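(* The set of $f\in C$ such that $\omega_1^{\mathbf S,f}=\omega_1^{\mathbf S}$ has $\mathbf m$-measure $1$.
   Context: $C=\{0,1\}^{\mathbb N}$, $\mathbf m$ the completed uniform product measure. The Suslin functional: $\mathbf S(g)=0$ if $\forall h\in\mathbb N^{\mathbb N}\exists n\,g(\bar h(n))=0$, and $1$ if $\exists h\forall n\,g(\bar h(n))>0$, $\bar h(n)=\langle h(0),\dots,h(n-1)\rangle$; computability is Kleene computability (S1–S9). $\omega_1^{\mathbf S}$ is the supremum of the ordinal ranks of terminating computations $\{e\}(\mathbf S,\vec a)=b$ with integer arguments only (the least recursively inaccessible ordinal); $\omega_1^{\mathbf S,f}$ is the corresponding ordinal relativised to $f$, i.e. the supremum of ranks of terminating computations $\{e\}(\mathbf S,\vec a,f)=b$ (equivalently the least ordinal not the order type of a well-ordering of a subset of $\mathbb N$ computable in $\mathbf S$ and $f$). *)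

theory Defs
  imports "HOL-Probability.Probability" "HOL-Library.Nat_Bijection"
begin

text \<open>kc F e as gs b  means  {e}(F, as, gs) = b, where F is the (fixed) type-2 argument,
  as the list of integer arguments and gs the list of type-1 arguments.
  Indices are codes  list_encode [clause, n, m, ...]  where n = length as, m = length gs.\<close>

inductive kc :: "((nat \<Rightarrow> nat) \<Rightarrow> nat) \<Rightarrow> nat \<Rightarrow> nat list \<Rightarrow> (nat \<Rightarrow> nat) list \<Rightarrow> nat \<Rightarrow> bool"
  for F :: "(nat \<Rightarrow> nat) \<Rightarrow> nat" where
  S1: "length as = n \<Longrightarrow> length gs = m \<Longrightarrow>
       kc F (list_encode [1, Suc n, m]) (x # as) gs (Suc x)"
| S2: "length as = n \<Longrightarrow> length gs = m \<Longrightarrow>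
       kc F (list_encode [2, n, m, q]) as gs q"
| S3: "length as = n \<Longrightarrow> length gs = m \<Longrightarrow>
       kc F (list_encode [3, Suc n, m]) (x # as) gs x"
| S4: "length as = n \<Longrightarrow> length gs = m \<Longrightarrow>
       kc F e2 as gs c \<Longrightarrow> kc F e1 (c # as) gs b \<Longrightarrow>
       kc F (list_encode [4, n, m, e1, e2]) as gs b"
| S5_0: "length as = n \<Longrightarrow> length gs = m \<Longrightarrow>
       kc F e1 as gs b \<Longrightarrow>
       kc F (list_encode [5, Suc n, m, e1, e2]) (0 # as) gs b"
| S5_Suc: "length as = n \<Longrightarrow> length gs = m \<Longrightarrow>
       kc F (list_encode [5, Suc n, m, e1, e2]) (x # as) gs c \<Longrightarrow>
       kc F e2 (c # x # as) gs b \<Longrightarrow>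
       kc F (list_encode [5, Suc n, m, e1, e2]) (Suc x # as) gs b"
| S6_num: "length as = n \<Longrightarrow> length gs = m \<Longrightarrow> Suc k < n \<Longrightarrow>
       kc F e1 (as[k := as ! Suc k, Suc k := as ! k]) gs b \<Longrightarrow>
       kc F (list_encode [6, n, m, 0, k, e1]) as gs b"
| S6_fun: "length as = n \<Longrightarrow> length gs = m \<Longrightarrow> Suc k < m \<Longrightarrow>
       kc F e1 as (gs[k := gs ! Suc k, Suc k := gs ! k]) b \<Longrightarrow>
       kc F (list_encode [6, n, m, 1, k, e1]) as gs b"
| S7: "length as = n \<Longrightarrow> length gs = m \<Longrightarrow>
       kc F (list_encode [7, Suc n, Suc m]) (x # as) (g # gs) (g x)"
| S8: "length as = n \<Longrightarrow> length gs = m \<Longrightarrow>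
       (\<forall>y. kc F e1 (y # as) gs (h y)) \<Longrightarrow>
       kc F (list_encode [8, n, m, e1]) as gs (F h)"
| S9: "length as = n \<Longrightarrow> length gs = m \<Longrightarrow>
       kc F d as gs b \<Longrightarrow>
       kc F (list_encode [9, Suc n, m]) (d # as) gs b"

definition seq_code :: "(nat \<Rightarrow> nat) \<Rightarrow> nat \<Rightarrow> nat" where
  "seq_code h n = list_encode (map h [0..<n])"

definition Suslin :: "(nat \<Rightarrow> nat) \<Rightarrow> nat" where
  "Suslin g = (if \<forall>h. \<exists>n. g (seq_code h n) = 0 then 0 else 1)"

definition comp_rel :: "((nat \<Rightarrow> nat) \<Rightarrow> nat) \<Rightarrow> (nat \<Rightarrow> nat) list \<Rightarrow> nat rel \<Rightarrow> bool" where
  "comp_rel F gs R = (\<exists>e. \<forall>a b. kc F e [a, b] gs (if (a, b) \<in> R then 0 else 1))"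

definition comp_wo :: "((nat \<Rightarrow> nat) \<Rightarrow> nat) \<Rightarrow> (nat \<Rightarrow> nat) list \<Rightarrow> nat rel \<Rightarrow> bool" where
  "comp_wo F gs R = (Well_order R \<and> comp_rel F gs R)"

text \<open>W (a well-order, considered up to order isomorphism) is the ordinal omega_1^{F,gs}:
  the least ordinal which is not the order type of a well-ordering of a subset of nat
  computable in F and gs.\<close>
definition is_omega1 :: "((nat \<Rightarrow> nat) \<Rightarrow> nat) \<Rightarrow> (nat \<Rightarrow> nat) list \<Rightarrow> nat rel \<Rightarrow> bool" where
  "is_omega1 F gs W = (Well_order W
     \<and> (\<forall>R. comp_wo F gs R \<longrightarrow> (R, W) \<notin> ordIso)
     \<and> (\<forall>V :: nat rel. Well_order V \<and> (V, W) \<in> ordLess \<longrightarrow>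
            (\<exists>R. comp_wo F gs R \<and> (R, V) \<in> ordIso)))"

definition cantor_measure :: "(nat \<Rightarrow> bool) measure" where
  "cantor_measure = completion (PiM UNIV (\<lambda>_. measure_pmf (pmf_of_set (UNIV :: bool set))))"

definition to_nat_fun :: "(nat \<Rightarrow> bool) \<Rightarrow> nat \<Rightarrow> nat" where
  "to_nat_fun f = (\<lambda>n. if f n then 1 else 0)"

end

theory Submission
  imports Defs
begin

text \<open>
  Kleene computations are run on a machine whose states have countably many children and a tail. The ranks of
  the convergent computations without function argument form \<open>\<omega>\<^sub>1\<close> of the Suslin functional, and stage comparison
  decides their order. For such a computation \<open>p\<close>, the event that a computation \<open>q\<close> in \<open>f\<close> has value \<open>b\<close> and rank
  at most that of \<open>p\<close> arises from the corresponding events for the immediate subcomputations of \<open>p\<close> by countable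
  unions and intersections, complements and one Suslin operation. So its measure is computable in the Suslin
  functional by recursion on \<open>p\<close>: a Suslin set has measure above \<open>r\<close> iff for some \<open>r' > r\<close> a single function
  \<open>g\<close> bounds branches such that all finite stages below \<open>g\<close> have measure at least \<open>r'\<close>.

  Suppose that with probability above \<open>r\<close> each child of \<open>q\<close> has rank below \<open>\<omega>\<^sub>1\<close>. Gandy selection yields,
  computably in \<open>y\<close>, some \<open>p\<close> that bounds the first \<open>y\<close> children with probability above \<open>r\<close>, and a single
  computation that runs all of these bounds all children with probability at least \<open>r\<close>. Hence almost surely no
  computation in \<open>f\<close> has rank \<open>\<omega>\<^sub>1\<close> or more, and recursion along a well-ordering computable in \<open>f\<close> bounds its
  length.
\<close>

section \<open>Kleene indices\<close>

text \<open>The obstacle is the branching of S8. For a single \<open>f\<close> each child of a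
  computation may have rank below \<open>\<omega>\<^sub>1\<close> while the supremum of these ranks
  is not below it: the sequence of bounds depends on \<open>f\<close> and need not be computable.
  Measure removes the dependence. A bound is sought for many \<open>f\<close> at once, and the test
  of a candidate, whether an event has measure above a fixed dyadic number, no longer mentions
  \<open>f\<close>. The tail of a node is one further computation and causes no such loss.

  The measures alone do not suffice for the recursion, since those of two events do not determine
  that of their union. So an event is carried by a name: a sequence of codes of clopen sets that
  approximates it, up to \<open>1 / 2 ^ k\<close>, in the measure of the symmetric difference.
  Countable unions converge without a computable rate, but the Suslin functional decides number
  quantifiers, so a sufficiently good approximation can be recognized in the limit. The bound
  \<open>g\<close> for a Suslin set is not constructed either: its existence has the form "some
  \<open>g\<close> for all \<open>n\<close>", which is one more application of the Suslin
  functional.\<close>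

abbreviation pr :: "nat \<Rightarrow> nat \<Rightarrow> nat" where
  "pr a b \<equiv> prod_encode (a, b)"

definition pf :: "nat \<Rightarrow> nat" where "pf z = fst (prod_decode z)"
definition ps :: "nat \<Rightarrow> nat" where "ps z = snd (prod_decode z)"

lemma pf_pr [simp]: "pf (pr a b) = a" and ps_pr [simp]: "ps (pr a b) = b"
  by (simp_all add: pf_def ps_def)

lemma pr_pf_ps [simp]: "pr (pf z) (ps z) = z"
  by (simp add: pf_def ps_def)

lemma pf_le: "pf z \<le> z" and ps_le: "ps z \<le> z"
  using le_prod_encode_1[of "pf z" "ps z"] le_prod_encode_2[of "ps z" "pf z"] by simp_all

context
  fixes gs :: "(nat \<Rightarrow> nat) list"
begin

definition kcs :: "nat \<Rightarrow> nat list \<Rightarrow> nat \<Rightarrow> bool" where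
  "kcs e as v = kc Suslin e as gs v"

definition run :: "nat \<Rightarrow> nat \<Rightarrow> nat \<Rightarrow> bool" where
  "run e x v = kc Suslin e [x] gs v"

lemma run_kcs: "run e x v = kcs e [x] v"
  by (simp add: run_def kcs_def)

lemma kcs_const: "\<exists>e. \<forall>as. length as = n \<longrightarrow> kcs e as q"
  unfolding kcs_def using kc.S2[of _ n gs "length gs"] by blast

lemma kcs_swap:
  assumes "Suc k < n"
  shows "\<exists>e'. \<forall>as v. length as = n \<longrightarrow> kcs e (as[k := as ! Suc k, Suc k := as ! k]) v \<longrightarrow> kcs e' as v"
  unfolding kcs_def using kc.S6_num[of _ n gs "length gs" k] assms by blast

lemma kcs_comp:
  "\<exists>e'. \<forall>as c v. length as = n \<longrightarrow> kcs e2 as c \<longrightarrow> kcs e1 (c # as) v \<longrightarrow> kcs e' as v"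
  unfolding kcs_def using kc.S4[of _ n gs "length gs"] by blast

text \<open>No clause discards an argument, but a primitive recursion that ignores its recursion argument does.\<close>

lemma kcs_drop_head:
  "\<exists>e'. \<forall>x as v. length as = n \<longrightarrow> kcs e as v \<longrightarrow> kcs e' (x # as) v"
proof -
  let ?e3 = "list_encode [3, Suc (Suc n), length gs]"
  let ?e' = "list_encode [5, Suc n, length gs, e, ?e3]"
  have "kcs ?e' (x # as) v" if "length as = n" "kcs e as v" for x as v
  proof (induct x)
    case 0
    then show ?case using that unfolding kcs_def by (intro kc.S5_0) auto
  next
    case (Suc x)
    then show ?case using that unfolding kcs_def
      by (intro kc.S5_Suc[where c = v] kc.S3) auto
  qed
  then show ?thesis by blast
qed

text \<open>S6 only transposes neighbours, so the entry travels to the front one place at a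
  time.\<close>

lemma kcs_move_front:
  "i < n \<Longrightarrow> \<exists>e'. \<forall>as v. length as = n \<longrightarrow> kcs e (as ! i # take i as @ drop (Suc i) as) v \<longrightarrow> kcs e' as v"
proof (induct i)
  case 0
  have "as ! 0 # take 0 as @ drop (Suc 0) as = as" if "length as = n" for as :: "nat list"
    using 0 that by (cases as) auto
  then show ?case by metis
next
  case (Suc i)
  then obtain e1 where e1: "\<And>as v. length as = n \<Longrightarrow>
     kcs e (as ! i # take i as @ drop (Suc i) as) v \<Longrightarrow> kcs e1 as v" by auto
  obtain e2 where e2: "\<And>as v. length as = n \<Longrightarrow>
     kcs e1 (as[i := as ! Suc i, Suc i := as ! i]) v \<Longrightarrow> kcs e2 as v"
    using kcs_swap[OF Suc.prems] by blast
  have "kcs e2 as v" if as: "length as = n"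
    and v: "kcs e (as ! Suc i # take (Suc i) as @ drop (Suc (Suc i)) as) v" for as v
  proof -
    let ?bs = "as[i := as ! Suc i, Suc i := as ! i]"
    have "?bs ! i = as ! Suc i" using as Suc.prems by simp
    moreover have "take i ?bs = take i as" by simp
    moreover have "drop (Suc i) ?bs = as ! i # drop (Suc (Suc i)) as"
      using as Suc.prems by (subst Cons_nth_drop_Suc[symmetric]) auto
    moreover have "take (Suc i) as = take i as @ [as ! i]"
      using as Suc.prems by (simp add: take_Suc_conv_app_nth)
    ultimately have eq: "?bs ! i # take i ?bs @ drop (Suc i) ?bs
       = as ! Suc i # take (Suc i) as @ drop (Suc (Suc i)) as" by (metis append.assoc append_Cons append_Nil)
    show ?thesis
      by (rule e2[OF as], rule e1) (use as v eq in simp_all)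
  qed
  then show ?case by blast
qed

lemma kcs_drop_nth:
  assumes "i \<le> n"
  shows "\<exists>e'. \<forall>as v. length as = Suc n \<longrightarrow> kcs e (take i as @ drop (Suc i) as) v \<longrightarrow> kcs e' as v"
proof -
  obtain e1 where e1: "\<And>x as v. length as = n \<Longrightarrow> kcs e as v \<Longrightarrow> kcs e1 (x # as) v"
    using kcs_drop_head by blast
  obtain e2 where e2: "\<And>as v. length as = Suc n \<Longrightarrow>
      kcs e1 (as ! i # take i as @ drop (Suc i) as) v \<Longrightarrow> kcs e2 as v"
    using kcs_move_front[of i "Suc n" e1] assms by auto
  have "kcs e2 as v" if "length as = Suc n" "kcs e (take i as @ drop (Suc i) as) v" for as v
    using that assms by (intro e2 e1) auto
  then show ?thesis by blast
qed

lemma kcs_take: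
  "\<exists>e'. \<forall>as v. length as = k + n \<longrightarrow> kcs e (take k as) v \<longrightarrow> kcs e' as v"
proof (induct n)
  case 0
  then show ?case by auto
next
  case (Suc n)
  then obtain e1 where e1: "\<And>as v. length as = k + n \<Longrightarrow> kcs e (take k as) v \<Longrightarrow> kcs e1 as v" by auto
  obtain e2 where e2: "\<And>as v. length as = Suc (k + n) \<Longrightarrow>
      kcs e1 (take k as @ drop (Suc k) as) v \<Longrightarrow> kcs e2 as v"
    using kcs_drop_nth[of k "k + n" e1] by auto
  have "kcs e2 as v" if "length as = k + Suc n" "kcs e (take k as) v" for as v
    using that by (intro e2 e1) auto
  then show ?case by blast
qed

lemma kcs_proj:
  assumes "i < n"
  shows "\<exists>e. \<forall>as. length as = n \<longrightarrow> kcs e as (as ! i)"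
proof -
  let ?e = "list_encode [3, n, length gs]"
  obtain e where e: "\<And>as v. length as = n \<Longrightarrow>
      kcs ?e (as ! i # take i as @ drop (Suc i) as) v \<Longrightarrow> kcs e as v"
    using kcs_move_front[OF assms, of ?e] by blast
  have "kcs e as (as ! i)" if "length as = n" for as
  proof (rule e[OF that])
    have "length (take i as @ drop (Suc i) as) = n - 1" using assms that by auto
    moreover have "n = Suc (n - 1)" using assms by simp
    ultimately show "kcs ?e (as ! i # take i as @ drop (Suc i) as) (as ! i)"
      unfolding kcs_def by (metis kc.S3)
  qed
  then show ?thesis by blast
qed

text \<open>S4 passes the inner value on together with all old arguments; \<open>kcs_take\<close>
  gets rid of these.\<close>

lemma kcs_call1:
  "\<exists>e'. \<forall>as c v. length as = n \<longrightarrow> kcs a as c \<longrightarrow> kcs e [c] v \<longrightarrow> kcs e' as v"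
proof -
  obtain e1 where e1: "\<And>as v. length as = Suc 0 + n \<Longrightarrow> kcs e (take (Suc 0) as) v \<Longrightarrow> kcs e1 as v"
    using kcs_take by blast
  obtain e2 where e2: "\<And>as c v. length as = n \<Longrightarrow> kcs a as c \<Longrightarrow> kcs e1 (c # as) v \<Longrightarrow> kcs e2 as v"
    using kcs_comp by blast
  have "kcs e2 as v" if "length as = n" "kcs a as c" "kcs e [c] v" for as c v
    using that by (intro e2[of as c] e1) auto
  then show ?thesis by blast
qed

lemma kcs_call2:
  "\<exists>e'. \<forall>as c d v. length as = n \<longrightarrow> kcs a as c \<longrightarrow> kcs b as d \<longrightarrow> kcs e [c, d] v \<longrightarrow> kcs e' as v"
proof -
  obtain a' where a': "\<And>x as v. length as = n \<Longrightarrow> kcs a as v \<Longrightarrow> kcs a' (x # as) v"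
    using kcs_drop_head by blast
  obtain e1 where e1: "\<And>as v. length as = 2 + n \<Longrightarrow> kcs e (take 2 as) v \<Longrightarrow> kcs e1 as v"
    using kcs_take by blast
  obtain e2 where e2: "\<And>as c v. length as = Suc n \<Longrightarrow> kcs a' as c \<Longrightarrow> kcs e1 (c # as) v \<Longrightarrow> kcs e2 as v"
    using kcs_comp by blast
  obtain e3 where e3: "\<And>as c v. length as = n \<Longrightarrow> kcs b as c \<Longrightarrow> kcs e2 (c # as) v \<Longrightarrow> kcs e3 as v"
    using kcs_comp by blast
  have "kcs e3 as v" if "length as = n" "kcs a as c" "kcs b as d" "kcs e [c, d] v" for as c d v
    using that by (intro e3[of as d] e2[of "d # as" c] e1 a') auto
  then show ?thesis by blast
qed

lemma kcs_primrec:
  "\<exists>e'. \<forall>as R n'. length as = n \<longrightarrow> kcs a as (R 0) \<longrightarrow>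
     (\<forall>x < n'. kcs b (R x # x # as) (R (Suc x))) \<longrightarrow> kcs e' (n' # as) (R n')"
proof -
  let ?e' = "list_encode [5, Suc n, length gs, a, b]"
  have "kcs ?e' (n' # as) (R n')" if "length as = n" "kcs a as (R 0)"
    "\<forall>x < n'. kcs b (R x # x # as) (R (Suc x))" for as R n'
    using that(3)
  proof (induct n')
    case 0
    then show ?case using that(1,2) unfolding kcs_def by (intro kc.S5_0) auto
  next
    case (Suc x)
    then show ?case using that(1,2) unfolding kcs_def
      by (intro kc.S5_Suc[where c = "R x"]) auto
  qed
  then show ?thesis by blast
qed

lemma len1: "length as = Suc 0 \<Longrightarrow> \<exists>x. as = [x]"
  and len2: "length as = Suc (Suc 0) \<Longrightarrow> \<exists>x y. as = [x, y]"
  by (auto simp: length_Suc_conv)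

section \<open>Total number functions with an index, up to the inverse of the pairing\<close>

definition tf :: "nat \<Rightarrow> (nat list \<Rightarrow> nat) \<Rightarrow> bool" where
  "tf n f = (\<exists>e. \<forall>as. length as = n \<longrightarrow> kcs e as (f as))"

lemma tf_const: "tf n (\<lambda>_. c)"
  unfolding tf_def by (rule kcs_const)

lemma tf_proj: "i < n \<Longrightarrow> tf n (\<lambda>as. as ! i)"
  unfolding tf_def by (rule kcs_proj)

lemma tf_Suc0: "tf (Suc 0) (\<lambda>as. Suc (as ! 0))"
proof -
  have "kcs (list_encode [1, Suc 0, length gs]) as (Suc (as ! 0))" if l: "length as = Suc 0" for as
  proof -
    obtain x where "as = [x]" using len1 l by blast
    then show ?thesis unfolding kcs_def using kc.S1[of "[]" 0 gs "length gs" Suslin x] by simp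
  qed
  then show ?thesis unfolding tf_def by blast
qed

lemma tf_comp1: "tf (Suc 0) (\<lambda>as. f (as ! 0)) \<Longrightarrow> tf n a \<Longrightarrow> tf n (\<lambda>as. f (a as))"
proof -
  assume "tf (Suc 0) (\<lambda>as. f (as ! 0))" "tf n a"
  then obtain e1 e2 where e: "\<And>as. length as = Suc 0 \<Longrightarrow> kcs e1 as (f (as ! 0))"
    "\<And>as. length as = n \<Longrightarrow> kcs e2 as (a as)"
    unfolding tf_def by blast
  obtain e' where e': "\<And>as c v. length as = n \<Longrightarrow> kcs e2 as c \<Longrightarrow> kcs e1 [c] v \<Longrightarrow> kcs e' as v"
    using kcs_call1 by blast
  have "kcs e' as (f (a as))" if as: "length as = n" for as
    by (rule e'[OF as e(2)[OF as]]) (use e(1)[of "[a as]"] in simp)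
  then show ?thesis unfolding tf_def by blast
qed

lemma tf_comp2: "tf (Suc (Suc 0)) (\<lambda>as. f (as ! 0) (as ! 1)) \<Longrightarrow> tf n a \<Longrightarrow> tf n b \<Longrightarrow> tf n (\<lambda>as. f (a as) (b as))"
proof -
  assume "tf (Suc (Suc 0)) (\<lambda>as. f (as ! 0) (as ! 1))" "tf n a" "tf n b"
  then obtain e1 e2 e3 where e: "\<And>as. length as = Suc (Suc 0) \<Longrightarrow> kcs e1 as (f (as ! 0) (as ! 1))"
    "\<And>as. length as = n \<Longrightarrow> kcs e2 as (a as)" "\<And>as. length as = n \<Longrightarrow> kcs e3 as (b as)"
    unfolding tf_def by blast
  obtain e' where "\<And>as c d v. length as = n \<Longrightarrow> kcs e2 as c \<Longrightarrow> kcs e3 as d \<Longrightarrow> kcs e1 [c, d] v \<Longrightarrow> kcs e' as v"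
    using kcs_call2 by blast
  note e' = this
  have "kcs e' as (f (a as) (b as))" if as: "length as = n" for as
    by (rule e'[OF as e(2)[OF as] e(3)[OF as]]) (use e(1)[of "[a as, b as]"] in simp)
  then show ?thesis unfolding tf_def by blast
qed

lemma tf_primrec:
  assumes "tf n a" "tf (Suc (Suc n)) b"
    "\<And>as. length as = n \<Longrightarrow> R 0 as = a as"
    "\<And>as x. length as = n \<Longrightarrow> R (Suc x) as = b (R x as # x # as)"
  shows "tf (Suc n) (\<lambda>as. R (hd as) (tl as))"
proof -
  obtain e1 e2 where e: "\<And>as. length as = n \<Longrightarrow> kcs e1 as (a as)"
    "\<And>as. length as = Suc (Suc n) \<Longrightarrow> kcs e2 as (b as)"
    using assms(1,2) unfolding tf_def by blast
  obtain e' where e': "\<And>as R n'. length as = n \<Longrightarrow> kcs e1 as (R 0) \<Longrightarrow>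
     (\<forall>x < n'. kcs e2 (R x # x # as) (R (Suc x))) \<Longrightarrow> kcs e' (n' # as) (R n')"
    using kcs_primrec by blast
  have "kcs e' as (R (hd as) (tl as))" if l: "length as = Suc n" for as
  proof -
    obtain x bs where as: "as = x # bs" "length bs = n" using l by (auto simp: length_Suc_conv)
    show ?thesis unfolding as list.sel
      by (rule e'[of bs "\<lambda>x. R x bs" x, OF as(2)])
        (use e(1)[OF as(2)] e(2) assms(3,4)[OF as(2)] as(2) in auto)
  qed
  then show ?thesis unfolding tf_def by blast
qed

lemma tf_cong: "tf n f \<Longrightarrow> (\<And>as. length as = n \<Longrightarrow> f as = g as) \<Longrightarrow> tf n g"
  unfolding tf_def by metis

lemma tf_Suc: "tf n a \<Longrightarrow> tf n (\<lambda>as. Suc (a as))"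
  by (rule tf_comp1[OF tf_Suc0])

lemma tf_add: "tf n a \<Longrightarrow> tf n b \<Longrightarrow> tf n (\<lambda>as. a as + b as)"
proof (rule tf_comp2[where f = "(+)"])
  have "tf (Suc (Suc 0)) (\<lambda>as. (\<lambda>x as. x + as ! 0) (hd as) (tl as))"
    by (rule tf_primrec[where a = "\<lambda>as. as ! 0" and b = "\<lambda>as. Suc (as ! 0)"])
      (auto intro!: tf_Suc tf_proj)
  then show "tf (Suc (Suc 0)) (\<lambda>as. as ! 0 + as ! 1)"
    by (rule tf_cong[of "Suc (Suc 0)"]) (auto dest!: len2)
qed

lemma tf_pred: "tf n a \<Longrightarrow> tf n (\<lambda>as. a as - 1)"
proof (rule tf_comp1[where f = "\<lambda>x. x - 1"])
  have "tf (Suc 0) (\<lambda>as. (\<lambda>x as. x - 1) (hd as) (tl as))"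
    by (rule tf_primrec[where a = "\<lambda>as. 0" and b = "\<lambda>as. as ! 1"])
      (auto intro!: tf_const tf_proj)
  then show "tf (Suc 0) (\<lambda>as. as ! 0 - 1)"
    by (rule tf_cong[of "Suc 0"]) (auto dest!: len1)
qed

lemma tf_diff: "tf n a \<Longrightarrow> tf n b \<Longrightarrow> tf n (\<lambda>as. a as - b as)"
proof -
  have "tf (Suc (Suc 0)) (\<lambda>as. (\<lambda>x as. as ! 0 - x) (hd as) (tl as))"
    by (rule tf_primrec[where a = "\<lambda>as. as ! 0" and b = "\<lambda>as. as ! 0 - 1"])
      (auto intro!: tf_pred[unfolded One_nat_def] tf_proj)
  then have "tf (Suc (Suc 0)) (\<lambda>as. as ! 1 - as ! 0)"
    by (rule tf_cong[of "Suc (Suc 0)"]) (auto dest!: len2)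
  then show "tf n a \<Longrightarrow> tf n b \<Longrightarrow> tf n (\<lambda>as. a as - b as)"
    by (rule tf_comp2[where f = "\<lambda>y x. x - y"])
qed

lemma tf_ifz: "tf n a \<Longrightarrow> tf n b \<Longrightarrow> tf n c \<Longrightarrow> tf n (\<lambda>as. if a as = 0 then b as else c as)"
proof -
  assume *: "tf n a" "tf n b" "tf n c"
  have "tf (Suc (Suc 0)) (\<lambda>as. (\<lambda>x as. if x = 0 then as ! 0 else 0) (hd as) (tl as))"
    by (rule tf_primrec[where a = "\<lambda>as. as ! 0" and b = "\<lambda>as. 0"]) (auto intro!: tf_proj tf_const)
  then have "tf (Suc (Suc 0)) (\<lambda>as. if as ! 0 = 0 then as ! 1 else 0)"
    by (rule tf_cong[of "Suc (Suc 0)"]) (auto dest!: len2)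
  note sel = tf_comp2[where f = "\<lambda>x y. if x = 0 then y else 0", OF this]
  have "tf n (\<lambda>as. (if a as = 0 then b as else 0) + (if 1 - a as = 0 then c as else 0))"
    by (intro tf_add sel tf_diff tf_const *)
  then show ?thesis by (rule tf_cong) auto
qed

lemma tf_triangle: "tf n a \<Longrightarrow> tf n (\<lambda>as. triangle (a as))"
proof (rule tf_comp1[where f = triangle])
  have "tf (Suc 0) (\<lambda>as. (\<lambda>x as. triangle x) (hd as) (tl as))"
    by (rule tf_primrec[where a = "\<lambda>as. 0" and b = "\<lambda>as. as ! 0 + Suc (as ! 1)"])
      (auto intro!: tf_const tf_proj tf_add tf_Suc simp del: add_Suc_right)
  then show "tf (Suc 0) (\<lambda>as. triangle (as ! 0))"
    by (rule tf_cong[of "Suc 0"]) (auto dest!: len1)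
qed

lemma tf_pr: "tf n a \<Longrightarrow> tf n b \<Longrightarrow> tf n (\<lambda>as. pr (a as) (b as))"
  unfolding prod_encode_def prod.case by (intro tf_add tf_triangle)

lemma diag_unique:
  assumes "triangle s \<le> z" "z < triangle (Suc s)"
  shows "pf z = z - triangle s" "pf z + ps z = s"
proof -
  have "prod_encode (z - triangle s, s - (z - triangle s)) = z"
    using assms by (simp add: prod_encode_def)
  then have "pf z = z - triangle s" "ps z = s - (z - triangle s)"
    by (metis pf_pr, metis ps_pr)
  then show "pf z = z - triangle s" "pf z + ps z = s" using assms by simp_all
qed

lemma diag_bounds: "triangle (pf z + ps z) \<le> z" "z < triangle (Suc (pf z + ps z))"
proof -
  have "z = triangle (pf z + ps z) + pf z"
    using pr_pf_ps[of z] by (simp add: prod_encode_def)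
  then show "triangle (pf z + ps z) \<le> z" "z < triangle (Suc (pf z + ps z))"
    unfolding triangle_Suc by linarith+
qed

text \<open>The pairing enumerates diagonals, and the diagonal number grows exactly when
  \<open>Suc z\<close> reaches the next triangular number. Truncated subtraction makes this test a
  term, which gives a primitive recursion for the inverse of the pairing.\<close>

lemma diag_Suc: "pf (Suc z) + ps (Suc z) =
  (pf z + ps z) + (1 - (triangle (Suc (pf z + ps z)) - Suc z))"
proof -
  let ?s = "pf z + ps z"
  note b = diag_bounds[of z]
  show ?thesis
  proof (cases "triangle (Suc ?s) \<le> Suc z")
    case True
    then have "pf (Suc z) + ps (Suc z) = Suc ?s" using b
      by (intro diag_unique(2)) (simp_all del: triangle_Suc, simp)
    then show ?thesis using True by simp
  next
    case False
    then have "pf (Suc z) + ps (Suc z) = ?s" using b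
      by (intro diag_unique(2)) simp_all
    then show ?thesis using False by simp
  qed
qed

lemma tf_diag: "tf n a \<Longrightarrow> tf n (\<lambda>as. pf (a as) + ps (a as))"
proof (rule tf_comp1[where f = "\<lambda>x. pf x + ps x"])
  have 0: "pf 0 = 0" "ps 0 = 0" using pf_le[of 0] ps_le[of 0] by simp_all
  have "tf (Suc 0) (\<lambda>as. (\<lambda>x as. pf x + ps x) (hd as) (tl as))"
    by (rule tf_primrec[where a = "\<lambda>as. 0" and
          b = "\<lambda>as. as ! 0 + (1 - (triangle (Suc (as ! 0)) - Suc (as ! 1)))"])
      (auto intro!: tf_const tf_proj tf_add tf_Suc tf_diff tf_triangle simp: diag_Suc 0
        simp del: add_Suc_right triangle_Suc One_nat_def)
  then show "tf (Suc 0) (\<lambda>as. pf (as ! 0) + ps (as ! 0))"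
    by (rule tf_cong[of "Suc 0"]) (auto dest!: len1)
qed

lemma tf_pf: "tf n a \<Longrightarrow> tf n (\<lambda>as. pf (a as))"
proof -
  assume a: "tf n a"
  have "pf x = x - triangle (pf x + ps x)" for x
    using diag_bounds[of x] diag_unique(1) by blast
  then show ?thesis using tf_diff[OF a tf_triangle[OF tf_diag[OF a]]] by simp
qed

lemma tf_ps: "tf n a \<Longrightarrow> tf n (\<lambda>as. ps (a as))"
  using tf_diff[OF tf_diag tf_pf, of n a a] by simp

end

section \<open>Computable functionals\<close>

text \<open>The default 0 makes minimization total. The case without a witness is detectable,
  because the Suslin functional decides existence.\<close>

definition minimize :: "(nat \<Rightarrow> bool) \<Rightarrow> nat" where
  "minimize Q = (if \<exists>n. Q n then LEAST n. Q n else 0)"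

lemma minimizeI: "\<exists>n. Q n \<Longrightarrow> Q (minimize Q)"
  unfolding minimize_def by (auto intro: LeastI)

text \<open>Applying the Suslin functional reads the whole oracle, so the lift to a partial oracle
  is defined only where that oracle is total.\<close>

definition olift :: "((nat \<Rightarrow> nat) \<Rightarrow> nat \<Rightarrow> nat) \<Rightarrow> (nat \<Rightarrow> nat option) \<Rightarrow> nat \<Rightarrow> nat option" where
  "olift \<phi> g x = (if \<forall>n. g n \<noteq> None then Some (\<phi> (\<lambda>n. the (g n)) x) else None)"

lemma olift_Some: "(\<And>n. g n = Some (h n)) \<Longrightarrow> olift \<phi> g x = Some (\<phi> h x)"
  unfolding olift_def by simp

context
  fixes gs :: "(nat \<Rightarrow> nat) list"
begin

lemma run_tf:
  assumes "tf gs (Suc 0) f"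
  shows "\<exists>E. \<forall>x. run gs E x (f [x])"
  using assms unfolding tf_def run_kcs by (metis length_Cons list.size(3))

lemma run_kcs2: "\<exists>E. \<forall>x c d v. run gs a x c \<longrightarrow> run gs b x d \<longrightarrow> kcs gs e [c, d] v \<longrightarrow> run gs E x v"
  using kcs_call2[of "Suc 0" gs a b e] unfolding run_kcs by (metis length_Cons list.size(3))

lemma run_tf2:
  assumes "tf gs (Suc (Suc 0)) f"
  shows "\<exists>E. \<forall>x c d. run gs a x c \<longrightarrow> run gs b x d \<longrightarrow> run gs E x (f [c, d])"
proof -
  obtain e where "\<And>as. length as = Suc (Suc 0) \<Longrightarrow> kcs gs e as (f as)"
    using assms unfolding tf_def by blast
  then have "kcs gs e [c, d] (f [c, d])" for c d by simp
  then show ?thesis using run_kcs2[of a b e] by blast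
qed

lemma kcs_rearrange:
  assumes "tf gs n f"
  shows "\<exists>E. \<forall>as v. length as = n \<longrightarrow> run gs e (f as) v \<longrightarrow> kcs gs E as v"
proof -
  obtain a where a: "\<And>as. length as = n \<Longrightarrow> kcs gs a as (f as)"
    using assms unfolding tf_def by blast
  show ?thesis using kcs_call1[of n gs a e] a unfolding run_kcs by blast
qed

text \<open>From here on \<open>SOME\<close> turns existence lemmas into terms: each combinator is
  an arbitrary index with the required behaviour, so that programs can be composed as terms.\<close>

definition ifun :: "(nat \<Rightarrow> nat) \<Rightarrow> nat" where
  "ifun f = (SOME E. \<forall>x. run gs E x (f x))"

lemma run_ifun: "tf gs (Suc 0) (\<lambda>as. f (as ! 0)) \<Longrightarrow> run gs (ifun f) x (f x)"
  unfolding ifun_def using someI_ex[OF run_tf[of "\<lambda>as. f (as ! 0)"]] by simp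

lemma run_ifst: "run gs (ifun pf) (pr a b) a" and run_isnd: "run gs (ifun ps) (pr a b) b"
  and run_const: "run gs (ifun (\<lambda>_. c)) x c" and run_id: "run gs (ifun (\<lambda>x. x)) x x"
  and run_Suc: "run gs (ifun Suc) x (Suc x)"
  using run_ifun[of pf "pr a b"] run_ifun[of ps "pr a b"] run_ifun[of "\<lambda>_. c" x]
    run_ifun[of "\<lambda>x. x" x] run_ifun[of Suc x]
  by (simp_all add: tf_pf tf_ps tf_proj tf_const tf_Suc)

definition icomp :: "nat \<Rightarrow> nat \<Rightarrow> nat" where
  "icomp a b = (SOME E. \<forall>x c v. run gs b x c \<longrightarrow> run gs a c v \<longrightarrow> run gs E x v)"

lemma run_icomp: "run gs b x c \<Longrightarrow> run gs a c v \<Longrightarrow> run gs (icomp a b) x v"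
proof -
  have "\<exists>E. \<forall>x c v. run gs b x c \<longrightarrow> run gs a c v \<longrightarrow> run gs E x v"
    using kcs_call1[of "Suc 0" gs b a] unfolding run_kcs by (metis length_Cons list.size(3))
  then show "run gs b x c \<Longrightarrow> run gs a c v \<Longrightarrow> ?thesis" unfolding icomp_def by (rule someI2_ex) blast
qed

definition ipair :: "nat \<Rightarrow> nat \<Rightarrow> nat" where
  "ipair a b = (SOME E. \<forall>x c d. run gs a x c \<longrightarrow> run gs b x d \<longrightarrow> run gs E x (pr c d))"

lemma run_ipair: "run gs a x c \<Longrightarrow> run gs b x d \<Longrightarrow> run gs (ipair a b) x (pr c d)"
proof -
  have "tf gs (Suc (Suc 0)) (\<lambda>as. pr (as ! 0) (as ! 1))" by (intro tf_pr tf_proj) auto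
  from run_tf2[OF this, of a b]
  have "\<exists>E. \<forall>x c d. run gs a x c \<longrightarrow> run gs b x d \<longrightarrow> run gs E x (pr c d)" by simp
  then show "run gs a x c \<Longrightarrow> run gs b x d \<Longrightarrow> ?thesis" unfolding ipair_def by (rule someI2_ex) blast
qed

definition icall :: "nat \<Rightarrow> nat \<Rightarrow> nat" where
  "icall a b = (SOME E. \<forall>x d y v. run gs a x d \<longrightarrow> run gs b x y \<longrightarrow> run gs d y v \<longrightarrow> run gs E x v)"

lemma run_icall: "run gs a x d \<Longrightarrow> run gs b x y \<Longrightarrow> run gs d y v \<Longrightarrow> run gs (icall a b) x v"
proof -
  let ?e = "list_encode [9, Suc (Suc 0), length gs]"
  have "kcs gs ?e [d, y] v" if "run gs d y v" for d y v
    using that unfolding kcs_def run_def by (intro kc.S9) auto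
  then have "\<exists>E. \<forall>x d y v. run gs a x d \<longrightarrow> run gs b x y \<longrightarrow> run gs d y v \<longrightarrow> run gs E x v"
    using run_kcs2[of a b ?e] by blast
  then show "run gs a x d \<Longrightarrow> run gs b x y \<Longrightarrow> run gs d y v \<Longrightarrow> ?thesis"
    unfolding icall_def by (rule someI2_ex) blast
qed

definition iSuslin :: "nat \<Rightarrow> nat" where
  "iSuslin e = (SOME E. \<forall>x h. (\<forall>y. run gs e (pr y x) (h y)) \<longrightarrow> run gs E x (Suslin h))"

lemma run_iSuslin: "(\<And>y. run gs e (pr y x) (h y)) \<Longrightarrow> run gs (iSuslin e) x (Suslin h)"
proof -
  have "tf gs (Suc (Suc 0)) (\<lambda>as. pr (as ! 0) (as ! 1))" by (intro tf_pr tf_proj) auto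
  from kcs_rearrange[OF this, of e]
  obtain E where E: "\<And>as v. length as = Suc (Suc 0) \<Longrightarrow> run gs e (pr (as ! 0) (as ! 1)) v \<Longrightarrow> kcs gs E as v"
    by blast
  have "run gs (list_encode [8, Suc 0, length gs, E]) x (Suslin h)"
    if "\<forall>y. run gs e (pr y x) (h y)" for x h
    unfolding run_def using that E[of "[_, x]"] unfolding kcs_def
    by (intro kc.S8) auto
  then have "\<exists>E. \<forall>x h. (\<forall>y. run gs e (pr y x) (h y)) \<longrightarrow> run gs E x (Suslin h)" by blast
  then show "(\<And>y. run gs e (pr y x) (h y)) \<Longrightarrow> ?thesis" unfolding iSuslin_def by (rule someI2_ex) blast
qed

text \<open>The s-m-n theorem. The specialized index \<open>?d x\<close> composes \<open>g\<close>
  with the constant clause S2, and its code depends on \<open>x\<close> only through list coding,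
  which is covered by \<open>tf\<close>.\<close>

lemma ex_curry: "\<exists>E d. \<forall>x. run gs E x (d x) \<and> (\<forall>y v. run gs e (pr y x) v \<longrightarrow> run gs (d x) y v)"
proof -
  have "tf gs (Suc (Suc 0)) (\<lambda>as. pr (as ! 1) (as ! 0))" by (intro tf_pr tf_proj) auto
  from kcs_rearrange[OF this, of e]
  obtain g where g: "\<And>as v. length as = Suc (Suc 0) \<Longrightarrow> run gs e (pr (as ! 1) (as ! 0)) v \<Longrightarrow> kcs gs g as v"
    by blast
  let ?m = "length gs"
  let ?d = "\<lambda>x. list_encode [4, Suc 0, ?m, g, list_encode [2, Suc 0, ?m, x]]"
  have "tf gs (Suc 0) (\<lambda>as. ?d (as ! 0))"
    unfolding list_encode.simps by (intro tf_Suc tf_pr tf_const tf_proj) simp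
  then have E: "run gs (ifun ?d) x (?d x)" for x by (rule run_ifun)
  have "run gs (?d x) y v" if "run gs e (pr y x) v" for x y v
    unfolding run_def using g[of "[x, y]" v] that unfolding kcs_def
    by (intro kc.S4[where c = x] kc.S2) auto
  then show ?thesis using E by (intro exI[of _ "ifun ?d"] exI[of _ ?d]) blast
qed

definition icurry :: "nat \<Rightarrow> nat" where
  "icurry e = (SOME E. \<exists>d. \<forall>x. run gs E x (d x) \<and> (\<forall>y v. run gs e (pr y x) v \<longrightarrow> run gs (d x) y v))"

definition iapp :: "nat \<Rightarrow> nat \<Rightarrow> nat" where
  "iapp e = (SOME d. \<forall>x. run gs (icurry e) x (d x) \<and> (\<forall>y v. run gs e (pr y x) v \<longrightarrow> run gs (d x) y v))"

lemma run_icurry: "run gs (icurry e) x (iapp e x)"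
  and run_iapp: "run gs e (pr y x) v \<Longrightarrow> run gs (iapp e x) y v"
  using someI_ex[OF someI_ex[OF ex_curry], of e] unfolding iapp_def icurry_def by blast+

text \<open>The test selects an index and S9 runs only that one; the other branch may diverge. This
  is what a sum of guarded terms, as in \<open>tf_ifz\<close>, cannot offer.\<close>

definition icond :: "nat \<Rightarrow> nat \<Rightarrow> nat \<Rightarrow> nat" where
  "icond q a b = icall (icomp (ifun (\<lambda>c. if c = 0 then a else b)) q) (ifun (\<lambda>x. x))"

lemma run_icond: "run gs q x c \<Longrightarrow> run gs (if c = 0 then a else b) x v \<Longrightarrow> run gs (icond q a b) x v"
proof -
  have "run gs (ifun (\<lambda>c. if c = 0 then a else b)) c (if c = 0 then a else b)"
    by (rule run_ifun) (intro tf_ifz tf_proj tf_const, simp)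
  then show "run gs q x c \<Longrightarrow> run gs (if c = 0 then a else b) x v \<Longrightarrow> ?thesis"
    unfolding icond_def using run_icall[OF run_icomp run_id] by blast
qed

text \<open>Kleene's recursion theorem: \<open>irec e\<close> is the self-application of the function
  \<open>u \<mapsto> {x \<mapsto> {e}({u}(u), x)}\<close>.\<close>

definition irec :: "nat \<Rightarrow> nat" where
  "irec e = (let b = icomp e (ipair (icall (ifun ps) (ifun ps)) (ifun pf)) in iapp b (icurry b))"

lemma run_irec: "run gs e (pr (irec e) x) v \<Longrightarrow> run gs (irec e) x v"
  unfolding irec_def Let_def
  by (rule run_iapp, rule run_icomp[OF run_ipair[OF run_icall[OF run_isnd run_isnd run_icurry] run_ifst]])

section \<open>Functionals of a total oracle\<close>

definition answers :: "nat \<Rightarrow> (nat \<Rightarrow> nat) \<Rightarrow> bool" where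
  "answers e \<nu> = (\<forall>n. run gs e n (\<nu> n))"

text \<open>The oracle enters as an index of a program for it, paired with the argument. A
  functional thus becomes a unary program that is uniform in that index.\<close>

definition realizes :: "nat \<Rightarrow> ((nat \<Rightarrow> nat) \<Rightarrow> nat \<Rightarrow> nat) \<Rightarrow> bool" where
  "realizes E \<phi> = (\<forall>e \<nu> x. answers e \<nu> \<longrightarrow> run gs E (pr e x) (\<phi> \<nu> x))"

definition computable :: "((nat \<Rightarrow> nat) \<Rightarrow> nat \<Rightarrow> nat) \<Rightarrow> bool" where
  "computable \<phi> = (\<exists>E. realizes E \<phi>)"

lemma answersD: "answers e \<nu> \<Longrightarrow> run gs e n (\<nu> n)"
  unfolding answers_def by blast

lemma realizesD: "realizes E \<phi> \<Longrightarrow> answers e \<nu> \<Longrightarrow> run gs E (pr e x) (\<phi> \<nu> x)"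
  unfolding realizes_def by blast

lemma computable_I: "(\<And>e \<nu> x. answers e \<nu> \<Longrightarrow> run gs E (pr e x) (\<phi> \<nu> x)) \<Longrightarrow> computable \<phi>"
  unfolding computable_def realizes_def by blast

lemma computable_tf: "tf gs (Suc 0) (\<lambda>as. f (as ! 0)) \<Longrightarrow> computable a \<Longrightarrow> computable (\<lambda>\<nu> x. f (a \<nu> x))"
proof -
  assume f: "tf gs (Suc 0) (\<lambda>as. f (as ! 0))" and "computable a"
  then obtain A where A: "realizes A a" unfolding computable_def by blast
  show ?thesis by (rule computable_I, rule run_icomp[OF realizesD[OF A] run_ifun[OF f]])
qed

lemma computable_tf2: "tf gs (Suc (Suc 0)) (\<lambda>as. f (as ! 0) (as ! 1)) \<Longrightarrow> computable a \<Longrightarrow> computable b \<Longrightarrow> computable (\<lambda>\<nu> x. f (a \<nu> x) (b \<nu> x))"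
proof -
  assume f: "tf gs (Suc (Suc 0)) (\<lambda>as. f (as ! 0) (as ! 1))" and "computable a" "computable b"
  then obtain A B where AB: "realizes A a" "realizes B b" unfolding computable_def by blast
  from run_tf2[OF f] obtain E where "\<And>x c d. run gs A x c \<Longrightarrow> run gs B x d \<Longrightarrow> run gs E x (f c d)" by fastforce
  then show ?thesis using realizesD[OF AB(1)] realizesD[OF AB(2)] by (intro computable_I[of E]) blast
qed

lemma computable_ps0: "computable (\<lambda>\<nu> x. x)"
  by (rule computable_I, rule run_isnd)

lemma computable_const: "computable (\<lambda>\<nu> x. c)"
  by (rule computable_I, rule run_const)

lemma computable_Suc: "computable a \<Longrightarrow> computable (\<lambda>\<nu> x. Suc (a \<nu> x))"
  by (rule computable_tf) (auto intro!: tf_Suc tf_proj)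

lemma computable_pf: "computable a \<Longrightarrow> computable (\<lambda>\<nu> x. pf (a \<nu> x))"
  by (rule computable_tf) (auto intro!: tf_pf tf_proj)

lemma computable_ps: "computable a \<Longrightarrow> computable (\<lambda>\<nu> x. ps (a \<nu> x))"
  by (rule computable_tf) (auto intro!: tf_ps tf_proj)

lemma computable_add: "computable a \<Longrightarrow> computable b \<Longrightarrow> computable (\<lambda>\<nu> x. a \<nu> x + b \<nu> x)"
  by (rule computable_tf2[where f = "(+)"]) (auto intro!: tf_add tf_proj)

lemma computable_diff: "computable a \<Longrightarrow> computable b \<Longrightarrow> computable (\<lambda>\<nu> x. a \<nu> x - b \<nu> x)"
  by (rule computable_tf2[where f = "(-)"]) (auto intro!: tf_diff tf_proj)

lemma computable_pr: "computable a \<Longrightarrow> computable b \<Longrightarrow> computable (\<lambda>\<nu> x. pr (a \<nu> x) (b \<nu> x))"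
  by (rule computable_tf2[where f = pr]) (auto intro!: tf_pr tf_proj)

lemma computable_query: "computable a \<Longrightarrow> computable (\<lambda>\<nu> x. \<nu> (a \<nu> x))"
proof -
  assume "computable a"
  then obtain A where A: "realizes A a" unfolding computable_def by blast
  show ?thesis
  proof (rule computable_I)
    show "run gs (icall (ifun pf) A) (pr e x) (\<nu> (a \<nu> x))" if e: "answers e \<nu>" for e \<nu> x
      by (rule run_icall[OF run_ifst realizesD[OF A e] answersD[OF e]])
  qed
qed

lemma computable_comp: "computable \<phi> \<Longrightarrow> computable a \<Longrightarrow> computable (\<lambda>\<nu> x. \<phi> \<nu> (a \<nu> x))"
proof -
  assume "computable \<phi>" "computable a"
  then obtain F A where F: "realizes F \<phi>" and A: "realizes A a" unfolding computable_def by blast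
  show ?thesis
  proof (rule computable_I)
    show "run gs (icomp F (ipair (ifun pf) A)) (pr e x) (\<phi> \<nu> (a \<nu> x))" if e: "answers e \<nu>" for e \<nu> x
      by (rule run_icomp[OF run_ipair[OF run_ifst realizesD[OF A e]] realizesD[OF F e]])
  qed
qed

text \<open>For each \<open>x\<close> the s-m-n theorem supplies an index of the inner function, and
  this index is the oracle for \<open>\<phi>\<close>.\<close>

lemma computable_sub:
  assumes "computable \<phi>" "computable (\<lambda>\<nu> z. \<psi> \<nu> (pf z) (ps z))" "computable a"
  shows "computable (\<lambda>\<nu> x. \<phi> (\<lambda>n. \<psi> \<nu> n x) (a \<nu> x))"
proof -
  obtain F P A where F: "realizes F \<phi>" and P: "realizes P (\<lambda>\<nu> z. \<psi> \<nu> (pf z) (ps z))" and A: "realizes A a"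
    using assms unfolding computable_def by blast
  let ?r = "ipair (icomp (ifun pf) (ifun ps)) (ipair (ifun pf) (icomp (ifun ps) (ifun ps)))"
  let ?c = "icomp P ?r"
  show ?thesis
  proof (rule computable_I)
    fix e \<nu> x assume e: "answers e \<nu>"
    have "run gs ?r (pr n (pr e x)) (pr e (pr n x))" for n
      by (rule run_ipair run_icomp run_ifst run_isnd)+
    then have "answers (iapp ?c (pr e x)) (\<lambda>n. \<psi> \<nu> n x)"
      unfolding answers_def using realizesD[OF P e, of "pr _ x"] by (auto intro: run_iapp run_icomp)
    then show "run gs (icomp F (ipair (icurry ?c) A)) (pr e x) (\<phi> (\<lambda>n. \<psi> \<nu> n x) (a \<nu> x))"
      by (intro run_icomp[OF run_ipair[OF run_icurry realizesD[OF A e]]] realizesD[OF F])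
  qed
qed

lemma computable_Suslin:
  assumes "computable (\<lambda>\<nu> z. P \<nu> (pf z) (ps z))"
  shows "computable (\<lambda>\<nu> x. Suslin (\<lambda>n. P \<nu> n x))"
proof -
  have "computable (\<lambda>\<nu> x. Suslin \<nu>)"
  proof (rule computable_I, rule run_iSuslin)
    show "answers e \<nu> \<Longrightarrow> run gs (icall (icomp (ifun pf) (ifun ps)) (ifun pf)) (pr y (pr e x)) (\<nu> y)" for e \<nu> x y
      by (rule run_icall[OF run_icomp[OF run_isnd run_ifst] run_ifst answersD])
  qed
  from computable_sub[OF this assms computable_const] show ?thesis .
qed

abbreviation decidable :: "((nat \<Rightarrow> nat) \<Rightarrow> nat \<Rightarrow> bool) \<Rightarrow> bool" where
  "decidable Q \<equiv> computable (\<lambda>\<nu> x. of_bool (Q \<nu> x))"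

lemma computable_ifz:
  assumes "computable q" "computable a" "computable b"
  shows "computable (\<lambda>\<nu> x. if q \<nu> x = 0 then a \<nu> x else b \<nu> x)"
proof -
  obtain Q A B where Q: "realizes Q q" and A: "realizes A a" and B: "realizes B b"
    using assms unfolding computable_def by blast
  show ?thesis
  proof (rule computable_I)
    show "run gs (icond Q A B) (pr e x) (if q \<nu> x = 0 then a \<nu> x else b \<nu> x)" if e: "answers e \<nu>" for e \<nu> x
      by (rule run_icond[OF realizesD[OF Q e]]) (simp add: realizesD[OF A e] realizesD[OF B e])
  qed
qed

lemma computable_cong: "computable a \<Longrightarrow> (\<And>\<nu> x. a \<nu> x = b \<nu> x) \<Longrightarrow> computable b"
  unfolding computable_def realizes_def by simp

lemma computable_if: "decidable Q \<Longrightarrow> computable a \<Longrightarrow> computable b \<Longrightarrow> computable (\<lambda>\<nu> x. if Q \<nu> x then a \<nu> x else b \<nu> x)"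
  by (rule computable_cong[OF computable_ifz[of "\<lambda>\<nu> x. of_bool (Q \<nu> x)" b a]]) auto

lemma decidable_not: "decidable P \<Longrightarrow> decidable (\<lambda>\<nu> x. \<not> P \<nu> x)"
  by (rule computable_cong[OF computable_diff[OF computable_const[of 1]]]) auto

lemma decidable_conj: "decidable P \<Longrightarrow> decidable Q \<Longrightarrow> decidable (\<lambda>\<nu> x. P \<nu> x \<and> Q \<nu> x)"
  by (rule computable_cong[OF computable_if[of P "\<lambda>\<nu> x. of_bool (Q \<nu> x)" "\<lambda>\<nu> x. 0"]]) (auto intro: computable_const)

lemma decidable_disj: "decidable P \<Longrightarrow> decidable Q \<Longrightarrow> decidable (\<lambda>\<nu> x. P \<nu> x \<or> Q \<nu> x)"
  by (rule computable_cong[OF computable_if[of P "\<lambda>\<nu> x. 1" "\<lambda>\<nu> x. of_bool (Q \<nu> x)"]]) (auto intro: computable_const)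

lemma decidable_imp: "decidable P \<Longrightarrow> decidable Q \<Longrightarrow> decidable (\<lambda>\<nu> x. P \<nu> x \<longrightarrow> Q \<nu> x)"
  by (rule computable_cong[OF computable_if[of P "\<lambda>\<nu> x. of_bool (Q \<nu> x)" "\<lambda>\<nu> x. 1"]]) (auto intro: computable_const)

lemma decidable_le: "computable a \<Longrightarrow> computable b \<Longrightarrow> decidable (\<lambda>\<nu> x. a \<nu> x \<le> b \<nu> x)"
  by (rule computable_cong[OF computable_ifz[OF computable_diff, of a b "\<lambda>\<nu> x. 1" "\<lambda>\<nu> x. 0"]]) (auto intro: computable_const)

lemma decidable_less: "computable a \<Longrightarrow> computable b \<Longrightarrow> decidable (\<lambda>\<nu> x. a \<nu> x < b \<nu> x)"
  by (rule computable_cong[OF decidable_not[OF decidable_le, of b a]]) auto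

lemma decidable_eq: "computable a \<Longrightarrow> computable b \<Longrightarrow> decidable (\<lambda>\<nu> x. a \<nu> x = b \<nu> x)"
  by (rule computable_cong[OF decidable_conj[OF decidable_le decidable_le, of a b b a]]) auto

text \<open>Number quantification reduces to the Suslin functional by looking only at the first entry of
  a sequence.\<close>

lemma of_bool_ex_Suslin:
  "of_bool (\<exists>n. P n) = Suslin (\<lambda>s. if s = 0 then 1 else of_bool (P (pf (s - 1))))"
proof -
  have sc: "seq_code h (Suc n) = Suc (pr (h 0) (list_encode (map h [1..<Suc n])))" for h n
    by (simp add: seq_code_def upt_conv_Cons del: upt_Suc)
  have sc0: "seq_code h 0 = 0" for h by (simp add: seq_code_def)
  show ?thesis
  proof (cases "\<exists>n. P n")
    case True
    then obtain n where n: "P n" by blast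
    have "\<exists>h. \<forall>k. (if seq_code h k = 0 then 1 else of_bool (P (pf (seq_code h k - 1)))) \<noteq> (0::nat)"
    proof (intro exI[of _ "\<lambda>_. n"] allI)
      fix k
      show "(if seq_code (\<lambda>_. n) k = 0 then 1 else of_bool (P (pf (seq_code (\<lambda>_. n) k - 1)))) \<noteq> (0::nat)"
        by (cases k) (auto simp: sc0 sc n)
    qed
    then show ?thesis using True unfolding Suslin_def by auto
  next
    case False
    have "(if seq_code h 1 = 0 then 1 else of_bool (P (pf (seq_code h 1 - 1)))) = (0::nat)" for h
      using False sc[of h 0] by simp
    then have "\<forall>h. \<exists>n. (if seq_code h n = 0 then 1 else of_bool (P (pf (seq_code h n - 1)))) = (0::nat)"
      by blast
    then show ?thesis using False unfolding Suslin_def by simp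
  qed
qed

lemma decidable_ex:
  assumes "decidable (\<lambda>\<nu> z. P \<nu> (pf z) (ps z))"
  shows "decidable (\<lambda>\<nu> x. \<exists>n. P \<nu> n x)"
  unfolding of_bool_ex_Suslin
proof (intro computable_Suslin computable_if decidable_eq computable_pf computable_ps computable_ps0 computable_const)
  show "decidable (\<lambda>\<nu> x. P \<nu> (pf (pf x - 1)) (ps x))"
    using computable_comp[OF assms, of "\<lambda>\<nu> x. pr (pf (pf x - 1)) (ps x)"]
    by (simp add: computable_pr computable_pf computable_ps computable_ps0 computable_diff computable_const)
qed

lemma decidable_all:
  assumes "decidable (\<lambda>\<nu> z. P \<nu> (pf z) (ps z))"
  shows "decidable (\<lambda>\<nu> x. \<forall>n. P \<nu> n x)"
  using decidable_not[OF decidable_ex, OF decidable_not, OF assms] by simp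

text \<open>\<open>B\<close> asks whether a witness exists before the search starts. The search
  \<open>z\<close> is a loop by the recursion theorem: it returns its counter if the test succeeds
  and calls itself at the successor otherwise.\<close>

lemma computable_mu:
  assumes "decidable (\<lambda>\<nu> z. P \<nu> (pf z) (ps z))"
  shows "computable (\<lambda>\<nu> x. minimize (\<lambda>n. P \<nu> n x))"
proof -
  obtain A B where A: "realizes A (\<lambda>\<nu> z. of_bool (P \<nu> (pf z) (ps z)))"
    and B: "realizes B (\<lambda>\<nu> x. of_bool (\<exists>n. P \<nu> n x))"
    using assms decidable_ex[OF assms] unfolding computable_def by blast
  define r where "r = ipair (icomp (ifun pf) (icomp (ifun ps) (ifun ps)))
    (ipair (icomp (ifun pf) (ifun ps)) (icomp (ifun ps) (icomp (ifun ps) (ifun ps))))"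
  define l where "l = icall (ifun pf) (ipair (icomp (ifun Suc) (icomp (ifun pf) (ifun ps))) (icomp (ifun ps) (ifun ps)))"
  define z where "z = irec (icond (icomp A r) l (icomp (ifun pf) (ifun ps)))"
  have r: "run gs r (pr z (pr n (pr e x))) (pr e (pr n x))" for n e x
    unfolding r_def by (rule run_ipair run_icomp run_ifst run_isnd)+
  have l: "run gs z (pr (Suc n) w) v \<Longrightarrow> run gs l (pr z (pr n w)) v" for n w v
    unfolding l_def by (rule run_icall[OF run_ifst], (rule run_ipair run_icomp run_ifst run_isnd run_Suc)+)
  have t: "run gs (icomp A r) (pr z (pr n (pr e x))) (of_bool (P \<nu> n x))" if "answers e \<nu>" for n e \<nu> x
    using run_icomp[OF r realizesD[OF A that]] by simp
  have zl: "run gs z (pr n (pr e x)) (LEAST n. P \<nu> n x)"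
    if e: "answers e \<nu>" and ex: "\<exists>n. P \<nu> n x" and n: "n \<le> (LEAST n. P \<nu> n x)" for n e \<nu> x
    using n
  proof (induct "(LEAST n. P \<nu> n x) - n" arbitrary: n)
    case 0
    then have nn: "(LEAST n. P \<nu> n x) = n" by simp
    have P: "P \<nu> n x" unfolding nn[symmetric] using ex by (rule LeastI_ex)
    show ?case unfolding nn unfolding z_def
      by (rule run_irec, rule run_icond[OF t[OF e, unfolded z_def]])
        (simp add: P, intro run_icomp[OF run_isnd run_ifst])
  next
    case (Suc k)
    have P: "\<not> P \<nu> n x" using Suc(2) not_less_Least[of n "\<lambda>n. P \<nu> n x"] by auto
    have "run gs z (pr (Suc n) (pr e x)) (LEAST n. P \<nu> n x)" using Suc(2) by (intro Suc(1)) auto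
    from l[OF this] show ?case unfolding z_def
      by (intro run_irec run_icond[OF t[OF e, unfolded z_def]]) (simp add: P)
  qed
  let ?z = "icomp z (ipair (ifun (\<lambda>_. 0)) (ifun (\<lambda>x. x)))"
  have z: "run gs z (pr 0 w) v \<Longrightarrow> run gs ?z w v" for w v
    by (rule run_icomp[OF run_ipair[OF run_const run_id]])
  show ?thesis
  proof (rule computable_I)
    show "run gs (icond B (ifun (\<lambda>_. 0)) ?z) (pr e x) (minimize (\<lambda>n. P \<nu> n x))" if e: "answers e \<nu>" for e \<nu> x
      by (rule run_icond[OF realizesD[OF B e]]) (simp add: minimize_def run_const z zl[OF e])
  qed
qed

lemma computable_rec_nat:
  assumes "computable a" "computable (\<lambda>\<nu> z. b \<nu> (pf z) (pf (ps z)) (ps (ps z)))" "computable n"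
  shows "computable (\<lambda>\<nu> x. rec_nat (a \<nu> x) (\<lambda>i r. b \<nu> i r x) (n \<nu> x))"
proof -
  obtain A B N where A: "realizes A a" and N: "realizes N n"
    and B: "realizes B (\<lambda>\<nu> z. b \<nu> (pf z) (pf (ps z)) (ps (ps z)))"
    using assms unfolding computable_def by blast
  \<comment> \<open>S5 supplies value, counter, parameter in this order, and the parameter is the
    pair of oracle index and \<open>x\<close>; \<open>B\<close> expects oracle index, counter,
    value, \<open>x\<close>.\<close>
  have "tf gs 3 (\<lambda>as. pr (pf (as ! 2)) (pr (as ! 1) (pr (as ! 0) (ps (as ! 2)))))"
    by (intro tf_pr tf_pf tf_ps tf_proj) simp_all
  from kcs_rearrange[OF this, of B] obtain B' where
    B': "\<And>as v. length as = 3 \<Longrightarrow> run gs B (pr (pf (as ! 2)) (pr (as ! 1) (pr (as ! 0) (ps (as ! 2))))) v \<Longrightarrow> kcs gs B' as v"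
    by blast
  obtain K where K: "\<And>as R n'. length as = Suc 0 \<Longrightarrow> kcs gs A as (R 0) \<Longrightarrow>
     (\<forall>x < n'. kcs gs B' (R x # x # as) (R (Suc x))) \<Longrightarrow> kcs gs K (n' # as) (R n')"
    using kcs_primrec by blast
  obtain E where E: "\<And>x c d v. run gs N x c \<Longrightarrow> run gs (ifun (\<lambda>x. x)) x d \<Longrightarrow> kcs gs K [c, d] v \<Longrightarrow> run gs E x v"
    using run_kcs2 by blast
  show ?thesis
  proof (rule computable_I, rule E[OF realizesD[OF N] run_id])
    fix e \<nu> x assume e: "answers e \<nu>"
    let ?R = "rec_nat (a \<nu> x) (\<lambda>i r. b \<nu> i r x)"
    have "kcs gs B' (?R k # k # [pr e x]) (?R (Suc k))" for k
      using realizesD[OF B e, of "pr k (pr (?R k) x)"] by (intro B') auto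
    then show "kcs gs K [n \<nu> x, pr e x] (?R (n \<nu> x))"
      using realizesD[OF A e, of x] by (intro K) (auto simp: run_kcs)
  qed
qed

lemma computable_pure:
  assumes "computable (\<lambda>\<nu>. f)" shows "\<exists>E. \<forall>x. run gs E x (f x)"
proof -
  obtain F where F: "realizes F (\<lambda>\<nu>. f)" using assms unfolding computable_def by blast
  have "answers (ifun (\<lambda>_. 0)) (\<lambda>_. 0)" unfolding answers_def using run_const by blast
  then have "run gs (icomp F (ipair (ifun (\<lambda>_. ifun (\<lambda>_. 0))) (ifun (\<lambda>x. x)))) x (f x)" for x
    by (rule run_icomp[OF run_ipair[OF run_const run_id] realizesD[OF F]])
  then show ?thesis by blast
qed

lemma pure_C: "(\<And>x. run gs E x (f x)) \<Longrightarrow> computable (\<lambda>\<nu>. f)"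
  by (rule computable_I, rule run_icomp[OF run_isnd])

text \<open>Nothing is claimed where \<open>\<phi>\<close> is undefined: it suffices to know that programs converge where they should.\<close>

definition panswers :: "nat \<Rightarrow> (nat \<Rightarrow> nat option) \<Rightarrow> bool" where
  "panswers e \<nu> = (\<forall>n w. \<nu> n = Some w \<longrightarrow> run gs e n w)"

definition prealizes :: "nat \<Rightarrow> ((nat \<Rightarrow> nat option) \<Rightarrow> nat \<Rightarrow> nat option) \<Rightarrow> bool" where
  "prealizes E \<phi> = (\<forall>e \<nu> x v. panswers e \<nu> \<longrightarrow> \<phi> \<nu> x = Some v \<longrightarrow> run gs E (pr e x) v)"

definition pcomputable :: "((nat \<Rightarrow> nat option) \<Rightarrow> nat \<Rightarrow> nat option) \<Rightarrow> bool" where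
  "pcomputable \<phi> = (\<exists>E. prealizes E \<phi>)"

definition partial_computable :: "(nat \<Rightarrow> nat option) \<Rightarrow> bool" where
  "partial_computable T = (\<exists>E. \<forall>x v. T x = Some v \<longrightarrow> run gs E x v)"

lemma prealizesD: "prealizes E \<phi> \<Longrightarrow> panswers e \<nu> \<Longrightarrow> \<phi> \<nu> x = Some v \<Longrightarrow> run gs E (pr e x) v"
  unfolding prealizes_def by blast

lemma pcomputable_I: "(\<And>e \<nu> x v. panswers e \<nu> \<Longrightarrow> \<phi> \<nu> x = Some v \<Longrightarrow> run gs E (pr e x) v) \<Longrightarrow> pcomputable \<phi>"
  unfolding pcomputable_def prealizes_def by blast

lemma pcomputable_pcf:
  assumes "partial_computable T" "computable (\<lambda>\<nu>. a)"
  shows "pcomputable (\<lambda>\<nu> x. T (a x))"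
proof -
  obtain A where A: "\<And>x. run gs A x (a x)" using computable_pure[OF assms(2)] by blast
  obtain F where F: "\<And>x v. T x = Some v \<Longrightarrow> run gs F x v" using assms(1) unfolding partial_computable_def by blast
  show ?thesis by (rule pcomputable_I, rule run_icomp[OF run_icomp[OF run_isnd A] F])
qed

lemma pcomputable_pcfD: "pcomputable (\<lambda>\<nu>. T) \<Longrightarrow> partial_computable T"
proof -
  assume "pcomputable (\<lambda>\<nu>. T)"
  then obtain F where F: "prealizes F (\<lambda>\<nu>. T)" unfolding pcomputable_def by blast
  have "panswers 0 (\<lambda>_. None)" by (simp add: panswers_def)
  then have "T x = Some v \<Longrightarrow> run gs (icomp F (ipair (ifun (\<lambda>_. 0)) (ifun (\<lambda>x. x)))) x v" for x v
    by (rule run_icomp[OF run_ipair[OF run_const run_id] prealizesD[OF F]])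
  then show ?thesis unfolding partial_computable_def by blast
qed

lemma partial_computable_pure: "computable (\<lambda>\<nu>. a) \<Longrightarrow> partial_computable (\<lambda>x. Some (a x))"
  using computable_pure unfolding partial_computable_def by fastforce

lemma pcomputable_Some: "computable (\<lambda>\<nu>. a) \<Longrightarrow> pcomputable (\<lambda>\<nu> x. Some (a x))"
  using pcomputable_pcf[OF partial_computable_pure computable_ps0] by blast

lemma pcomputable_call:
  assumes "computable (\<lambda>\<nu>. a)" shows "pcomputable (\<lambda>\<nu> x. \<nu> (a x))"
proof -
  obtain A where A: "\<And>x. run gs A x (a x)" using computable_pure[OF assms] by blast
  show ?thesis
    by (rule pcomputable_I, rule run_icall[OF run_ifst run_icomp[OF run_isnd A]]) (simp add: panswers_def)
qed

lemma pcomputable_if: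
  assumes "decidable (\<lambda>\<nu>. Q)" "pcomputable a" "pcomputable b"
  shows "pcomputable (\<lambda>\<nu> x. if Q x then a \<nu> x else b \<nu> x)"
proof -
  obtain F where F: "\<And>x. run gs F x (of_bool (Q x))" using computable_pure[OF assms(1)] by blast
  obtain A B where A: "prealizes A a" and B: "prealizes B b" using assms unfolding pcomputable_def by blast
  show ?thesis
  proof (rule pcomputable_I)
    fix e \<nu> x v assume e: "panswers e \<nu>" and v: "(if Q x then a \<nu> x else b \<nu> x) = Some v"
    show "run gs (icond (icomp F (ifun ps)) B A) (pr e x) v"
      by (rule run_icond[OF run_icomp[OF run_isnd F]])
        (use v prealizesD[OF A e, of x v] prealizesD[OF B e, of x v] in \<open>simp split: if_split_asm\<close>)
  qed
qed

lemma pcomputable_bind: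
  assumes "pcomputable a" "pcomputable (\<lambda>\<nu> z. b \<nu> (pf z) (ps z))"
  shows "pcomputable (\<lambda>\<nu> x. Option.bind (a \<nu> x) (\<lambda>v. b \<nu> v x))"
proof -
  obtain A B where A: "prealizes A a" and B: "prealizes B (\<lambda>\<nu> z. b \<nu> (pf z) (ps z))"
    using assms unfolding pcomputable_def by blast
  show ?thesis
  proof (rule pcomputable_I)
    fix e \<nu> x v assume e: "panswers e \<nu>" and "Option.bind (a \<nu> x) (\<lambda>v. b \<nu> v x) = Some v"
    then obtain u where u: "a \<nu> x = Some u" "b \<nu> u x = Some v" by (auto simp: bind_eq_Some_conv)
    have "run gs B (pr e (pr u x)) v" using u(2) by (intro prealizesD[OF B e]) simp
    then show "run gs (icomp B (ipair (ifun pf) (ipair A (ifun ps)))) (pr e x) v"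
      by (rule run_icomp[OF run_ipair[OF run_ifst run_ipair[OF prealizesD[OF A e u(1)] run_isnd]]])
  qed
qed

lemma pcomputable_olift:
  assumes "computable \<phi>" "pcomputable (\<lambda>\<nu> z. \<psi> \<nu> (pf z) (ps z))" "computable (\<lambda>\<nu>. a)"
  shows "pcomputable (\<lambda>\<nu> x. olift \<phi> (\<lambda>n. \<psi> \<nu> n x) (a x))"
proof -
  obtain F P where F: "realizes F (\<lambda>\<nu> x. \<phi> \<nu> (a x))" and P: "prealizes P (\<lambda>\<nu> z. \<psi> \<nu> (pf z) (ps z))"
    using computable_comp[OF assms(1,3)] assms(2) unfolding computable_def pcomputable_def by blast
  let ?r = "ipair (icomp (ifun pf) (ifun ps)) (ipair (ifun pf) (icomp (ifun ps) (ifun ps)))"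
  let ?c = "icomp P ?r"
  show ?thesis
  proof (rule pcomputable_I)
    fix e \<nu> x v assume e: "panswers e \<nu>" and "olift \<phi> (\<lambda>n. \<psi> \<nu> n x) (a x) = Some v"
    then have tot: "\<exists>w. \<psi> \<nu> n x = Some w" and v: "v = \<phi> (\<lambda>n. the (\<psi> \<nu> n x)) (a x)" for n
      by (auto simp: olift_def split: if_splits)
    have "run gs ?r (pr n (pr e x)) (pr e (pr n x))" for n
      by (rule run_ipair run_icomp run_ifst run_isnd)+
    moreover have "run gs P (pr e (pr n x)) (the (\<psi> \<nu> n x))" for n
      using tot[of n] by (intro prealizesD[OF P e]) auto
    ultimately have "answers (iapp ?c (pr e x)) (\<lambda>n. the (\<psi> \<nu> n x))"
      unfolding answers_def by (blast intro: run_iapp run_icomp)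
    then show "run gs (icomp F (ipair (icurry ?c) (ifun ps))) (pr e x) v"
      unfolding v by (intro run_icomp[OF run_ipair[OF run_icurry run_isnd]] realizesD[OF F])
  qed
qed

text \<open>\<open>\<nu>\<close> is left open on purpose: in a later induction it is the part of the
  graph on which \<open>z\<close> has already been shown correct, so termination is argued
  separately for each use.\<close>

lemma pcomputable_rec:
  assumes "pcomputable \<phi>"
  shows "\<exists>z. \<forall>x v \<nu>. (\<forall>n w. \<nu> n = Some w \<longrightarrow> run gs z n w) \<longrightarrow> \<phi> \<nu> x = Some v \<longrightarrow> run gs z x v"
proof -
  obtain P where P: "prealizes P \<phi>" using assms unfolding pcomputable_def by blast
  show ?thesis using run_irec prealizesD[OF P] unfolding panswers_def by (intro exI[of _ "irec P"]) blast
qed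

text \<open>Calls at arguments of no smaller \<open>ms\<close> are answered by 0, so that the oracle
  is total and \<open>olift\<close> applies.\<close>

lemma computable_wfrec:
  assumes "computable \<phi>" "computable (\<lambda>\<nu>. ms)"
    "\<And>x. g x = \<phi> (\<lambda>y. if ms y < ms x then g y else 0) x"
  shows "computable (\<lambda>\<nu>. g)"
proof -
  have decidable: "decidable (\<lambda>\<nu> z. ms (pf z) < ms (ps z))"
    using computable_comp[OF assms(2)] by (intro decidable_less) (auto intro!: computable_pf computable_ps computable_ps0)
  have "pcomputable (\<lambda>\<nu> x. olift \<phi> (\<lambda>n. if ms n < ms x then \<nu> n else Some 0) x)"
    by (intro pcomputable_olift assms pcomputable_if decidable pcomputable_call pcomputable_Some computable_const computable_pf computable_ps0)
  from pcomputable_rec[OF this] obtain z where z: "\<And>x v \<nu>. (\<And>n w. \<nu> n = Some w \<Longrightarrow> run gs z n w) \<Longrightarrow>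
     olift \<phi> (\<lambda>n. if ms n < ms x then \<nu> n else Some 0) x = Some v \<Longrightarrow> run gs z x v" by blast
  have "run gs z x (g x)" for x
  proof (induct "ms x" arbitrary: x rule: less_induct)
    case less
    show ?case
    proof (rule z[where \<nu> = "\<lambda>n. if ms n < ms x then Some (g n) else None"])
      show "run gs z n w" if "(if ms n < ms x then Some (g n) else None) = Some w" for n w
        using that less by (auto split: if_splits)
      show "olift \<phi> (\<lambda>n. if ms n < ms x then if ms n < ms x then Some (g n) else None else Some 0) x = Some (g x)"
        by (subst assms(3), rule olift_Some) auto
    qed
  qed
  then show ?thesis by (rule pure_C)
qed

end

section \<open>A machine for Kleene computations\<close>

named_theorems cintro

lemmas [cintro] = computable_const computable_ps0 computable_query computable_pf computable_ps computable_Suc computable_add computable_diff computable_pr computable_if decidable_not decidable_conj decidable_disj decidable_imp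
  decidable_le decidable_less decidable_eq decidable_ex decidable_all computable_mu computable_rec_nat computable_Suslin

lemma computable_mult [cintro]: "computable gs a \<Longrightarrow> computable gs b \<Longrightarrow> computable gs (\<lambda>\<nu> x. a \<nu> x * b \<nu> x)"
proof -
  assume "computable gs a" "computable gs b"
  moreover have "n * m = rec_nat 0 (\<lambda>i r. r + m) n" for n m :: nat
    by (induct n) (simp_all add: add.commute)
  ultimately show ?thesis by (simp only:) (intro cintro computable_comp[OF \<open>computable gs b\<close>]; assumption)
qed

lemma computable_power [cintro]: "computable gs a \<Longrightarrow> computable gs b \<Longrightarrow> computable gs (\<lambda>\<nu> x. a \<nu> x ^ b \<nu> x)"
proof -
  assume "computable gs a" "computable gs b"
  moreover have "m ^ n = rec_nat 1 (\<lambda>i r. r * m) n" for n m :: nat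
    by (induct n) (simp_all add: mult.commute)
  ultimately show ?thesis by (simp only:) (intro cintro computable_comp[OF \<open>computable gs a\<close>]; assumption)
qed

section \<open>Operations on codes of argument lists\<close>

definition chd :: "nat \<Rightarrow> nat" where "chd z = pf (z - 1)"
definition ctl :: "nat \<Rightarrow> nat" where "ctl z = ps (z - 1)"
definition ccons :: "nat \<Rightarrow> nat \<Rightarrow> nat" where "ccons x z = Suc (pr x z)"

lemma list_encode_Cons: "list_encode (x # xs) = ccons x (list_encode xs)"
  by (simp add: ccons_def)

lemma chd_ccons [simp]: "chd (ccons x z) = x" and ctl_ccons [simp]: "ctl (ccons x z) = z"
  by (simp_all add: chd_def ctl_def ccons_def)

lemma computable_chd [cintro]: "computable gs a \<Longrightarrow> computable gs (\<lambda>\<nu> x. chd (a \<nu> x))"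
  and computable_ctl [cintro]: "computable gs a \<Longrightarrow> computable gs (\<lambda>\<nu> x. ctl (a \<nu> x))"
  and computable_ccons [cintro]: "computable gs a \<Longrightarrow> computable gs b \<Longrightarrow> computable gs (\<lambda>\<nu> x. ccons (a \<nu> x) (b \<nu> x))"
  unfolding chd_def ctl_def ccons_def by (intro cintro; assumption)+

fun cswap :: "nat \<Rightarrow> nat \<Rightarrow> nat" where
  "cswap 0 a = ccons (chd (ctl a)) (ccons (chd a) (ctl (ctl a)))"
| "cswap (Suc k) a = ccons (chd a) (cswap k (ctl a))"

lemma cswap_list:
  "Suc k < length as \<Longrightarrow> cswap k (list_encode as) = list_encode (as[k := as ! Suc k, Suc k := as ! k])"
proof (induct k arbitrary: as)
  case 0
  then obtain x y bs where "as = x # y # bs" by (metis Suc_length_conv less_imp_Suc_add add_Suc plus_nat.add_0 length_Suc_conv)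
  then show ?case by (simp add: list_encode_Cons del: list_encode.simps)
next
  case (Suc k)
  then obtain x bs where "as = x # bs" by (cases as) auto
  then show ?case using Suc by (simp add: list_encode_Cons del: list_encode.simps)
qed

lemma computable_cswap [cintro]: "computable gs a \<Longrightarrow> computable gs b \<Longrightarrow> computable gs (\<lambda>\<nu> x. cswap (a \<nu> x) (b \<nu> x))"
proof -
  assume ab: "computable gs a" "computable gs b"
  let ?\<phi> = "\<lambda>\<nu> x. if pf x = 0 then ccons (chd (ctl (ps x))) (ccons (chd (ps x)) (ctl (ctl (ps x))))
     else ccons (chd (ps x)) (\<nu> (pr (pf x - 1) (ctl (ps x))))"
  have "computable gs (\<lambda>\<nu>. (\<lambda>x. cswap (pf x) (ps x)))"
  proof (rule computable_wfrec[where \<phi> = ?\<phi> and ms = pf])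
    show "computable gs ?\<phi>" by (intro cintro)
    show "computable gs (\<lambda>\<nu>. pf)" by (intro cintro)
    show "cswap (pf x) (ps x) = ?\<phi> (\<lambda>y. if pf y < pf x then cswap (pf y) (ps y) else 0) x" for x
      by (cases "pf x") auto
  qed
  from computable_comp[OF this, of "\<lambda>\<nu> x. pr (a \<nu> x) (b \<nu> x)"] ab show ?thesis by (simp add: cintro)
qed

text \<open>The states. \<open>stK\<close>: a Kleene computation; the length annotations of indices are ignored, and the clause
  of S6 for function arguments cannot occur with at most one of them. \<open>stBar\<close>, \<open>stW\<close>, \<open>stBA\<close>: recursion along
  the relation with index \<open>e\<close>. \<open>stSeq p q\<close>: run \<open>p\<close>, then \<open>q\<close>. \<open>stChk\<close>: diverge unless the value is \<open>0\<close>.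
  \<open>stSel\<close>: search for a convergent candidate \<open>stCand e y w\<close>, with \<open>k\<close> an index of stage comparison.
  \<open>stSup\<close>, \<open>stV\<close>: run the computations selected for all \<open>y\<close>.\<close>

definition stK :: "nat \<Rightarrow> nat \<Rightarrow> nat" where "stK e a = pr 0 (pr e a)"
definition stL :: "nat \<Rightarrow> nat" where "stL v = pr 1 v"
definition stSeq :: "nat \<Rightarrow> nat \<Rightarrow> nat" where "stSeq p q = pr 2 (pr p q)"
definition stBar :: "nat \<Rightarrow> nat \<Rightarrow> nat" where "stBar e x = pr 3 (pr e x)"
definition stW :: "nat \<Rightarrow> nat \<Rightarrow> nat \<Rightarrow> nat" where "stW e x y = pr 4 (pr e (pr x y))"
definition stBA :: "nat \<Rightarrow> nat" where "stBA e = pr 5 e"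
definition stChk :: "nat \<Rightarrow> nat \<Rightarrow> nat" where "stChk e x = pr 6 (pr e x)"
definition stDiv :: "nat" where "stDiv = pr 7 0"
definition stSel :: "nat \<Rightarrow> nat \<Rightarrow> nat \<Rightarrow> nat \<Rightarrow> nat" where "stSel k e y w = pr 8 (pr k (pr e (pr y w)))"
definition stSup :: "nat \<Rightarrow> nat \<Rightarrow> nat" where "stSup k e = pr 9 (pr k e)"
definition stV :: "nat \<Rightarrow> nat \<Rightarrow> nat \<Rightarrow> nat" where "stV k e y = pr 10 (pr k (pr e y))"

definition stCand :: "nat \<Rightarrow> nat \<Rightarrow> nat \<Rightarrow> nat" where
  "stCand e y w = stSeq w (stChk e (pr y w))"

lemmas st_defs = stK_def stL_def stSeq_def stBar_def stW_def stBA_def stChk_def stDiv_def stSel_def stSup_def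
  stV_def stCand_def

text \<open>Numbers that code no proper state are leaves too, so that every number is a state and
  the machine needs no well-formedness predicate.\<close>

definition is_leaf :: "nat \<Rightarrow> bool" where
  "is_leaf p = (pf p = 1 \<or> 10 < pf p \<or>
     (pf p = 0 \<and> (let c = chd (pf (ps p)) in \<not> (c = 4 \<or> c = 5 \<or> c = 6 \<or> c = 8 \<or> c = 9))))"

definition kleene_val :: "(nat \<Rightarrow> nat) \<Rightarrow> nat \<Rightarrow> nat \<Rightarrow> nat" where
  "kleene_val f e a = (if chd e = 1 then Suc (chd a) else if chd e = 2 then chd (ctl (ctl (ctl e)))
      else if chd e = 3 then chd a else if chd e = 7 then f (chd a) else 0)"

definition leaf_val :: "(nat \<Rightarrow> nat) \<Rightarrow> nat \<Rightarrow> nat" where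
  "leaf_val f p = (if pf p = 0 then kleene_val f (pf (ps p)) (ps (ps p)) else ps p)"

text \<open>Only S8 has children that differ. A clause with one preliminary computation repeats it
  in every child, and one without any gets the dummy leaf \<open>stL 0\<close>; thus all clauses
  share a single shape of node.\<close>

definition kleene_child :: "nat \<Rightarrow> nat \<Rightarrow> nat \<Rightarrow> nat" where
  "kleene_child e a y = (if chd e = 4 then stK (chd (ctl (ctl (ctl (ctl e))))) a
     else if chd e = 5 then (if chd a = 0 then stL 0 else stK e (ccons (chd a - 1) (ctl a)))
     else if chd e = 8 then stK (chd (ctl (ctl (ctl e)))) (ccons y a)
     else stL 0)"

definition kleene_tail :: "nat \<Rightarrow> nat \<Rightarrow> nat \<Rightarrow> nat \<Rightarrow> nat" where
  "kleene_tail e a h s = (if chd e = 4 then stK (chd (ctl (ctl (ctl e)))) (ccons h a)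
     else if chd e = 5 then (if chd a = 0 then stK (chd (ctl (ctl (ctl e)))) (ctl a)
        else stK (chd (ctl (ctl (ctl (ctl e))))) (ccons h (ccons (chd a - 1) (ctl a))))
     else if chd e = 6 then stK (chd (ctl (ctl (ctl (ctl (ctl e)))))) (cswap (chd (ctl (ctl (ctl (ctl e))))) a)
     else if chd e = 8 then stL s
     else stK (chd a) (ctl a))"

definition child :: "nat \<Rightarrow> nat \<Rightarrow> nat" where
  "child p y = (let t = pf p; u = ps p in
     if t = 0 then kleene_child (pf u) (ps u) y
     else if t = 2 then pf u
     else if t = 3 then stW (pf u) (ps u) y
     else if t = 4 then stK (pf u) (ccons (ps (ps u)) (ccons (pf (ps u)) 0))
     else if t = 5 then stBar u y
     else if t = 6 then stK (pf u) (ccons (ps u) 0)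
     else if t = 7 then stDiv
     else if t = 8 then stK (pf u) (ccons (pr (stCand (pf (ps u)) (pf (ps (ps u))) (ps (ps (ps u))))
         (stSel (pf u) (pf (ps u)) (pf (ps (ps u))) (Suc (ps (ps (ps u)))))) 0)
     else if t = 9 then stV (pf u) (ps u) y
     else stSel (pf u) (pf (ps u)) (ps (ps u)) 0)"

definition tail_of :: "nat \<Rightarrow> nat \<Rightarrow> nat \<Rightarrow> nat" where
  "tail_of p h s = (let t = pf p; u = ps p in
     if t = 0 then kleene_tail (pf u) (ps u) h s
     else if t = 2 then ps u
     else if t = 4 then (if h = 0 \<and> pf (ps u) \<noteq> ps (ps u) then stBar (pf u) (ps (ps u)) else stL 0)
     else if t = 6 then (if h = 0 then stL 0 else stDiv)
     else if t = 7 then stDiv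
     else if t = 8 then (if h = 0
        then stSeq (stCand (pf (ps u)) (pf (ps (ps u))) (ps (ps (ps u)))) (stL (ps (ps (ps u))))
        else stSel (pf u) (pf (ps u)) (pf (ps (ps u))) (Suc (ps (ps (ps u)))))
     else if t = 10 then h
     else stL 0)"

lemma computable_st [cintro]:
  "computable gs a \<Longrightarrow> computable gs b \<Longrightarrow> computable gs (\<lambda>\<nu> x. stK (a \<nu> x) (b \<nu> x))"
  "computable gs a \<Longrightarrow> computable gs (\<lambda>\<nu> x. stL (a \<nu> x))"
  "computable gs a \<Longrightarrow> computable gs b \<Longrightarrow> computable gs (\<lambda>\<nu> x. stSeq (a \<nu> x) (b \<nu> x))"
  "computable gs a \<Longrightarrow> computable gs b \<Longrightarrow> computable gs (\<lambda>\<nu> x. stBar (a \<nu> x) (b \<nu> x))"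
  "computable gs a \<Longrightarrow> computable gs b \<Longrightarrow> computable gs c \<Longrightarrow> computable gs (\<lambda>\<nu> x. stW (a \<nu> x) (b \<nu> x) (c \<nu> x))"
  "computable gs a \<Longrightarrow> computable gs b \<Longrightarrow> computable gs (\<lambda>\<nu> x. stChk (a \<nu> x) (b \<nu> x))"
  "computable gs a \<Longrightarrow> computable gs b \<Longrightarrow> computable gs c \<Longrightarrow> computable gs d \<Longrightarrow> computable gs (\<lambda>\<nu> x. stSel (a \<nu> x) (b \<nu> x) (c \<nu> x) (d \<nu> x))"
  "computable gs a \<Longrightarrow> computable gs b \<Longrightarrow> computable gs c \<Longrightarrow> computable gs (\<lambda>\<nu> x. stV (a \<nu> x) (b \<nu> x) (c \<nu> x))"
  "computable gs a \<Longrightarrow> computable gs b \<Longrightarrow> computable gs c \<Longrightarrow> computable gs (\<lambda>\<nu> x. stCand (a \<nu> x) (b \<nu> x) (c \<nu> x))"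
  unfolding st_defs by (intro cintro; assumption)+

lemma computable_pure2I: "computable gs (\<lambda>\<nu> z. f (pf z) (ps z)) \<Longrightarrow> computable gs a \<Longrightarrow> computable gs b \<Longrightarrow> computable gs (\<lambda>\<nu> x. f (a \<nu> x) (b \<nu> x))"
  using computable_comp[of gs "\<lambda>\<nu> z. f (pf z) (ps z)" "\<lambda>\<nu> x. pr (a \<nu> x) (b \<nu> x)"] by (simp add: computable_pr)

lemma computable_pure3I: "computable gs (\<lambda>\<nu> z. f (pf z) (pf (ps z)) (ps (ps z))) \<Longrightarrow> computable gs a \<Longrightarrow> computable gs b \<Longrightarrow> computable gs c \<Longrightarrow>
    computable gs (\<lambda>\<nu> x. f (a \<nu> x) (b \<nu> x) (c \<nu> x))"
  using computable_comp[of gs "\<lambda>\<nu> z. f (pf z) (pf (ps z)) (ps (ps z))" "\<lambda>\<nu> x. pr (a \<nu> x) (pr (b \<nu> x) (c \<nu> x))"]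
  by (simp add: computable_pr)

lemma decidable_is_leaf [cintro]: "computable gs a \<Longrightarrow> decidable gs (\<lambda>\<nu> x. is_leaf (a \<nu> x))"
proof -
  have "decidable gs (\<lambda>\<nu> x. is_leaf x)" unfolding is_leaf_def Let_def by (intro cintro)
  then show "computable gs a \<Longrightarrow> ?thesis" by (rule computable_comp)
qed

lemma computable_val [cintro]: "computable gs a \<Longrightarrow> computable gs (\<lambda>\<nu> x. leaf_val (\<lambda>_. 0) (a \<nu> x))"
proof -
  have "computable gs (\<lambda>\<nu> x. leaf_val (\<lambda>_. 0) x)" unfolding leaf_val_def kleene_val_def by (intro cintro)
  then show "computable gs a \<Longrightarrow> ?thesis" by (rule computable_comp)
qed

lemma computable_child [cintro]: "computable gs a \<Longrightarrow> computable gs b \<Longrightarrow> computable gs (\<lambda>\<nu> x. child (a \<nu> x) (b \<nu> x))"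
proof -
  have "computable gs (\<lambda>\<nu> x. child (pf x) (ps x))" unfolding child_def kleene_child_def Let_def stBA_def stDiv_def
    by (intro cintro)
  then show "computable gs a \<Longrightarrow> computable gs b \<Longrightarrow> ?thesis" by (rule computable_pure2I)
qed

lemma computable_tail_of [cintro]: "computable gs a \<Longrightarrow> computable gs b \<Longrightarrow> computable gs c \<Longrightarrow> computable gs (\<lambda>\<nu> x. tail_of (a \<nu> x) (b \<nu> x) (c \<nu> x))"
proof -
  have "computable gs (\<lambda>\<nu> x. tail_of (pf x) (pf (ps x)) (ps (ps x)))" unfolding tail_of_def kleene_tail_def Let_def stBA_def stDiv_def
    by (intro cintro)
  then show "computable gs a \<Longrightarrow> computable gs b \<Longrightarrow> computable gs c \<Longrightarrow> ?thesis" by (rule computable_pure3I)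
qed

text \<open>A node runs its children, one for each number; their values \<open>h\<close> determine the tail, whose value is returned.\<close>

inductive evals :: "(nat \<Rightarrow> nat) \<Rightarrow> nat \<Rightarrow> nat \<Rightarrow> bool" for f where
  leaf: "is_leaf p \<Longrightarrow> evals f p (leaf_val f p)"
| node: "\<not> is_leaf p \<Longrightarrow> (\<And>y. evals f (child p y) (h y)) \<Longrightarrow> evals f (tail_of p (h 0) (Suslin h)) b \<Longrightarrow> evals f p b"

lemma evals_det: "evals f p b \<Longrightarrow> evals f p c \<Longrightarrow> b = c"
proof (induct arbitrary: c rule: evals.induct)
  case (leaf p)
  then show ?case by (auto elim: evals.cases)
next
  case (node p h b)
  obtain h' where h': "\<And>y. evals f (child p y) (h' y)" "evals f (tail_of p (h' 0) (Suslin h')) c"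
    using node(6)
  proof cases
    case leaf
    then show ?thesis using node(1) by blast
  next
    case (node h)
    then show ?thesis using that by blast
  qed
  have "h = h'" using node(3) h'(1) by blast
  then show ?case using node(5) h'(2) by blast
qed

lemma evals_leaf: "is_leaf p \<Longrightarrow> evals f p b \<longleftrightarrow> b = leaf_val f p"
  using evals.leaf evals_det by blast

lemma evals_node:
  assumes n: "\<not> is_leaf p"
  shows "evals f p b \<longleftrightarrow> (\<exists>h. (\<forall>y. evals f (child p y) (h y)) \<and> evals f (tail_of p (h 0) (Suslin h)) b)"
proof
  assume "evals f p b"
  then show "\<exists>h. (\<forall>y. evals f (child p y) (h y)) \<and> evals f (tail_of p (h 0) (Suslin h)) b"
    by cases (use n in blast)+
qed (use n in \<open>blast intro: evals.node\<close>)

lemma is_leaf_simps [simp]: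
  "is_leaf (stL v)" "\<not> is_leaf (stSeq p q)" "\<not> is_leaf (stBar e x)" "\<not> is_leaf (stW e x y)" "\<not> is_leaf (stBA e)"
  "\<not> is_leaf (stChk e x)" "\<not> is_leaf stDiv" "\<not> is_leaf (stSel k e y w)" "\<not> is_leaf (stSup k e)" "\<not> is_leaf (stV k e y)"
  by (simp_all add: is_leaf_def st_defs)

lemma leaf_val_L [simp]: "leaf_val f (stL v) = v"
  by (simp add: leaf_val_def st_defs)

lemma is_leaf_K: "is_leaf (stK e a) = (\<not> (chd e = 4 \<or> chd e = 5 \<or> chd e = 6 \<or> chd e = 8 \<or> chd e = 9))"
  by (simp add: is_leaf_def st_defs Let_def)

lemma leaf_val_K: "leaf_val f (stK e a) = kleene_val f e a"
  by (simp add: leaf_val_def stK_def)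

lemma child_simps [simp]:
  "child (stK e a) y = kleene_child e a y"
  "child (stSeq p q) y = p"
  "child (stBar e x) y = stW e x y"
  "child (stW e x z) y = stK e (ccons z (ccons x 0))"
  "child (stBA e) y = stBar e y"
  "child (stChk e x) y = stK e (ccons x 0)"
  "child stDiv y = stDiv"
  "child (stSel k e z w) y = stK k (ccons (pr (stCand e z w) (stSel k e z (Suc w))) 0)"
  "child (stSup k e) y = stV k e y"
  "child (stV k e z) y = stSel k e z 0"
  unfolding child_def Let_def by (simp_all add: stK_def stSeq_def stBar_def[of e x] stW_def[of e x z] stBA_def
      stChk_def[of e x] stDiv_def stSel_def[of k e z w] stSup_def[of k e] stV_def[of k e z])

lemma tail_of_simps [simp]:
  "tail_of (stK e a) h s = kleene_tail e a h s"
  "tail_of (stSeq p q) h s = q"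
  "tail_of (stBar e x) h s = stL 0"
  "tail_of (stW e x z) h s = (if h = 0 \<and> x \<noteq> z then stBar e z else stL 0)"
  "tail_of (stBA e) h s = stL 0"
  "tail_of (stChk e x) h s = (if h = 0 then stL 0 else stDiv)"
  "tail_of stDiv h s = stDiv"
  "tail_of (stSel k e z w) h s = (if h = 0 then stSeq (stCand e z w) (stL w) else stSel k e z (Suc w))"
  "tail_of (stSup k e) h s = stL 0"
  "tail_of (stV k e z) h s = h"
  unfolding tail_of_def Let_def by (simp_all add: stK_def stSeq_def[of p q] stBar_def[of e x] stW_def[of e x z] stBA_def
      stChk_def[of e x] stDiv_def stSel_def[of k e z w] stSup_def[of k e] stV_def[of k e z])

lemma evals_L [simp]: "evals f (stL v) b \<longleftrightarrow> b = v"
  by (simp add: evals_leaf)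

lemma evals_K_node:
  "chd e = 4 \<or> chd e = 5 \<or> chd e = 6 \<or> chd e = 8 \<or> chd e = 9 \<Longrightarrow>
    (\<And>y. evals f (kleene_child e a y) (h y)) \<Longrightarrow> evals f (kleene_tail e a (h 0) (Suslin h)) b \<Longrightarrow> evals f (stK e a) b"
  by (rule evals.node[of _ _ h]) (auto simp: is_leaf_K)

text \<open>Each clause is a leaf or a single node. For \<open>gs = []\<close> clause S7 cannot
  occur, hence \<open>f\<close> is arbitrary there; this is how computations without function
  argument are compared with those in \<open>f\<close>.\<close>

lemma kc_imp_ev:
  assumes "kc Suslin e as gs b" "gs = [] \<or> gs = [f]"
  shows "evals f (stK e (list_encode as)) b"
  using assms
proof (induct rule: kc.induct)
  note [simp] = list_encode_Cons is_leaf_K leaf_val_K kleene_val_def kleene_child_def kleene_tail_def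
  note [simp del] = list_encode.simps(2)
  {
    case (S1 as n gs m x)
    then show ?case by (simp add: evals_leaf)
  next
    case (S2 as n gs m q)
    then show ?case by (simp add: evals_leaf)
  next
    case (S3 as n gs m x)
    then show ?case by (simp add: evals_leaf)
  next
    case (S4 as n gs m e2 c e1 b)
    then show ?case by (intro evals_K_node[where h = "\<lambda>_. c"]) auto
  next
    case (S5_0 as n gs m e1 b e2)
    then show ?case by (intro evals_K_node[where h = "\<lambda>_. 0"]) auto
  next
    case (S5_Suc as n gs m e1 e2 x c b)
    then show ?case by (intro evals_K_node[where h = "\<lambda>_. c"]) auto
  next
    case (S6_num as n gs m k e1 b)
    then show ?case by (intro evals_K_node[where h = "\<lambda>_. 0"]) (auto simp: cswap_list)
  next
    case (S6_fun as n gs m k e1 b)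
    then show ?case by auto
  next
    case (S7 as n gs m x g)
    then show ?case by (simp add: evals_leaf)
  next
    case (S8 as n gs m e1 h)
    then show ?case by (intro evals_K_node[where h = h]) auto
  next
    case (S9 as n gs m d b)
    then show ?case by (intro evals_K_node[where h = "\<lambda>_. 0"]) auto
  }
qed

definition conv :: "(nat \<Rightarrow> nat) \<Rightarrow> nat \<Rightarrow> bool" where "conv f p = (\<exists>b. evals f p b)"
definition result :: "(nat \<Rightarrow> nat) \<Rightarrow> nat \<Rightarrow> nat" where "result f p = (THE b. evals f p b)"

lemma result_eq: "evals f p b \<Longrightarrow> result f p = b"
  unfolding result_def using evals_det by blast

lemma conv_ev: "conv f p \<Longrightarrow> evals f p (result f p)"
  unfolding conv_def using result_eq by metis

lemma evals_iff: "evals f p b \<longleftrightarrow> conv f p \<and> result f p = b"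
  using conv_ev result_eq conv_def by metis

definition tail :: "(nat \<Rightarrow> nat) \<Rightarrow> nat \<Rightarrow> nat" where
  "tail f p = tail_of p (result f (child p 0)) (Suslin (\<lambda>y. result f (child p y)))"

lemma conv_leaf: "is_leaf p \<Longrightarrow> conv f p"
  using evals.leaf conv_def by blast

lemma conv_node: "\<not> is_leaf p \<Longrightarrow> conv f p \<longleftrightarrow> (\<forall>y. conv f (child p y)) \<and> conv f (tail f p)"
proof -
  assume n: "\<not> is_leaf p"
  have *: "h = (\<lambda>y. result f (child p y))" if "\<forall>y. evals f (child p y) (h y)" for h
    using that by (simp add: evals_iff fun_eq_iff)
  show ?thesis
  proof
    assume "conv f p"
    then obtain h b where h: "\<forall>y. evals f (child p y) (h y)" "evals f (tail_of p (h 0) (Suslin h)) b"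
      unfolding conv_def using evals_node[OF n] by blast
    then show "(\<forall>y. conv f (child p y)) \<and> conv f (tail f p)"
      unfolding conv_def tail_def using *[OF h(1)] by blast
  next
    assume "(\<forall>y. conv f (child p y)) \<and> conv f (tail f p)"
    then show "conv f p" unfolding tail_def
      using evals.node[OF n, of f "\<lambda>y. result f (child p y)"] conv_ev conv_def by blast
  qed
qed

lemma result_node: "\<not> is_leaf p \<Longrightarrow> conv f p \<Longrightarrow> result f p = result f (tail f p)"
proof -
  assume n: "\<not> is_leaf p" and "conv f p"
  then have c: "\<forall>y. conv f (child p y)" "conv f (tail f p)" using conv_node by blast+
  show ?thesis unfolding tail_def
    by (rule result_eq, rule evals.node[OF n, of f "\<lambda>y. result f (child p y)"])
      (use c conv_ev in \<open>auto simp: tail_def\<close>)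
qed

text \<open>The machine run on the zero function is computable in the Suslin functional itself,
  because a node is one application of it followed by one recursive call.\<close>

lemma universal:
  "\<exists>U. \<forall>p b. evals (\<lambda>_. 0) p b \<longrightarrow> run gs U p b"
proof -
  let ?t = "\<lambda>\<nu> p. tail_of p (\<nu> 0) (Suslin (\<lambda>n. \<nu> n))"
  have "pcomputable gs (\<lambda>\<nu> p. if is_leaf p then Some (leaf_val (\<lambda>_. 0) p)
     else Option.bind (olift ?t (\<lambda>y. \<nu> (child p y)) p) (\<lambda>r. \<nu> r))"
    by (intro pcomputable_if pcomputable_bind pcomputable_olift pcomputable_Some pcomputable_call cintro)
  from pcomputable_rec[OF this] obtain z where z: "\<And>x v \<nu>. (\<And>n w. \<nu> n = Some w \<Longrightarrow> run gs z n w) \<Longrightarrow>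
     (if is_leaf x then Some (leaf_val (\<lambda>_. 0) x)
     else Option.bind (olift ?t (\<lambda>y. \<nu> (child x y)) x) (\<lambda>r. \<nu> r)) = Some v \<Longrightarrow> run gs z x v" by blast
  have "run gs z p b" if "evals (\<lambda>_. 0) p b" for p b
    using that
  proof (induct rule: evals.induct)
    case (leaf p)
    show ?case by (rule z[of "\<lambda>_. None"]) (use leaf in auto)
  next
    case (node p h b)
    \<comment> \<open>Only those answers on which \<open>z\<close> is known to be correct, so that
      the premise on the oracle holds by definition.\<close>
    let ?\<nu> = "\<lambda>n. if \<exists>w. evals (\<lambda>_. 0) n w \<and> run gs z n w then Some (result (\<lambda>_. 0) n) else None"
    have \<nu>: "?\<nu> n = Some w" if "evals (\<lambda>_. 0) n w" "run gs z n w" for n w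
      using that result_eq by auto
    show ?case
    proof (rule z[of ?\<nu>])
      show "run gs z n w" if "?\<nu> n = Some w" for n w
        using that result_eq by (auto split: if_splits)
      have "olift ?t (\<lambda>y. ?\<nu> (child p y)) p = Some (?t h p)"
        by (intro olift_Some \<nu> node)
      moreover have "?\<nu> (?t h p) = Some b" using node by (intro \<nu>)
      ultimately show "(if is_leaf p then Some (leaf_val (\<lambda>_. 0) p)
        else Option.bind (olift ?t (\<lambda>y. ?\<nu> (child p y)) p) (\<lambda>r. ?\<nu> r)) = Some b"
        using node(1) by simp
    qed
  qed
  then show ?thesis by blast
qed

section \<open>Ranks of computations\<close>

abbreviation zero :: "nat \<Rightarrow> nat" where "zero \<equiv> (\<lambda>_. 0)"

definition result_opt :: "nat \<Rightarrow> nat option" where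
  "result_opt p = (if conv zero p then Some (result zero p) else None)"

text \<open>Defined even if the tail itself diverges: the values of the children already determine
  which computation it is.\<close>

definition tail_opt :: "nat \<Rightarrow> nat option" where
  "tail_opt p = (if \<forall>y. conv zero (child p y) then Some (tail zero p) else None)"

lemma partial_computable_Uo: "partial_computable gs result_opt"
proof -
  obtain U where "\<And>p b. evals zero p b \<Longrightarrow> run gs U p b" using universal by blast
  then show ?thesis unfolding partial_computable_def result_opt_def using conv_ev[of zero] by (intro exI[of _ U]) auto
qed

lemma partial_computable_To: "partial_computable gs tail_opt"
proof -
  have "pcomputable gs (\<lambda>\<nu> p. olift (\<lambda>\<nu> p. tail_of p (\<nu> 0) (Suslin (\<lambda>n. \<nu> n))) (\<lambda>y. result_opt (child p y)) p)"
    by (intro pcomputable_olift pcomputable_pcf[OF partial_computable_Uo] cintro)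
  from pcomputable_pcfD[OF this] have "partial_computable gs (\<lambda>p. olift (\<lambda>\<nu> p. tail_of p (\<nu> 0) (Suslin (\<lambda>n. \<nu> n))) (\<lambda>y. result_opt (child p y)) p)" .
  also have "(\<lambda>p. olift (\<lambda>\<nu> p. tail_of p (\<nu> 0) (Suslin (\<lambda>n. \<nu> n))) (\<lambda>y. result_opt (child p y)) p) = tail_opt"
    by (rule ext) (auto simp: tail_opt_def result_opt_def olift_def tail_def)
  finally show ?thesis .
qed

type_synonym comp = "(nat \<Rightarrow> nat) \<times> nat"

text \<open>Divergent computations get no subcomputations, which makes the relation well-founded on
  all pairs. In exchange they look like rank 0, so statements about ranks have to carry convergence
  along.\<close>

definition subcomps :: "comp \<Rightarrow> comp set" where
  "subcomps z = (if conv (fst z) (snd z) \<and> \<not> is_leaf (snd z)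
     then insert (fst z, tail (fst z) (snd z)) (range (\<lambda>y. (fst z, child (snd z) y))) else {})"

lemma wf_Sub: "wf {(s, z). s \<in> subcomps z}"
proof -
  have acc: "(f, p) \<in> Wellfounded.acc {(s, z). s \<in> subcomps z}" if "evals f p b" for f p b
    using that
  proof (induct rule: evals.induct)
    case (leaf p)
    then show ?case by - (rule acc.intros, auto simp: subcomps_def)
  next
    case (node p h b)
    have "h = (\<lambda>y. result f (child p y))" using node(2) by (simp add: evals_iff fun_eq_iff)
    then have r: "tail f p = tail_of p (h 0) (Suslin h)" by (simp add: tail_def)
    have "s = (f, tail_of p (h 0) (Suslin h)) \<or> (\<exists>y. s = (f, child p y))" if "s \<in> subcomps (f, p)" for s
      using that by (auto simp: subcomps_def r split: if_splits)
    then show ?case using node(3,5) by - (rule acc.intros, blast)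
  qed
  have "z \<in> Wellfounded.acc {(s, z). s \<in> subcomps z}" for z
  proof (cases "conv (fst z) (snd z)")
    case True
    then show ?thesis using acc[of "fst z" "snd z"] by (auto simp: conv_def)
  next
    case False
    then show ?thesis by - (rule acc.intros, auto simp: subcomps_def)
  qed
  then show ?thesis by (simp add: wf_iff_acc)
qed

lemma subcomps_induct: "(\<And>z. (\<And>s. s \<in> subcomps z \<Longrightarrow> P s) \<Longrightarrow> P z) \<Longrightarrow> P z"
  using wf_induct_rule[OF wf_Sub, of P z] by blast

text \<open>Comparison of ordinal ranks without ordinals.\<close>

inductive rank_le :: "comp \<Rightarrow> comp \<Rightarrow> bool" where
  "(\<And>s. s \<in> subcomps z \<Longrightarrow> \<exists>t. t \<in> subcomps w \<and> rank_le s t) \<Longrightarrow> rank_le z w"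

definition rank_less :: "comp \<Rightarrow> comp \<Rightarrow> bool" where
  "rank_less z w = (\<exists>t\<in>subcomps w. rank_le z t)"

lemma rank_le_iff: "rank_le z w \<longleftrightarrow> (\<forall>s\<in>subcomps z. rank_less s w)"
  unfolding rank_less_def by (subst rank_le.simps) blast

lemma rank_le_refl: "rank_le z z"
  by (induct z rule: subcomps_induct) (blast intro: rank_le.intros)

lemma rank_le_trans: "rank_le x y \<Longrightarrow> rank_le y z \<Longrightarrow> rank_le x z"
proof (induct x arbitrary: y z rule: subcomps_induct)
  case (1 x)
  show ?case
  proof (rule rank_le.intros)
    fix s assume s: "s \<in> subcomps x"
    then obtain t where t: "t \<in> subcomps y" "rank_le s t" using 1(2) rank_le_iff rank_less_def by blast
    then obtain u where "u \<in> subcomps z" "rank_le t u" using 1(3) rank_le_iff rank_less_def by blast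
    then show "\<exists>t. t \<in> subcomps z \<and> rank_le s t" using 1(1)[OF s t(2)] by blast
  qed
qed

text \<open>If some \<open>s\<close> in \<open>subcomps z\<close> is not below \<open>w\<close>,
  then by induction every subcomputation of \<open>w\<close> is below \<open>s\<close>, and
  \<open>w\<close> is below \<open>z\<close>.\<close>

lemma rank_le_or_rlt: "rank_le z w \<or> rank_less w z"
proof (induct z arbitrary: w rule: subcomps_induct)
  case (1 z)
  show ?case
  proof (cases "rank_le z w")
    case False
    then obtain s where s: "s \<in> subcomps z" "\<not> rank_less s w" using rank_le_iff by blast
    have "rank_less t s" if "t \<in> subcomps w" for t using 1[OF s(1), of t] s(2) that rank_less_def by blast
    then have "rank_le w s" using rank_le_iff by blast
    then show ?thesis using s(1) rank_less_def by blast
  qed simp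
qed

lemma rank_less_irrefl0: "t \<in> subcomps w \<Longrightarrow> \<not> rank_le w t"
proof (induct w arbitrary: t rule: subcomps_induct)
  case (1 w)
  then show ?case using rank_le_iff[of w t] rank_less_def by blast
qed

lemma rank_le_not_rlt: "rank_le z w \<Longrightarrow> \<not> rank_less w z"
  unfolding rank_less_def using rank_le_trans rank_less_irrefl0 by blast

lemma rank_less_iff: "rank_less z w \<longleftrightarrow> \<not> rank_le w z"
  using rank_le_or_rlt rank_le_not_rlt by metis

lemma rank_le_Sub: "t \<in> subcomps w \<Longrightarrow> rank_le t w"
proof (induct t arbitrary: w rule: subcomps_induct)
  case (1 t)
  then show ?case unfolding rank_le_iff[of t w] rank_less_def by blast
qed

lemma rank_less_rle: "rank_less z w \<Longrightarrow> rank_le z w"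
  unfolding rank_less_def using rank_le_trans rank_le_Sub by blast

lemma rank_le_rlt_trans: "rank_le x y \<Longrightarrow> rank_less y z \<Longrightarrow> rank_less x z"
  and rank_less_rle_trans: "rank_less x y \<Longrightarrow> rank_le y z \<Longrightarrow> rank_less x z"
  using rank_less_iff rank_le_trans by metis+

lemma rank_less_Sub: "s \<in> subcomps z \<Longrightarrow> rank_less s z"
  unfolding rank_less_def using rank_le_refl by blast

text \<open>By induction on \<open>w\<close>, everything of rank at most that of \<open>w\<close> is
  accessible: whatever lies below it is bounded by a single subcomputation of
  \<open>w\<close>.\<close>

lemma wf_rlt: "wf {(x, y). rank_less x y}"
proof -
  have "\<forall>z. rank_le z w \<longrightarrow> z \<in> Wellfounded.acc {(x, y). rank_less x y}" for w
  proof (induct w rule: subcomps_induct)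
    case (1 w)
    show ?case
    proof (intro allI impI, rule acc.intros)
      fix z y assume "rank_le z w" "(y, z) \<in> {(x, y). rank_less x y}"
      then have "rank_less y w" using rank_less_rle_trans by blast
      then obtain t where "t \<in> subcomps w" "rank_le y t" unfolding rank_less_def by blast
      then show "y \<in> Wellfounded.acc {(x, y). rank_less x y}" using 1 by blast
    qed
  qed
  then show ?thesis unfolding wf_iff_acc using rank_le_refl by blast
qed

lemma subcomps_leaf: "is_leaf p \<Longrightarrow> subcomps (f, p) = {}"
  by (simp add: subcomps_def)

lemma subcomps_node: "conv f p \<Longrightarrow> \<not> is_leaf p \<Longrightarrow> subcomps (f, p) = insert (f, tail f p) (range (\<lambda>y. (f, child p y)))"
  by (simp add: subcomps_def)

lemma rank_le_leaf: "is_leaf p \<Longrightarrow> rank_le (f, p) w"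
  by (simp add: rank_le_iff subcomps_leaf)

text \<open>Divergent computations have rank infinity here.\<close>

definition stage_le :: "nat \<Rightarrow> nat \<Rightarrow> bool" where
  "stage_le p q = (conv zero p \<and> (conv zero q \<longrightarrow> rank_le (zero, p) (zero, q)))"

lemma stage_le_leaf: "is_leaf p \<Longrightarrow> stage_le p q"
  by (simp add: stage_le_def conv_leaf rank_le_leaf)

lemma stage_le_leaf2: "\<not> is_leaf p \<Longrightarrow> is_leaf q \<Longrightarrow> \<not> stage_le p q"
  using rank_le_iff[of "(zero, p)" "(zero, q)"] by (auto simp: stage_le_def conv_leaf subcomps_node subcomps_leaf rank_less_def)

text \<open>The case split ensures that a tail is consulted only once the children that determine it
  are known to converge. If every child of \<open>p\<close> is bounded by a child of
  \<open>q\<close>, the children of \<open>p\<close> converge. Otherwise one child of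
  \<open>p\<close> exceeds all children of \<open>q\<close>; these then converge, and only the tail
  of \<open>q\<close> can still bound \<open>p\<close>.\<close>

lemma stage_le_node:
  assumes p: "\<not> is_leaf p" and q: "\<not> is_leaf q" and pq: "conv zero p \<or> conv zero q"
  shows "stage_le p q \<longleftrightarrow>
     (if \<forall>y. \<exists>y'. stage_le (child p y) (child q y') then (\<exists>y'. stage_le (tail zero p) (child q y')) \<or> stage_le (tail zero p) (tail zero q)
      else (\<forall>y. stage_le (child p y) (tail zero q)) \<and> stage_le (tail zero p) (tail zero q))"
    (is "_ = (if ?A then ?B \<or> ?R else ?B' \<and> ?R)")
proof -
  note cp = conv_node[OF p, of zero] and cq = conv_node[OF q, of zero]
  show ?thesis
  proof (cases "conv zero p")
    case False
    then have "\<not> stage_le p q" by (simp add: stage_le_def)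
    moreover have "\<not> ?R \<and> \<not> ?B" if ?A using that False cp by (auto simp: stage_le_def)
    moreover have "\<not> (?B' \<and> ?R)" using False cp by (auto simp: stage_le_def)
    ultimately show ?thesis by auto
  next
    case P: True
    then have c: "conv zero (child p y)" "conv zero (tail zero p)" for y using cp by auto
    show ?thesis
    proof (cases "conv zero q")
      case False
      then have "stage_le p q" using P by (simp add: stage_le_def)
      moreover have ?R if "\<not> ?B"
        using that False cq c by (auto simp: stage_le_def)
      moreover have "?B' \<and> ?R" if "\<not> ?A"
        using that False cq c by (auto simp: stage_le_def)
      ultimately show ?thesis by auto
    next
      case Q: True
      then have d: "conv zero (child q y)" "conv zero (tail zero q)" for y using cq by auto
      let ?l = "\<lambda>a b. rank_le (zero, a) (zero, b)"
      have L: "stage_le a b \<longleftrightarrow> ?l a b" if "conv zero a" "conv zero b" for a b using that by (simp add: stage_le_def)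
      have main: "?l p q \<longleftrightarrow> (\<forall>y. (\<exists>y'. ?l (child p y) (child q y')) \<or> ?l (child p y) (tail zero q)) \<and>
         ((\<exists>y'. ?l (tail zero p) (child q y')) \<or> ?l (tail zero p) (tail zero q))"
        unfolding rank_le_iff[of "(zero, p)"] rank_less_def subcomps_node[OF P p] subcomps_node[OF Q q] by auto
      have tot: "?l a b \<or> ?l b a" for a b using rank_le_or_rlt rank_less_rle by metis
      show ?thesis
      proof (cases "\<forall>y. \<exists>y'. ?l (child p y) (child q y')")
        case True
        then show ?thesis using main by (simp add: L P Q c d)
      next
        case False
        then obtain y0 where y0: "\<And>y'. \<not> ?l (child p y0) (child q y')" by blast
        then have y0': "\<And>y'. ?l (child q y') (child p y0)" using tot by blast
        have "(\<forall>y. (\<exists>y'. ?l (child p y) (child q y')) \<or> ?l (child p y) (tail zero q)) \<longleftrightarrow> (\<forall>y. ?l (child p y) (tail zero q))"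
          using y0 y0' rank_le_trans by blast
        moreover have "(\<exists>y'. ?l (tail zero p) (child q y')) \<or> ?l (tail zero p) (tail zero q) \<longleftrightarrow> ?l (tail zero p) (tail zero q)"
          if "\<forall>y. ?l (child p y) (tail zero q)"
          using that y0' rank_le_trans by blast
        ultimately show ?thesis using main False by (simp add: L P Q c d) blast
      qed
    qed
  qed
qed

theorem stage_comparison:
  "\<exists>E. \<forall>p q. conv zero p \<or> conv zero q \<longrightarrow> run gs E (pr p q) (if stage_le p q then 0 else 1)"
proof -
  let ?OA = "\<lambda>(\<nu> :: nat \<Rightarrow> nat) x :: nat. of_bool (\<forall>y. \<exists>y'. \<nu> (pr y y') = 0) :: nat"
  let ?OB = "\<lambda>(\<nu> :: nat \<Rightarrow> nat) x :: nat. of_bool (\<exists>y. \<nu> y = 0) :: nat"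
  let ?OC = "\<lambda>(\<nu> :: nat \<Rightarrow> nat) x :: nat. of_bool (\<forall>y. \<nu> y = 0) :: nat"
  define \<phi> where "\<phi> = (\<lambda>(\<nu> :: nat \<Rightarrow> nat option) x. if is_leaf (pf x) then Some 0 else if is_leaf (ps x) then Some 1 else
    Option.bind (olift ?OA (\<lambda>n. \<nu> (pr (child (pf x) (pf n)) (child (ps x) (ps n)))) 0) (\<lambda>a.
      if a = 1 then Option.bind (tail_opt (pf x)) (\<lambda>r.
         Option.bind (olift ?OB (\<lambda>n. \<nu> (pr r (child (ps x) n))) 0) (\<lambda>b.
           if b = 1 then Some 0 else Option.bind (tail_opt (ps x)) (\<lambda>r'. \<nu> (pr r r'))))
      else Option.bind (tail_opt (ps x)) (\<lambda>r'.
         Option.bind (olift ?OC (\<lambda>n. \<nu> (pr (child (pf x) n) r')) 0) (\<lambda>b.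
           if b = 1 then Option.bind (tail_opt (pf x)) (\<lambda>r. \<nu> (pr r r')) else Some 1))))"
  have "pcomputable gs \<phi>"
    unfolding \<phi>_def by (intro pcomputable_if pcomputable_bind pcomputable_olift pcomputable_Some pcomputable_call pcomputable_pcf[OF partial_computable_To] cintro)
  from pcomputable_rec[OF this] obtain z where z: "\<And>x v \<nu>. (\<And>n w. \<nu> n = Some w \<Longrightarrow> run gs z n w) \<Longrightarrow>
     \<phi> \<nu> x = Some v \<Longrightarrow> run gs z x v" by blast
  let ?c = "\<lambda>p q. if stage_le p q then 0 else (1 :: nat)"
  have step: "run gs z (pr p q) (?c p q)"
    if n: "\<not> is_leaf p" "\<not> is_leaf q" and cpq: "conv zero p \<or> conv zero q"
      and ih: "\<And>p' q'. p' \<in> insert (tail zero p) (range (child p)) \<Longrightarrow> q' \<in> insert (tail zero q) (range (child q)) \<Longrightarrow>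
         run gs z (pr p' q') (?c p' q')" for p q
  proof -
    \<comment> \<open>As in \<open>universal\<close>, the oracle is cut down to the answers that
      \<open>z\<close> provably gives; \<open>ih\<close> puts all pairs of subcomputations among
      them.\<close>
    define \<nu> where "\<nu> = (\<lambda>n. if run gs z n (?c (pf n) (ps n)) then Some (?c (pf n) (ps n)) else None)"
    have \<nu>: "\<nu> (pr p' q') = Some (?c p' q')" if "p' \<in> insert (tail zero p) (range (child p))"
      "q' \<in> insert (tail zero q) (range (child q))" for p' q'
      using ih[OF that] by (simp add: \<nu>_def)
    have \<nu>1: "\<nu> (pr (child p y) (child q y')) = Some (?c (child p y) (child q y'))"
      "\<nu> (pr (tail zero p) (child q y')) = Some (?c (tail zero p) (child q y'))"
      "\<nu> (pr (child p y) (tail zero q)) = Some (?c (child p y) (tail zero q))"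
      "\<nu> (pr (tail zero p) (tail zero q)) = Some (?c (tail zero p) (tail zero q))" for y y'
      by (rule \<nu>; simp)+
    note cp = conv_node[OF n(1), of zero] and cq = conv_node[OF n(2), of zero]
    have OA: "olift ?OA (\<lambda>k. \<nu> (pr (child p (pf k)) (child q (ps k)))) 0
       = Some (of_bool (\<forall>y. \<exists>y'. stage_le (child p y) (child q y')))"
      by (subst olift_Some[where h = "\<lambda>k. ?c (child p (pf k)) (child q (ps k))"]) (simp_all only: \<nu>1, auto)
    have OB: "olift ?OB (\<lambda>k. \<nu> (pr (tail zero p) (child q k))) 0 = Some (of_bool (\<exists>y'. stage_le (tail zero p) (child q y')))"
      by (subst olift_Some[where h = "\<lambda>k. ?c (tail zero p) (child q k)"]) (simp_all only: \<nu>1, auto)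
    have OC: "olift ?OC (\<lambda>k. \<nu> (pr (child p k) (tail zero q))) 0 = Some (of_bool (\<forall>y. stage_le (child p y) (tail zero q)))"
      by (subst olift_Some[where h = "\<lambda>k. ?c (child p k) (tail zero q)"]) (simp_all only: \<nu>1, auto)
    have Tp: "tail_opt p = Some (tail zero p)" if "\<forall>y. conv zero (child p y)" using that by (simp add: tail_opt_def)
    have Tq: "tail_opt q = Some (tail zero q)" if "\<forall>y. conv zero (child q y)" using that by (simp add: tail_opt_def)
    have phi: "\<phi> \<nu> (pr p q) = Some (?c p q)"
    proof (cases "\<forall>y. \<exists>y'. stage_le (child p y) (child q y')")
      case A: True
      then have 1: "tail_opt p = Some (tail zero p)" by (intro Tp) (auto simp: stage_le_def)
      show ?thesis
      proof (cases "\<exists>y'. stage_le (tail zero p) (child q y')")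
        case True
        then show ?thesis using A n stage_le_node[OF n cpq]
          by (simp only: \<phi>_def pf_pr ps_pr OA OB 1 if_False bind.simps) simp
      next
        case False
        have "tail_opt q = Some (tail zero q)" using False cpq cp cq by (intro Tq) (auto simp: stage_le_def)
        then show ?thesis using A n stage_le_node[OF n cpq] False
          by (simp only: \<phi>_def pf_pr ps_pr OA OB 1 if_False bind.simps) (simp add: \<nu>1)
      qed
    next
      case A: False
      then have 1: "tail_opt q = Some (tail zero q)" using cpq cp cq by (intro Tq) (auto simp: stage_le_def)
      show ?thesis
      proof (cases "\<forall>y. stage_le (child p y) (tail zero q)")
        case True
        then have "tail_opt p = Some (tail zero p)" by (intro Tp) (auto simp: stage_le_def)
        then show ?thesis using A n stage_le_node[OF n cpq] True
          by (simp only: \<phi>_def pf_pr ps_pr OA OC 1 if_False bind.simps) (simp add: \<nu>1)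
      next
        case False
        then show ?thesis using A n stage_le_node[OF n cpq]
          by (simp only: \<phi>_def pf_pr ps_pr OA OC 1 if_False bind.simps) simp
      qed
    qed
    show ?thesis
    proof (rule z[OF _ phi])
      show "run gs z n w" if "\<nu> n = Some w" for n w
        using that unfolding \<nu>_def by (simp split: if_split_asm)
    qed
  qed
  have leaf1: "run gs z (pr p q) (?c p q)" if "is_leaf p" for p q
    by (rule z[of "\<lambda>_. None"]) (simp_all add: stage_le_leaf \<phi>_def that)
  have leaf2: "run gs z (pr p q) (?c p q)" if "\<not> is_leaf p" "is_leaf q" for p q
    by (rule z[of "\<lambda>_. None"]) (simp_all add: stage_le_leaf2 \<phi>_def that)
  \<comment> \<open>The induction follows the one argument that converges, on either side of the
    pair, while the other stays arbitrary. The variable \<open>f\<close> only serves to match the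
    pairs of \<open>subcomps_induct\<close>.\<close>
  have main: "conv f r \<Longrightarrow> f = zero \<Longrightarrow> \<forall>q. run gs z (pr r q) (?c r q) \<and> run gs z (pr q r) (?c q r)" for f r
  proof (induct "(f, r)" arbitrary: r rule: subcomps_induct)
    case 1
    have ih: "\<forall>q. run gs z (pr r' q) (?c r' q) \<and> run gs z (pr q r') (?c q r')"
      if "r' \<in> insert (tail zero r) (range (child r))" "\<not> is_leaf r" for r'
      using that 1(2,3) conv_node[of r zero] by (intro 1(1)) (auto simp: subcomps_node)
    show ?case
    proof (intro allI conjI)
      fix q
      show "run gs z (pr r q) (?c r q)"
      proof (cases "is_leaf r")
        case True
        then show ?thesis by (rule leaf1)
      next
        case r: False
        show ?thesis
        proof (cases "is_leaf q")
          case True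
          then show ?thesis using r by (intro leaf2)
        next
          case False
          show ?thesis using 1(2,3) ih r by (intro step[OF r False]) simp_all
        qed
      qed
      show "run gs z (pr q r) (?c q r)"
      proof (cases "is_leaf q")
        case True
        then show ?thesis by (rule leaf1)
      next
        case q: False
        show ?thesis
        proof (cases "is_leaf r")
          case True
          then show ?thesis using q by (intro leaf2)
        next
          case False
          show ?thesis using 1(2,3) ih False by (intro step[OF q False]) simp_all
        qed
      qed
    qed
  qed
  have "run gs z (pr p q) (?c p q)" if "conv zero p \<or> conv zero q" for p q
    using that main[OF _ refl] by blast
  then show ?thesis by blast
qed

section \<open>The ordinal of the Suslin functional\<close>

lemma comp_relI:
  assumes "decidable gs (\<lambda>\<nu> x. (pf x, ps x) \<in> R)"
  shows "comp_rel Suslin gs R"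
proof -
  have "computable gs (\<lambda>\<nu> x. if (pf x, ps x) \<in> R then 0 else 1)"
    by (rule computable_cong[OF computable_diff[OF computable_const[of _ 1] assms]]) auto
  from computable_pure[OF this] obtain F where F: "\<And>x. run gs F x (if (pf x, ps x) \<in> R then 0 else 1)" by blast
  have "tf gs (Suc (Suc 0)) (\<lambda>as. pr (as ! 0) (as ! 1))" by (intro tf_pr tf_proj) auto
  from kcs_rearrange[OF this, of F] obtain E where
    E: "\<And>as v. length as = Suc (Suc 0) \<Longrightarrow> run gs F (pr (as ! 0) (as ! 1)) v \<Longrightarrow> kcs gs E as v" by blast
  have "kc Suslin E [a, b] gs (if (a, b) \<in> R then 0 else 1)" for a b
    using E[of "[a, b]"] F[of "pr a b"] unfolding kcs_def by simp
  then show ?thesis unfolding comp_rel_def by blast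
qed

text \<open>The least representatives of the ranks, ordered by rank, form \<open>\<omega>\<^sub>1\<close> of the Suslin functional.\<close>

definition rep :: "nat \<Rightarrow> bool" where
  "rep s = (conv zero s \<and> (\<forall>u. u < s \<longrightarrow> \<not> (conv zero u \<and> rank_le (zero, u) (zero, s) \<and> rank_le (zero, s) (zero, u))))"

definition Wrel :: "nat rel" where
  "Wrel = {(s, t). rep s \<and> rep t \<and> rank_le (zero, s) (zero, t)}"

lemma ex_rep:
  assumes "conv zero p"
  shows "\<exists>s. rep s \<and> rank_le (zero, p) (zero, s) \<and> rank_le (zero, s) (zero, p)"
proof -
  let ?Q = "\<lambda>s. conv zero s \<and> rank_le (zero, p) (zero, s) \<and> rank_le (zero, s) (zero, p)"
  have Q: "?Q (LEAST s. ?Q s)" by (rule LeastI[of ?Q p]) (use assms rank_le_refl in auto)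
  moreover have "rep (LEAST s. ?Q s)" unfolding rep_def
  proof (intro conjI allI impI notI)
    fix u assume u: "u < (LEAST s. ?Q s)"
      "conv zero u \<and> rank_le (zero, u) (zero, LEAST s. ?Q s) \<and> rank_le (zero, LEAST s. ?Q s) (zero, u)"
    then have "?Q u" using Q rank_le_trans by blast
    then show False using u(1) not_less_Least by blast
  qed (use Q in blast)
  ultimately show ?thesis by blast
qed

lemma rep_eq: "rep s \<Longrightarrow> rep t \<Longrightarrow> rank_le (zero, s) (zero, t) \<Longrightarrow> rank_le (zero, t) (zero, s) \<Longrightarrow> s = t"
  unfolding rep_def by (metis linorder_neqE_nat)

lemma Field_Wrel: "Field Wrel = {s. rep s}"
  unfolding Wrel_def Field_def using rank_le_refl by auto

lemma Well_order_Wrel: "Well_order Wrel"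
  unfolding well_order_on_def linear_order_on_def partial_order_on_def preorder_on_def Field_Wrel
proof (intro conjI)
  show "Wrel \<subseteq> {s. rep s} \<times> {s. rep s}" unfolding Wrel_def by auto
  show "refl_on {s. rep s} Wrel" unfolding refl_on_def Wrel_def using rank_le_refl by auto
  show "trans Wrel" unfolding trans_def Wrel_def using rank_le_trans by blast
  show "antisym Wrel" unfolding antisym_def Wrel_def using rep_eq by blast
  show "total_on {s. rep s} Wrel" unfolding total_on_def Wrel_def using rank_le_or_rlt rank_less_rle by blast
  have "Wrel - Id \<subseteq> inv_image {(x, y). rank_less x y} (\<lambda>s. (zero, s))"
    unfolding Wrel_def inv_image_def using rep_eq rank_less_iff by auto
  then show "wf (Wrel - Id)" using wf_subset[OF wf_inv_image[OF wf_rlt]] by blast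
qed

definition Wseg :: "nat \<Rightarrow> nat rel" where
  "Wseg a = {(s, t). (s, t) \<in> Wrel \<and> rank_less (zero, s) (zero, a) \<and> rank_less (zero, t) (zero, a)}"

lemma Restr_underS_Wrel:
  assumes "a \<in> Field Wrel" shows "Restr Wrel (underS Wrel a) = Wseg a"
proof -
  have "(s \<in> underS Wrel a) = (rep s \<and> rank_less (zero, s) (zero, a))" for s
  proof
    assume "s \<in> underS Wrel a"
    then have "s \<noteq> a" "rep s" "rep a" "rank_le (zero, s) (zero, a)" unfolding underS_def Wrel_def by auto
    then show "rep s \<and> rank_less (zero, s) (zero, a)" using rep_eq rank_less_iff by blast
  next
    assume "rep s \<and> rank_less (zero, s) (zero, a)"
    then show "s \<in> underS Wrel a" unfolding underS_def Wrel_def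
      using assms rank_less_rle rank_less_iff rank_le_refl by (auto simp: Field_Wrel)
  qed
  then show ?thesis unfolding Wseg_def Wrel_def by auto
qed

text \<open>A comparison with the fixed convergent \<open>a\<close> always terminates and decides
  \<open>?P\<close>, that is, convergence with rank below that of \<open>a\<close>. Among such
  numbers all comparisons terminate, and being the least representative is a bounded quantifier over
  them.\<close>

lemma comp_rel_Wseg:
  assumes a: "conv zero a" shows "comp_rel Suslin gs (Wseg a)"
proof -
  obtain E where E: "\<And>p q. conv zero p \<or> conv zero q \<Longrightarrow> run gs E (pr p q) (if stage_le p q then 0 else 1)"
    using stage_comparison by blast
  let ?P = "\<lambda>s. \<not> stage_le a s"
  have P: "?P s \<longleftrightarrow> conv zero s \<and> rank_less (zero, s) (zero, a)" for s
    using a rank_less_iff by (auto simp: stage_le_def)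
  let ?T = "\<lambda>x. if conv zero (pf x) \<or> conv zero (ps x) then Some (if stage_le (pf x) (ps x) then 0 else 1 :: nat) else None"
  have "run gs E x v" if "?T x = Some v" for x v
    using E[of "pf x" "ps x"] that by (simp split: if_split_asm)
  then have T: "partial_computable gs ?T" unfolding partial_computable_def by blast
  have "pcomputable gs (\<lambda>\<nu> x. ?T (pr a x))" by (rule pcomputable_pcf[OF T]) (intro cintro)
  from pcomputable_pcfD[OF this] obtain F where F: "\<And>x v. ?T (pr a x) = Some v \<Longrightarrow> run gs F x v"
    unfolding partial_computable_def by blast
  have "run gs F x (of_bool (?P x))" for x by (rule F) (use a in simp)
  then have DP: "decidable gs (\<lambda>\<nu> x. ?P x)" by (rule pure_C)
  have DP': "computable gs b \<Longrightarrow> decidable gs (\<lambda>\<nu> x. ?P (b \<nu> x))" for b by (rule computable_comp[OF DP])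
  let ?L = "\<lambda>x. ?P (pf x) \<and> ?P (ps x) \<and> stage_le (pf x) (ps x)"
  have "pcomputable gs (\<lambda>\<nu> x. if ?P (pf x) \<and> ?P (ps x) then ?T x else Some 1)"
    by (intro pcomputable_if pcomputable_pcf[OF T] pcomputable_Some DP' cintro)
  from pcomputable_pcfD[OF this] obtain F where F: "\<And>x v. (if ?P (pf x) \<and> ?P (ps x) then ?T x else Some 1) = Some v \<Longrightarrow> run gs F x v"
    unfolding partial_computable_def by blast
  have "run gs F x (1 - of_bool (?L x))" for x
    by (rule F) (use P in auto)
  then have "computable gs (\<lambda>\<nu> x. 1 - of_bool (?L x))" by (rule pure_C)
  then have DL: "decidable gs (\<lambda>\<nu> x. ?L x)"
    by (rule computable_cong[OF computable_diff[OF computable_const[of _ 1]]]) auto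
  have DL': "computable gs b \<Longrightarrow> computable gs c \<Longrightarrow> decidable gs (\<lambda>\<nu> x. ?P (b \<nu> x) \<and> ?P (c \<nu> x) \<and> stage_le (b \<nu> x) (c \<nu> x))" for b c
    using computable_comp[OF DL, of "\<lambda>\<nu> x. pr (b \<nu> x) (c \<nu> x)"] by (simp add: computable_pr)
  let ?LL = "\<lambda>s t. ?P s \<and> ?P t \<and> stage_le s t"
  have seg: "(s, t) \<in> Wseg a \<longleftrightarrow> ?LL s t \<and> (\<forall>u. u < s \<longrightarrow> \<not> (?LL u s \<and> ?LL s u))
     \<and> (\<forall>u. u < t \<longrightarrow> \<not> (?LL u t \<and> ?LL t u))" for s t
  proof -
    have L: "?LL u v \<longleftrightarrow> conv zero u \<and> conv zero v \<and> rank_less (zero, u) (zero, a) \<and> rank_less (zero, v) (zero, a) \<and> rank_le (zero, u) (zero, v)" for u v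
      unfolding P using stage_le_def[of u v] by blast
    have R: "rep s \<longleftrightarrow> (\<forall>u. u < s \<longrightarrow> \<not> (?LL u s \<and> ?LL s u))" if "conv zero s" "rank_less (zero, s) (zero, a)" for s
      unfolding L rep_def using that rank_le_rlt_trans by blast
    show ?thesis
    proof (cases "conv zero s \<and> rank_less (zero, s) (zero, a) \<and> conv zero t \<and> rank_less (zero, t) (zero, a)")
      case True
      then show ?thesis using R[of s] R[of t] unfolding Wseg_def Wrel_def by (auto simp: L)
    next
      case False
      then have "\<not> ?LL s t" unfolding L by blast
      moreover have "(s, t) \<notin> Wseg a" using False unfolding Wseg_def Wrel_def rep_def by auto
      ultimately show ?thesis by blast
    qed
  qed
  show ?thesis
    by (rule comp_relI, unfold seg, intro DL' cintro) 
qed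

definition good :: "(nat \<Rightarrow> nat) \<Rightarrow> bool" where
  "good f = (\<forall>q. conv f q \<longrightarrow> (\<exists>p. conv zero p \<and> rank_le (f, q) (zero, p)))"

text \<open>The states \<open>stBar e x\<close> recurse along \<open>R\<close>, so their ranks
  increase strictly along \<open>R\<close> and \<open>stBA e\<close> exceeds them all. An embedding
  of \<open>Wrel\<close> into \<open>R\<close> would push these ranks beyond the bound that
  \<open>good\<close> provides for \<open>stBA e\<close>.\<close>

lemma comp_wo_less_Wrel:
  assumes g: "good f" and gs: "gs = [] \<or> gs = [f]" and R: "comp_wo Suslin gs R"
  shows "(R, Wrel) \<in> ordLess"
proof (rule ccontr)
  assume no: "(R, Wrel) \<notin> ordLess"
  have wo: "Well_order R" and "comp_rel Suslin gs R" using R unfolding comp_wo_def by auto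
  then obtain e where e: "\<And>a b. kc Suslin e [a, b] gs (if (a, b) \<in> R then 0 else 1)"
    unfolding comp_rel_def by blast
  have K: "evals f (stK e (ccons a (ccons b 0))) (if (a, b) \<in> R then 0 else 1)" for a b
    using kc_imp_ev[OF e gs, of a b] by (simp add: ccons_def)
  have vK: "result f (stK e (ccons a (ccons b 0))) = (if (a, b) \<in> R then 0 else 1)" for a b
    by (rule result_eq[OF K])
  have rtW: "tail f (stW e x y) = (if (y, x) \<in> R \<and> x \<noteq> y then stBar e y else stL 0)" for x y
    by (simp add: tail_def vK)
  have wfR: "wf (R - Id)" using wo unfolding well_order_on_def by blast
  have cW: "conv f (stW e x y)" if "(y, x) \<in> R - Id \<Longrightarrow> conv f (stBar e y)" for x y
    using that K conv_leaf by (subst conv_node) (auto simp: rtW conv_def)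
  have cB: "conv f (stBar e x)" for x
  proof (induct x rule: wf_induct_rule[OF wfR])
    case (1 x)
    then show ?case by (subst conv_node) (auto simp: tail_def intro: cW conv_leaf)
  qed
  have cA: "conv f (stBA e)"
    by (subst conv_node) (auto simp: tail_def intro: cB conv_leaf)
  have less: "rank_less (f, stBar e y) (f, stBar e x)" if "(y, x) \<in> R" "x \<noteq> y" for x y
  proof -
    have "(f, stBar e y) \<in> subcomps (f, stW e x y)" using that cW cB by (simp add: subcomps_node rtW)
    moreover have "(f, stW e x y) \<in> subcomps (f, stBar e x)" using cB by (simp add: subcomps_node)
    ultimately show ?thesis using rank_less_Sub rank_less_rle rank_le_rlt_trans by blast
  qed
  have lessA: "rank_less (f, stBar e x) (f, stBA e)" for x
    using cA by (intro rank_less_Sub) (simp add: subcomps_node)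
  obtain p where p: "conv zero p" "rank_le (f, stBA e) (zero, p)" using g cA unfolding good_def by blast
  obtain a where a: "rep a" "rank_le (zero, p) (zero, a)" using ex_rep[OF p(1)] by blast
  have "(Wrel, R) \<in> ordLeq" using no wo Well_order_Wrel not_ordLess_iff_ordLeq by blast
  then obtain j where j: "embed Wrel R j" unfolding ordLeq_def by blast
  have inj: "inj_on j (Field Wrel)" using embed_inj_on[OF Well_order_Wrel j] .
  have mono: "(j s, j t) \<in> R" if "(s, t) \<in> Wrel" for s t
    using embed_compat[OF j] that unfolding compat_def by blast
  \<comment> \<open>A subcomputation of \<open>s\<close> need not be in the domain of the embedding;
    it is replaced by the representative of its rank, which lies below \<open>s\<close> in
    \<open>Wrel\<close>.\<close>
  have main: "rep s \<Longrightarrow> rank_le (zero, s) (f, stBar e (j s))" for s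
  proof (induct "(zero, s)" arbitrary: s rule: wf_induct_rule[OF wf_rlt])
    case 1
    show ?case unfolding rank_le_iff[of "(zero, s)"]
    proof
      fix u assume u: "u \<in> subcomps (zero, s)"
      obtain u' where u': "u = (zero, u')" "conv zero u'"
        using u conv_node[of s zero] by (auto simp: subcomps_def split: if_splits)
      obtain r where r: "rep r" "rank_le u (zero, r)" "rank_le (zero, r) u" using ex_rep[OF u'(2)] u'(1) by blast
      have lt: "rank_less (zero, r) (zero, s)" using r(3) u rank_less_Sub rank_le_rlt_trans by blast
      then have "(r, s) \<in> Wrel" "r \<noteq> s" using r 1(2) rank_less_rle rank_less_iff rank_le_refl unfolding Wrel_def by auto
      then have "(j r, j s) \<in> R" "j r \<noteq> j s"
        using mono inj r(1) 1(2) unfolding inj_on_def Field_Wrel by auto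
      then have "rank_less (f, stBar e (j r)) (f, stBar e (j s))" using less by metis
      moreover have "rank_le (zero, r) (f, stBar e (j r))" using 1(1)[of r] lt r(1) by auto
      ultimately show "rank_less u (f, stBar e (j s))" using r(2) rank_le_trans rank_le_rlt_trans by blast
    qed
  qed
  have "rank_less (zero, a) (zero, a)"
    using main[OF a(1)] lessA p(2) a(2) rank_le_rlt_trans rank_less_rle_trans by blast
  then show False using rank_less_iff rank_le_refl by blast
qed

text \<open>Every order shorter than \<open>Wrel\<close> is isomorphic to a proper initial segment
  \<open>Wseg a\<close>, and \<open>a\<close> converges; the segment is computable from the Suslin
  functional without use of \<open>f\<close>.\<close>

lemma is_omega1_Wrel:
  assumes "good f" and "gs = [] \<or> gs = [f]"
  shows "is_omega1 Suslin gs Wrel"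
  unfolding is_omega1_def
proof (intro conjI allI impI)
  show "Well_order Wrel" by (rule Well_order_Wrel)
  show "(R, Wrel) \<notin> ordIso" if "comp_wo Suslin gs R" for R
    using comp_wo_less_Wrel[OF assms that] not_ordLess_ordIso by blast
  fix V :: "nat rel" assume V: "Well_order V \<and> (V, Wrel) \<in> ordLess"
  then obtain a where a: "a \<in> Field Wrel" "(V, Restr Wrel (underS Wrel a)) \<in> ordIso"
    using ordLess_iff_ordIso_Restr[OF Well_order_Wrel, of V] by blast
  then have "(Wseg a, V) \<in> ordIso" using Restr_underS_Wrel ordIso_symmetric by metis
  moreover have "Well_order (Wseg a)"
    using Well_order_Restr[OF Well_order_Wrel] Restr_underS_Wrel[OF a(1)] by metis
  moreover have "conv zero a" using a(1) by (simp add: Field_Wrel rep_def)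
  ultimately show "\<exists>R. comp_wo Suslin gs R \<and> (R, V) \<in> ordIso"
    using comp_rel_Wseg unfolding comp_wo_def by blast
qed

section \<open>Measure of the Suslin operation\<close>

definition susop :: "(nat \<Rightarrow> 'a set) \<Rightarrow> 'a set" where
  "susop U = {x. \<exists>h. \<forall>n. x \<in> U (seq_code h n)}"

text \<open>An outer approximation at a finite stage: finitely many tuples \<open>t\<close>, and the
  sets for \<open>k\<close> beyond the length of \<open>t\<close> repeat. It is therefore
  measurable, whereas \<open>Aset\<close> bounds only the first entries of an infinite branch and is
  not known to be measurable at this point.\<close>

definition Kset :: "(nat \<Rightarrow> 'a set) \<Rightarrow> nat list \<Rightarrow> 'a set" where
  "Kset U s = (\<Union>t\<in>{t. list_all2 (\<le>) t s}. \<Inter>k. U (list_encode (take k t)))"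

definition Aset :: "(nat \<Rightarrow> 'a set) \<Rightarrow> nat list \<Rightarrow> 'a set" where
  "Aset U s = {x. \<exists>h. (\<forall>i<length s. h i \<le> s ! i) \<and> (\<forall>n. x \<in> U (seq_code h n))}"

lemma Aset_Nil: "Aset U [] = susop U"
  by (simp add: Aset_def susop_def)

lemma Aset_snoc: "Aset U s = (\<Union>j. Aset U (s @ [j]))"
proof
  show "Aset U s \<subseteq> (\<Union>j. Aset U (s @ [j]))"
  proof
    fix x assume "x \<in> Aset U s"
    then obtain h where h: "\<forall>i<length s. h i \<le> s ! i" "\<forall>n. x \<in> U (seq_code h n)"
      unfolding Aset_def by blast
    then have "x \<in> Aset U (s @ [h (length s)])"
      unfolding Aset_def by (auto simp: nth_append less_Suc_eq)
    then show "x \<in> (\<Union>j. Aset U (s @ [j]))" by blast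
  qed
  show "(\<Union>j. Aset U (s @ [j])) \<subseteq> Aset U s"
  proof clarify
    fix x j assume "x \<in> Aset U (s @ [j])"
    then obtain h where h: "\<forall>i<length (s @ [j]). h i \<le> (s @ [j]) ! i" "\<forall>n. x \<in> U (seq_code h n)"
      unfolding Aset_def by blast
    have "h i \<le> s ! i" if "i < length s" for i using h(1)[rule_format, of i] that by (simp add: nth_append)
    then show "x \<in> Aset U s" using h(2) unfolding Aset_def by blast
  qed
qed

lemma Aset_incseq: "incseq (\<lambda>j. Aset U (s @ [j]))"
proof (rule incseq_SucI, rule subsetI)
  fix j x assume "x \<in> Aset U (s @ [j])"
  then obtain h where h: "\<forall>i<length (s @ [j]). h i \<le> (s @ [j]) ! i" "\<forall>n. x \<in> U (seq_code h n)"
    unfolding Aset_def by blast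
  have "h i \<le> (s @ [Suc j]) ! i" if "i < length (s @ [Suc j])" for i
    using h(1)[rule_format, of i] that by (auto simp: nth_append split: if_splits)
  then show "x \<in> Aset U (s @ [Suc j])" using h(2) unfolding Aset_def by blast
qed

lemma take_upt_min: "take k [0..<n] = [0..<min k n]"
  by (metis add_0 min.cobounded1 min_def nat_le_linear take_all take_upt length_upt diff_zero)

lemma Aset_subset_Kset: "Aset U s \<subseteq> Kset U s"
proof
  fix x assume "x \<in> Aset U s"
  then obtain h where h: "\<forall>i<length s. h i \<le> s ! i" "\<forall>n. x \<in> U (seq_code h n)"
    unfolding Aset_def by blast
  have "list_all2 (\<le>) (map h [0..<length s]) s" using h(1) by (simp add: list_all2_conv_all_nth)
  moreover have "x \<in> U (list_encode (take k (map h [0..<length s])))" for k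
    using h(2)[rule_format, of "min k (length s)"] by (simp add: seq_code_def take_map take_upt_min)
  ultimately show "x \<in> Kset U s" unfolding Kset_def by blast
qed

lemma Kset_mono_take: "Kset U s \<subseteq> Kset U (take n s)"
proof
  fix x assume "x \<in> Kset U s"
  then obtain t where t: "list_all2 (\<le>) t s" "\<And>k. x \<in> U (list_encode (take k t))"
    unfolding Kset_def by blast
  have "list_all2 (\<le>) (take n t) (take n s)" using t(1) by (rule list_all2_takeI)
  moreover have "x \<in> U (list_encode (take k (take n t)))" for k using t(2)[of "min k n"] by simp
  ultimately show "x \<in> Kset U (take n s)" unfolding Kset_def by blast
qed

lemma Kset_decseq: "decseq (\<lambda>n. Kset U (map g [0..<n]))"
proof (rule decseq_SucI)
  fix n
  have "take n (map g [0..<Suc n]) = map g [0..<n]" by (simp add: take_map)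
  then show "Kset U (map g [0..<Suc n]) \<subseteq> Kset U (map g [0..<n])"
    using Kset_mono_take[of U "map g [0..<Suc n]" n] by simp
qed

text \<open>Koenig's lemma for the finitely branching tree of sequences bounded by \<open>g\<close>.\<close>

lemma Kset_INT_subset: "(\<Inter>n. Kset U (map g [0..<n])) \<subseteq> susop U"
proof
  fix x assume x: "x \<in> (\<Inter>n. Kset U (map g [0..<n]))"
  define ext where "ext t n \<longleftrightarrow> (\<exists>t'. list_all2 (\<le>) t' (map g [0..<n]) \<and> take (length t) t' = t \<and>
     (\<forall>k. x \<in> U (list_encode (take k t'))))" for t n
  have ext_down: "ext t m" if e: "ext t n" and m: "length t \<le> m" "m \<le> n" for t m n
  proof -
    obtain t' where t': "list_all2 (\<le>) t' (map g [0..<n])" "take (length t) t' = t"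
      "\<forall>k. x \<in> U (list_encode (take k t'))" using e unfolding ext_def by blast
    have "list_all2 (\<le>) (take m t') (map g [0..<m])"
      using list_all2_takeI[OF t'(1), of m] m by (simp add: take_map)
    moreover have "take (length t) (take m t') = t" using t'(2) m by (simp add: min_def)
    moreover have "x \<in> U (list_encode (take k (take m t')))" for k using t'(3)[rule_format, of "min k m"] by simp
    ultimately show ?thesis unfolding ext_def by blast
  qed
  have step: "\<exists>j. \<forall>n\<ge>length (t @ [j]). ext (t @ [j]) n" if t: "\<forall>n\<ge>length t. ext t n" for t
  proof (rule ccontr)
    assume "\<nexists>j. \<forall>n\<ge>length (t @ [j]). ext (t @ [j]) n"
    then obtain N where N: "\<And>j. N j \<ge> length (t @ [j])" "\<And>j. \<not> ext (t @ [j]) (N j)" by metis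
    \<comment> \<open>Each possible next entry fails at some level \<open>N j\<close>. Only finitely
      many entries are allowed, and extendability passes down to lower levels, so all of them fail
      at the maximum.\<close>
    define n where "n = Max (N ` {..g (length t)})"
    have n: "N j \<le> n" if "j \<le> g (length t)" for j unfolding n_def using that by (intro Max_ge) auto
    have ln: "length t < n" using n[of 0] N(1)[of 0] by simp
    then obtain t' where t': "list_all2 (\<le>) t' (map g [0..<n])" "take (length t) t' = t"
      "\<forall>k. x \<in> U (list_encode (take k t'))" using t[rule_format, of n] unfolding ext_def by auto
    have len: "length t' = n" using list_all2_lengthD[OF t'(1)] by simp
    let ?j = "t' ! length t"
    have j: "?j \<le> g (length t)" using list_all2_nthD[OF t'(1), of "length t"] len ln by simp
    have "take (length (t @ [?j])) t' = t @ [?j]" using t'(2) len ln by (simp add: take_Suc_conv_app_nth)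
    then have "ext (t @ [?j]) n" unfolding ext_def using t'(1,3) by blast
    then show False using ext_down[OF _ N(1) n[OF j]] N(2) by blast
  qed
  define S where "S t = (SOME j. \<forall>n\<ge>length (t @ [j]). ext (t @ [j]) n)" for t
  define L where "L = rec_nat [] (\<lambda>_ t. t @ [S t])"
  have L: "length (L n) = n \<and> (\<forall>m\<ge>n. ext (L n) m)" for n
  proof (induct n)
    case 0
    have "ext [] m" for m using x unfolding ext_def Kset_def by auto
    then show ?case by (simp add: L_def)
  next
    case (Suc n)
    have "\<forall>m\<ge>length (L n @ [S (L n)]). ext (L n @ [S (L n)]) m"
      unfolding S_def by (rule someI_ex) (rule step, use Suc in auto)
    then show ?case using Suc by (simp add: L_def)
  qed
  define h where "h n = S (L n)" for n
  have Lh: "L n = map h [0..<n]" for n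
    by (induct n) (simp_all add: L_def h_def)
  have "x \<in> U (seq_code h n)" for n
  proof -
    have "ext (L n) n" using L by blast
    then obtain t' where t': "list_all2 (\<le>) t' (map g [0..<n])" "take (length (L n)) t' = L n"
      "\<forall>k. x \<in> U (list_encode (take k t'))" unfolding ext_def by blast
    then show ?thesis using t'(3)[rule_format, of n] L[of n] unfolding seq_code_def Lh[symmetric] by simp
  qed
  then show "x \<in> susop U" unfolding susop_def by blast
qed

context finite_measure
begin

lemma Kset_sets: "(\<And>s. U s \<in> sets M) \<Longrightarrow> Kset U s \<in> sets M"
  unfolding Kset_def by (intro sets.countable_UN'' countableI_type sets.countable_INT) auto

text \<open>Outer measure is continuous along increasing sequences of arbitrary sets. So the next
  entry of \<open>g\<close> can be chosen large enough to keep the branches below \<open>g\<close>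
  above \<open>r\<close>, although these sets are not yet known to be measurable.\<close>

lemma suslin_lower:
  assumes U: "\<And>s. U s \<in> sets M" and sp: "space M = UNIV" and C: "C \<in> sets M"
    and r: "ennreal r < outer_measure_of M (C \<inter> susop U)"
  shows "\<exists>g. \<forall>n. r \<le> measure M (C \<inter> Kset U (map g [0..<n]))"
proof -
  let ?o = "\<lambda>s. outer_measure_of M (C \<inter> Aset U s)"
  have step: "\<exists>j. ennreal r < ?o (s @ [j])" if "ennreal r < ?o s" for s
  proof -
    have "(SUP j. ?o (s @ [j])) = outer_measure_of M (\<Union>j. C \<inter> Aset U (s @ [j]))"
      by (rule SUP_outer_measure_of_incseq) (use Aset_incseq[of U s] in \<open>auto simp: sp incseq_def\<close>)
    also have "(\<Union>j. C \<inter> Aset U (s @ [j])) = C \<inter> Aset U s" using Aset_snoc[of U s] by blast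
    finally have "ennreal r < (SUP j. ?o (s @ [j]))" using that by simp
    then show ?thesis by (simp add: less_SUP_iff)
  qed
  define S where "S t = (SOME j. ennreal r < ?o (t @ [j]))" for t
  define L where "L = rec_nat [] (\<lambda>_ t. t @ [S t])"
  have L: "ennreal r < ?o (L n)" for n
  proof (induct n)
    case 0
    then show ?case using r by (simp add: L_def Aset_Nil)
  next
    case (Suc n)
    have "ennreal r < ?o (L n @ [S (L n)])" unfolding S_def by (rule someI_ex) (use step Suc in blast)
    then show ?case by (simp add: L_def)
  qed
  define g where "g n = S (L n)" for n
  have Lg: "L n = map g [0..<n]" for n by (induct n) (simp_all add: L_def g_def)
  have "r \<le> measure M (C \<inter> Kset U (map g [0..<n]))" for n
  proof -
    have K: "C \<inter> Kset U (L n) \<in> sets M" using C Kset_sets[of U, OF U] by blast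
    have "ennreal r < outer_measure_of M (C \<inter> Aset U (L n))" by (rule L)
    also have "\<dots> \<le> outer_measure_of M (C \<inter> Kset U (L n))"
      using Aset_subset_Kset[of U "L n"] by (intro outer_measure_of_mono) auto
    also have "\<dots> = ennreal (measure M (C \<inter> Kset U (L n)))" using K by (simp add: emeasure_eq_measure)
    finally show ?thesis unfolding Lg by (metis ennreal_leI leD nle_le)
  qed
  then show ?thesis by blast
qed

lemma Kset_INT_measure:
  assumes U: "\<And>s. U s \<in> sets M" and C: "C \<in> sets M"
    and r: "\<And>n. r \<le> measure M (C \<inter> Kset U (map g [0..<n]))"
  shows "r \<le> measure M (\<Inter>n. C \<inter> Kset U (map g [0..<n]))"
proof -
  have "(\<lambda>n. measure M (C \<inter> Kset U (map g [0..<n]))) \<longlonglongrightarrow> measure M (\<Inter>n. C \<inter> Kset U (map g [0..<n]))"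
  proof (rule finite_Lim_measure_decseq)
    show "range (\<lambda>n. C \<inter> Kset U (map g [0..<n])) \<subseteq> sets M" using C Kset_sets[of U, OF U] by blast
    show "decseq (\<lambda>n. C \<inter> Kset U (map g [0..<n]))"
      using Kset_decseq[of U g] unfolding decseq_def by blast
  qed
  then show ?thesis using r by (intro LIMSEQ_le_const) auto
qed

text \<open>Measurable sets inside \<open>susop U\<close>, obtained from bounding functions, exhaust
  its measurable hull \<open>E\<close> up to \<open>1 / Suc n\<close>. What remains of
  \<open>susop U\<close> lies in a null set, and the measure is complete.\<close>

lemma susop_sets:
  assumes U: "\<And>s. U s \<in> sets M" and sp: "space M = UNIV" and cm: "complete_measure M"
  shows "susop U \<in> sets M"
proof -
  obtain E where E: "E \<in> sets M" "susop U \<subseteq> E" "outer_measure_of M (susop U) = emeasure M E"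
    using outer_measure_of_attain[of "susop U" M] sp by auto
  have "\<exists>I\<in>sets M. I \<subseteq> susop U \<and> measure M E - 1 / Suc n \<le> measure M I" for n
  proof (cases "measure M E - 1 / Suc n < 0")
    case True
    then show ?thesis by (intro bexI[of _ "{}"]) auto
  next
    case False
    have "ennreal (measure M E - 1 / Suc n) < emeasure M E"
      unfolding emeasure_eq_measure using False by (simp add: ennreal_less_iff)
    then obtain g where g: "\<And>k. measure M E - 1 / Suc n \<le> measure M (UNIV \<inter> Kset U (map g [0..<k]))"
      using suslin_lower[of U UNIV "measure M E - 1 / Suc n", OF U sp] E(3) sets.top[of M] sp by auto
    have "measure M E - 1 / Suc n \<le> measure M (\<Inter>k. UNIV \<inter> Kset U (map g [0..<k]))"
      by (rule Kset_INT_measure[of U UNIV _ g, OF U _ g]) (use sets.top[of M] sp in auto)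
    moreover have "(\<Inter>k. Kset U (map g [0..<k])) \<in> sets M"
      by (intro sets.countable_INT) (use Kset_sets[of U, OF U] in auto)
    ultimately show ?thesis using Kset_INT_subset[of U g] by auto
  qed
  then obtain I where I: "\<And>n. I n \<in> sets M" "\<And>n. I n \<subseteq> susop U"
    "\<And>n. measure M E - 1 / Suc n \<le> measure M (I n)" by metis
  let ?I = "\<Union>n. I n"
  have Is: "?I \<in> sets M" using I(1) by blast
  have IE: "?I \<subseteq> E" using I(2) E(2) by blast
  have "measure M E - 1 / Suc n \<le> measure M ?I" for n
    using I(3)[of n] finite_measure_mono[of "I n" ?I] Is by (meson UNIV_I UN_upper order_trans)
  then have "(\<lambda>n. measure M E - 1 / Suc n) \<longlonglongrightarrow> measure M E - 0 \<Longrightarrow> measure M E - 0 \<le> measure M ?I"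
    by (intro LIMSEQ_le_const2) auto
  moreover have "(\<lambda>n. measure M E - 1 / Suc n) \<longlonglongrightarrow> measure M E - 0"
    by (intro tendsto_diff tendsto_const) (use LIMSEQ_inverse_real_of_nat in \<open>simp add: inverse_eq_divide\<close>)
  ultimately have "measure M E \<le> measure M ?I" by simp
  then have "measure M (E - ?I) = 0"
    using finite_measure_Diff[OF E(1) Is IE] measure_nonneg[of M "E - ?I"] by linarith
  then have null: "E - ?I \<in> null_sets M"
    using E(1) Is by (auto simp: null_sets_def emeasure_eq_measure)
  have "susop U - ?I \<in> sets M"
    by (rule complete_measure.complete[OF cm, of _ "E - ?I"]) (use E(2) null in auto)
  moreover have "susop U = ?I \<union> (susop U - ?I)" using I(2) by blast
  ultimately show ?thesis using Is by (metis sets.Un)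
qed

lemma suslin_measure_lower:
  assumes U: "\<And>s. U s \<in> sets M" and sp: "space M = UNIV" and cm: "complete_measure M" and C: "C \<in> sets M"
    and r: "0 \<le> r" "r < measure M (C \<inter> susop U)"
  shows "\<exists>g. \<forall>n. r \<le> measure M (C \<inter> Kset U (map g [0..<n]))"
proof (rule suslin_lower[of U C r, OF U sp C])
  have "C \<inter> susop U \<in> sets M" using susop_sets[of U, OF U sp cm] C by blast
  then show "ennreal r < outer_measure_of M (C \<inter> susop U)"
    using r by (simp add: emeasure_eq_measure ennreal_less_iff)
qed

lemma suslin_measure_upper:
  assumes U: "\<And>s. U s \<in> sets M" and sp: "space M = UNIV" and cm: "complete_measure M" and C: "C \<in> sets M"
    and r: "\<And>n. r \<le> measure M (C \<inter> Kset U (map g [0..<n]))"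
  shows "r \<le> measure M (C \<inter> susop U)"
proof -
  have "(\<Inter>n. C \<inter> Kset U (map g [0..<n])) \<subseteq> C \<inter> susop U" using Kset_INT_subset[of U g] by blast
  then have "measure M (\<Inter>n. C \<inter> Kset U (map g [0..<n])) \<le> measure M (C \<inter> susop U)"
    using susop_sets[of U, OF U sp cm] C by (intro finite_measure_mono) auto
  then show ?thesis using Kset_INT_measure[of U C r g, OF U C r] by linarith
qed

end

section \<open>Clopen sets\<close>

definition cN :: "nat \<Rightarrow> nat \<Rightarrow> nat" where "cN a b = Suc (Suc (pr a b))"

lemma pf_less: "2 \<le> c \<Longrightarrow> pf (c - 2) < c" and ps_less: "2 \<le> c \<Longrightarrow> ps (c - 2) < c"
  using pf_le[of "c - 2"] ps_le[of "c - 2"] by linarith+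

text \<open>A code above \<open>1\<close> is a tree that branches on the first bit.\<close>

function clopen :: "nat \<Rightarrow> (nat \<Rightarrow> bool) set" where
  "clopen c = (if c = 0 then {} else if c = 1 then UNIV
     else {f. if f 0 then (\<lambda>n. f (Suc n)) \<in> clopen (pf (c - 2)) else (\<lambda>n. f (Suc n)) \<in> clopen (ps (c - 2))})"
  by auto
termination
  by (relation "Wellfounded.measure id") (auto intro!: pf_less ps_less simp del: One_nat_def)
declare clopen.simps [simp del]

lemma clopen_0 [simp]: "clopen 0 = {}" and clopen_1 [simp]: "clopen (Suc 0) = UNIV"
  and clopen_N: "clopen (cN a b) = {f. if f 0 then (\<lambda>n. f (Suc n)) \<in> clopen a else (\<lambda>n. f (Suc n)) \<in> clopen b}"
  by (subst clopen.simps; simp add: cN_def)+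

lemma clopen_1' [simp]: "clopen 1 = UNIV" by simp

lemma cN_cases: "(c = 0 \<Longrightarrow> P) \<Longrightarrow> (c = 1 \<Longrightarrow> P) \<Longrightarrow> (\<And>a b. c = cN a b \<Longrightarrow> P) \<Longrightarrow> P"
proof -
  assume *: "c = 0 \<Longrightarrow> P" "c = 1 \<Longrightarrow> P" "\<And>a b. c = cN a b \<Longrightarrow> P"
  have "c = cN (pf (c - 2)) (ps (c - 2))" if "2 \<le> c" using that by (simp add: cN_def)
  then show P using * by (metis One_nat_def Suc_1 less_2_cases not_less)
qed

lemma cN_less: "a < cN a b" "b < cN a b"
  unfolding cN_def using le_prod_encode_1[of a b] le_prod_encode_2[of b a] by linarith+

lemma cN_induct: "P 0 \<Longrightarrow> P 1 \<Longrightarrow> (\<And>a b. P a \<Longrightarrow> P b \<Longrightarrow> P (cN a b)) \<Longrightarrow> P c"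
proof (induct c rule: less_induct)
  case (less c)
  show ?case by (rule cN_cases[of c]) (use less cN_less in auto)
qed

function cneg :: "nat \<Rightarrow> nat" where
  "cneg c = (if c = 0 then 1 else if c = 1 then 0 else cN (cneg (pf (c - 2))) (cneg (ps (c - 2))))"
  by auto
termination
  by (relation "Wellfounded.measure id") (auto intro!: pf_less ps_less simp del: One_nat_def)
declare cneg.simps [simp del]

lemma cneg_simps: "cneg 0 = 1" "cneg 1 = 0" "cneg (cN a b) = cN (cneg a) (cneg b)"
  by (subst cneg.simps; simp add: cN_def)+

lemma clopen_cneg: "clopen (cneg c) = - clopen c"
  by (induct c rule: cN_induct) (auto simp: cneg_simps clopen_N simp flip: One_nat_def)

function cor :: "nat \<Rightarrow> nat \<Rightarrow> nat" where
  "cor a b = (if a = 0 then b else if b = 0 then a else if a = 1 \<or> b = 1 then 1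
     else cN (cor (pf (a - 2)) (pf (b - 2))) (cor (ps (a - 2)) (ps (b - 2))))"
  by auto
termination
  by (relation "Wellfounded.measure fst") (auto intro!: pf_less ps_less simp del: One_nat_def)
declare cor.simps [simp del]

lemma cor_simps: "cor 0 b = b" "cor a 0 = a" "cor 1 b = 1" "cor a 1 = 1"
   "cor (cN a b) (cN a' b') = cN (cor a a') (cor b b')"
  by (subst cor.simps; simp add: cN_def)+

lemma clopen_cor: "clopen (cor a b) = clopen a \<union> clopen b"
proof (induct a arbitrary: b rule: cN_induct)
  case (3 a1 a2)
  show ?case by (rule cN_cases[of b]) (auto simp: cor_simps clopen_N 3 simp flip: One_nat_def)
qed (auto simp: cor_simps simp flip: One_nat_def)

definition cand :: "nat \<Rightarrow> nat \<Rightarrow> nat" where "cand a b = cneg (cor (cneg a) (cneg b))"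
definition cxor :: "nat \<Rightarrow> nat \<Rightarrow> nat" where "cxor a b = cor (cand a (cneg b)) (cand b (cneg a))"

lemma clopen_cand: "clopen (cand a b) = clopen a \<inter> clopen b"
  by (simp add: cand_def clopen_cor clopen_cneg)

lemma clopen_cxor: "clopen (cxor a b) = (clopen a - clopen b) \<union> (clopen b - clopen a)"
  by (auto simp: cxor_def clopen_cor clopen_cand clopen_cneg)

text \<open>Counts the bit strings of length \<open>d\<close> that lead into the set. This is
  correct only if \<open>d\<close> is at least the depth of the tree.\<close>

function clopen_count :: "nat \<Rightarrow> nat \<Rightarrow> nat" where
  "clopen_count c d = (if c = 0 then 0 else if c = 1 then 2 ^ d else clopen_count (pf (c - 2)) (d - 1) + clopen_count (ps (c - 2)) (d - 1))"
  by auto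
termination
  by (relation "Wellfounded.measure fst") (auto intro!: pf_less ps_less simp del: One_nat_def)
declare clopen_count.simps [simp del]

lemma clopen_count_simps: "clopen_count 0 d = 0" "clopen_count 1 d = 2 ^ d" "clopen_count (cN a b) d = clopen_count a (d - 1) + clopen_count b (d - 1)"
  by (subst clopen_count.simps; simp add: cN_def)+

text \<open>The floor of \<open>2 ^ k\<close> times the measure; the code \<open>c\<close> itself bounds the depth of the tree.\<close>

definition clopen_floor :: "nat \<Rightarrow> nat \<Rightarrow> nat" where "clopen_floor c k = (clopen_count c c * 2 ^ k) div 2 ^ c"

definition cbit :: "nat \<Rightarrow> nat" where "cbit n = rec_nat (cN 1 0) (\<lambda>_ c. cN c c) n"

lemma clopen_cbit: "clopen (cbit n) = {f. f n}"
  by (induct n) (auto simp: cbit_def clopen_N)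

lemma computable_cN [cintro]: "computable gs a \<Longrightarrow> computable gs b \<Longrightarrow> computable gs (\<lambda>\<nu> x. cN (a \<nu> x) (b \<nu> x))"
  unfolding cN_def by (intro cintro)

lemma computable_cneg0: "computable gs (\<lambda>\<nu>. cneg)"
proof -
  let ?\<phi> = "\<lambda>\<nu> c. if c = 0 then 1 else if c = 1 then 0 else cN (\<nu> (pf (c - 2))) (\<nu> (ps (c - 2)))"
  show ?thesis
  proof (rule computable_wfrec[where \<phi> = ?\<phi> and ms = "\<lambda>x. x"])
    show "cneg x = ?\<phi> (\<lambda>y. if y < x then cneg y else 0) x" for x
      by (subst cneg.simps) (use pf_less[of x] ps_less[of x] in auto)
  qed (intro cintro)+
qed

lemmas computable_cneg [cintro] = computable_comp[OF computable_cneg0]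

lemma computable_cor0: "computable gs (\<lambda>\<nu> z. cor (pf z) (ps z))"
proof -
  let ?\<phi> = "\<lambda>\<nu> z. if pf z = 0 then ps z else if ps z = 0 then pf z else if pf z = 1 \<or> ps z = 1 then 1
     else cN (\<nu> (pr (pf (pf z - 2)) (pf (ps z - 2)))) (\<nu> (pr (ps (pf z - 2)) (ps (ps z - 2))))"
  show ?thesis
  proof (rule computable_wfrec[where \<phi> = ?\<phi> and ms = pf])
    show "cor (pf x) (ps x) = ?\<phi> (\<lambda>y. if pf y < pf x then cor (pf y) (ps y) else 0) x" for x
      by (subst cor.simps) (use pf_less[of "pf x"] ps_less[of "pf x"] in auto)
  qed (intro cintro)+
qed

lemmas computable_cor [cintro] = computable_pure2I[OF computable_cor0]

lemma computable_cand [cintro]: "computable gs a \<Longrightarrow> computable gs b \<Longrightarrow> computable gs (\<lambda>\<nu> x. cand (a \<nu> x) (b \<nu> x))"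
  and computable_cxor [cintro]: "computable gs a \<Longrightarrow> computable gs b \<Longrightarrow> computable gs (\<lambda>\<nu> x. cxor (a \<nu> x) (b \<nu> x))"
  unfolding cand_def cxor_def by (intro cintro; assumption)+

text \<open>Makes division available to the computability rules, which provide minimization.\<close>

lemma div_mu: "0 < b \<Longrightarrow> a div b = minimize (\<lambda>n. a < Suc n * b)"
proof -
  assume b: "0 < b"
  have "a < Suc n * b \<longleftrightarrow> a div b < Suc n" for n using b by (simp add: less_mult_imp_div_less div_less_iff_less_mult del: mult_Suc)
  then have "a < Suc n * b \<longleftrightarrow> a div b \<le> n" for n by (simp add: less_Suc_eq_le)
  then show ?thesis unfolding minimize_def by (auto intro!: Least_equality[symmetric] simp del: mult_Suc)
qed

lemma computable_fl0: "computable gs (\<lambda>\<nu> z. clopen_floor (pf z) (ps z))"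
proof -
  let ?\<phi> = "\<lambda>\<nu> z. if pf z = 0 then 0 else if pf z = 1 then 2 ^ ps z
     else \<nu> (pr (pf (pf z - 2)) (ps z - 1)) + \<nu> (pr (ps (pf z - 2)) (ps z - 1))"
  have "computable gs (\<lambda>\<nu> z. clopen_count (pf z) (ps z))"
  proof (rule computable_wfrec[where \<phi> = ?\<phi> and ms = pf])
    show "clopen_count (pf x) (ps x) = ?\<phi> (\<lambda>y. if pf y < pf x then clopen_count (pf y) (ps y) else 0) x" for x
      by (subst clopen_count.simps) (use pf_less[of "pf x"] ps_less[of "pf x"] in auto)
  qed (intro cintro)+
  note clopen_count = computable_pure2I[OF this]
  have eq: "clopen_floor c k = minimize (\<lambda>n. clopen_count c c * 2 ^ k < Suc n * 2 ^ c)" for c k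
    unfolding clopen_floor_def by (rule div_mu) simp
  show ?thesis unfolding eq by (intro clopen_count cintro)
qed

lemmas computable_fl [cintro] = computable_pure2I[OF computable_fl0]

lemma computable_cbit [cintro]: "computable gs a \<Longrightarrow> computable gs (\<lambda>\<nu> x. cbit (a \<nu> x))"
  unfolding cbit_def by (intro cintro)

section \<open>The coin-tossing measure of clopen sets\<close>

abbreviation coin :: "bool measure" where "coin \<equiv> measure_pmf (pmf_of_set UNIV)"
abbreviation coins :: "(nat \<Rightarrow> bool) measure" where "coins \<equiv> PiM UNIV (\<lambda>_. coin)"

interpretation coin: sequence_space coin
  by unfold_locales

interpretation CM: prob_space cantor_measure
  unfolding cantor_measure_def by (rule prob_space.prob_space_completion) (rule coin.prob_space_axioms)

lemma complete_CM: "complete_measure cantor_measure"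
  unfolding cantor_measure_def by (rule completion.complete_measure_axioms)

lemma space_CM [simp]: "space cantor_measure = UNIV"
  by (simp add: cantor_measure_def space_PiM)

lemma sets_coins_CM: "A \<in> sets coins \<Longrightarrow> A \<in> sets cantor_measure"
  unfolding cantor_measure_def by (rule sets_completionI_sets)

lemma measure_coins_CM: "A \<in> sets coins \<Longrightarrow> measure cantor_measure A = measure coins A"
  unfolding cantor_measure_def by (simp add: measure_completion)

lemma shift_measurable: "(\<lambda>f n. f (Suc n)) \<in> measurable coins coins"
  by (rule measurable_PiM_single') (auto simp: space_PiM)

lemma branch_sets:
  assumes "X \<in> sets coins" "Y \<in> sets coins"
  shows "{f. if f 0 then (\<lambda>n. f (Suc n)) \<in> X else (\<lambda>n. f (Suc n)) \<in> Y} \<in> sets coins"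
proof -
  have b: "{f. f 0} \<in> sets coins"
    using measurable_sets[OF measurable_component_singleton[of 0 UNIV "\<lambda>_. coin"], of "{True}"]
    by (simp add: space_PiM vimage_def)
  have "(\<lambda>f n. f (Suc n)) -` X \<inter> space coins \<in> sets coins" "(\<lambda>f n. f (Suc n)) -` Y \<inter> space coins \<in> sets coins"
    using shift_measurable assms by (auto intro: measurable_sets)
  then have "({f. f 0} \<inter> ((\<lambda>f n. f (Suc n)) -` X \<inter> space coins)) \<union>
     (((\<lambda>f n. f (Suc n)) -` Y \<inter> space coins) - {f. f 0}) \<in> sets coins" using b by blast
  also have "({f. f 0} \<inter> ((\<lambda>f n. f (Suc n)) -` X \<inter> space coins)) \<union>
     (((\<lambda>f n. f (Suc n)) -` Y \<inter> space coins) - {f. f 0}) =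
     {f. if f 0 then (\<lambda>n. f (Suc n)) \<in> X else (\<lambda>n. f (Suc n)) \<in> Y}"
    by (auto simp: space_PiM)
  finally show ?thesis .
qed

text \<open>By \<open>coin.PiM_iter\<close> a sequence of tosses is one toss followed by an
  independent sequence, so each of the two cases is a product set with a factor 1/2.\<close>

lemma branch_measure:
  assumes X: "X \<in> sets coins" and Y: "Y \<in> sets coins"
  shows "measure coins {f. if f 0 then (\<lambda>n. f (Suc n)) \<in> X else (\<lambda>n. f (Suc n)) \<in> Y}
     = (measure coins X + measure coins Y) / 2"
proof -
  let ?A = "{f. if f 0 then (\<lambda>n. f (Suc n)) \<in> X else (\<lambda>n. f (Suc n)) \<in> Y}"
  let ?g = "\<lambda>(s, \<omega>). case_nat s \<omega>"
  have g: "?g \<in> measurable (coin \<Otimes>\<^sub>M coins) coins"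
  proof (rule measurable_PiM_single')
    show "(\<lambda>\<omega>. ?g \<omega> i) \<in> measurable (coin \<Otimes>\<^sub>M coins) coin" for i
    proof (cases i)
      case 0
      then show ?thesis by (simp add: case_prod_beta' del: measurable_pmf_measure2)
    next
      case (Suc j)
      have "(\<lambda>\<omega>. snd \<omega> j) \<in> measurable (coin \<Otimes>\<^sub>M coins) coin"
        by (rule measurable_compose[OF measurable_snd measurable_component_singleton]) simp
      then show ?thesis using Suc by (simp add: case_prod_beta')
    qed
  qed (auto simp: space_pair_measure space_PiM)
  interpret P: pair_prob_space coin coins ..
  have half: "measure (coin \<Otimes>\<^sub>M coins) ({b} \<times> Z) = measure coins Z / 2" if "Z \<in> sets coins" for b Z
  proof -
    have "emeasure (coin \<Otimes>\<^sub>M coins) ({b} \<times> Z) = emeasure coin {b} * emeasure coins Z"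
      by (rule coin.emeasure_pair_measure_Times) (use that in auto)
    then have "measure (coin \<Otimes>\<^sub>M coins) ({b} \<times> Z) = measure coin {b} * measure coins Z"
      by (simp add: measure_def enn2real_mult)
    also have "measure coin {b} = 1 / 2"
      by (simp add: measure_pmf_single)
    finally show ?thesis by simp
  qed
  have "measure coins ?A = measure (distr (coin \<Otimes>\<^sub>M coins) coins ?g) ?A"
    by (simp add: coin.PiM_iter)
  also have "\<dots> = measure (coin \<Otimes>\<^sub>M coins) (?g -` ?A \<inter> space (coin \<Otimes>\<^sub>M coins))"
    by (rule measure_distr[OF g branch_sets[OF X Y]])
  also have "?g -` ?A \<inter> space (coin \<Otimes>\<^sub>M coins) = ({True} \<times> X) \<union> ({False} \<times> Y)"
    by (auto simp: space_pair_measure space_PiM split: if_splits)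
  also have "measure (coin \<Otimes>\<^sub>M coins) \<dots> = measure (coin \<Otimes>\<^sub>M coins) ({True} \<times> X) + measure (coin \<Otimes>\<^sub>M coins) ({False} \<times> Y)"
    by (rule P.finite_measure_Union) (use X Y in auto)
  also have "\<dots> = (measure coins X + measure coins Y) / 2" by (simp only: half[OF X] half[OF Y] add_divide_distrib)
  finally show ?thesis .
qed

lemma clopen_sets_coins: "clopen c \<in> sets coins"
proof (induct c rule: cN_induct)
  case 2
  then show ?case using sets.top[of coins] by (simp add: space_PiM)
next
  case (3 a b)
  then show ?case unfolding clopen_N by (rule branch_sets)
qed simp

lemma clopen_sets [simp, intro]: "clopen c \<in> sets cantor_measure"
  by (rule sets_coins_CM[OF clopen_sets_coins])

abbreviation \<mu> :: "(nat \<Rightarrow> bool) set \<Rightarrow> real" where "\<mu> A \<equiv> measure cantor_measure A"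

lemma minimize_cl_N: "\<mu> (clopen (cN a b)) = (\<mu> (clopen a) + \<mu> (clopen b)) / 2"
  unfolding measure_coins_CM[OF clopen_sets_coins] unfolding clopen_N by (rule branch_measure[OF clopen_sets_coins clopen_sets_coins])

lemma clopen_count_measure: "c \<le> d \<Longrightarrow> real (clopen_count c d) = \<mu> (clopen c) * 2 ^ d"
proof (induct c arbitrary: d rule: cN_induct)
  case 2
  then show ?case using CM.prob_space by (simp add: clopen_count_simps(2)[unfolded One_nat_def])
next
  case (3 a b)
  then obtain e where e: "d = Suc e" using cN_less(1)[of a b] by (cases d) auto
  have "a \<le> e" "b \<le> e" using 3(3) cN_less[of a b] cN_less[of b a] e by linarith+
  then show ?case using 3(1,2) by (simp add: clopen_count_simps minimize_cl_N e field_simps)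
qed (simp add: clopen_count_simps)

lemma le_fl_iff: "n \<le> clopen_floor c k \<longleftrightarrow> real n \<le> 2 ^ k * \<mu> (clopen c)"
proof -
  have "n \<le> clopen_floor c k \<longleftrightarrow> n * 2 ^ c \<le> clopen_count c c * 2 ^ k"
    unfolding clopen_floor_def by (simp add: less_eq_div_iff_mult_less_eq)
  also have "\<dots> \<longleftrightarrow> real n * 2 ^ c \<le> real (clopen_count c c) * 2 ^ k"
    using of_nat_le_iff[of "n * 2 ^ c" "clopen_count c c * 2 ^ k", where ?'a = real] by simp
  also have "\<dots> \<longleftrightarrow> real n \<le> 2 ^ k * \<mu> (clopen c)" by (simp add: clopen_count_measure mult.commute mult.left_commute)
  finally show ?thesis .
qed

lemma clopen_floor_0_iff: "clopen_floor c k = 0 \<longleftrightarrow> \<mu> (clopen c) < 1 / 2 ^ k"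
  using le_fl_iff[of 1 c k] by (auto simp: field_simps not_le)

section \<open>Approximation of events by clopen sets\<close>

definition mdist :: "(nat \<Rightarrow> bool) set \<Rightarrow> (nat \<Rightarrow> bool) set \<Rightarrow> real" where
  "mdist A B = \<mu> ((A - B) \<union> (B - A))"

abbreviation evs :: "(nat \<Rightarrow> bool) set set" where "evs \<equiv> sets cantor_measure"

lemma mdist_sym: "mdist A B = mdist B A"
  unfolding mdist_def by (simp add: Un_commute)

lemma mdist_nonneg: "0 \<le> mdist A B"
  unfolding mdist_def by simp

lemma mdist_refl [simp]: "mdist A A = 0"
  unfolding mdist_def by simp

lemma Compl_evs: "A \<in> evs \<Longrightarrow> - A \<in> evs"
  using sets.compl_sets[of A cantor_measure] by (simp add: Compl_eq_Diff_UNIV)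

lemma mdist_triangle: "A \<in> evs \<Longrightarrow> B \<in> evs \<Longrightarrow> E \<in> evs \<Longrightarrow> mdist A E \<le> mdist A B + mdist B E"
proof -
  assume s: "A \<in> evs" "B \<in> evs" "E \<in> evs"
  have "mdist A E \<le> \<mu> (((A - B) \<union> (B - A)) \<union> ((B - E) \<union> (E - B)))"
    unfolding mdist_def using s by (intro CM.finite_measure_mono) auto
  also have "\<dots> \<le> mdist A B + mdist B E"
    unfolding mdist_def using s by (intro measure_Un_le) auto
  finally show ?thesis .
qed

lemma mdist_Un: "A \<in> evs \<Longrightarrow> B \<in> evs \<Longrightarrow> A' \<in> evs \<Longrightarrow> B' \<in> evs \<Longrightarrow> mdist (A \<union> B) (A' \<union> B') \<le> mdist A A' + mdist B B'"
proof -
  assume s: "A \<in> evs" "B \<in> evs" "A' \<in> evs" "B' \<in> evs"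
  have "mdist (A \<union> B) (A' \<union> B') \<le> \<mu> (((A - A') \<union> (A' - A)) \<union> ((B - B') \<union> (B' - B)))"
    unfolding mdist_def using s by (intro CM.finite_measure_mono) auto
  also have "\<dots> \<le> mdist A A' + mdist B B'"
    unfolding mdist_def using s by (intro measure_Un_le) auto
  finally show ?thesis .
qed

lemma mdist_Compl: "mdist (- A) (- B) = mdist A B"
proof -
  have "(- A - - B) \<union> (- B - - A) = (A - B) \<union> (B - A)" by auto
  then show ?thesis by (simp add: mdist_def)
qed

lemma mdist_measure: "A \<in> evs \<Longrightarrow> B \<in> evs \<Longrightarrow> \<mu> A \<le> \<mu> B + mdist A B"
proof -
  assume s: "A \<in> evs" "B \<in> evs"
  have "\<mu> A \<le> \<mu> (B \<union> ((A - B) \<union> (B - A)))" using s by (intro CM.finite_measure_mono) auto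
  also have "\<dots> \<le> \<mu> B + mdist A B" unfolding mdist_def using s by (intro measure_Un_le) auto
  finally show ?thesis .
qed

lemma mdist_Int_measure: "A \<in> evs \<Longrightarrow> B \<in> evs \<Longrightarrow> E \<in> evs \<Longrightarrow> \<mu> (E \<inter> A) \<le> \<mu> (E \<inter> B) + mdist A B"
proof -
  assume s: "A \<in> evs" "B \<in> evs" "E \<in> evs"
  have "\<mu> (E \<inter> A) \<le> \<mu> (E \<inter> B) + mdist (E \<inter> A) (E \<inter> B)" using s by (intro mdist_measure) auto
  also have "mdist (E \<inter> A) (E \<inter> B) \<le> mdist A B"
    unfolding mdist_def using s by (intro CM.finite_measure_mono) auto
  finally show ?thesis by simp
qed

text \<open>The distance to a Suslin set is broken into the measures of its parts inside and outside
  a clopen set, the quantities that can be compared with dyadic numbers.\<close>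

lemma mdist_split: "A \<in> evs \<Longrightarrow> B \<in> evs \<Longrightarrow> mdist A B = \<mu> B - \<mu> (B \<inter> A) + \<mu> (- B \<inter> A)"
proof -
  assume s: "A \<in> evs" "B \<in> evs"
  have "mdist A B = \<mu> (A - B) + \<mu> (B - A)"
    unfolding mdist_def using s by (intro CM.finite_measure_Union) auto
  moreover have "\<mu> (B - A) = \<mu> B - \<mu> (B \<inter> A)"
    using s CM.finite_measure_Diff'[of B A] by auto
  moreover have "A - B = - B \<inter> A" by auto
  ultimately show ?thesis by simp
qed

lemma mdist_UN_tendsto:
  assumes "\<And>n. A n \<in> evs" shows "(\<lambda>N. mdist (\<Union>n. A n) (\<Union>n<N. A n)) \<longlonglongrightarrow> 0"
proof -
  let ?B = "\<lambda>N. \<Union>n<N. A n"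
  have U: "(\<Union>N. ?B N) = (\<Union>n. A n)" by auto
  have s: "?B N \<in> evs" "(\<Union>n. A n) \<in> evs" for N using assms by auto
  have "(\<lambda>N. \<mu> (?B N)) \<longlonglongrightarrow> \<mu> (\<Union>N. ?B N)"
  proof (rule CM.finite_Lim_measure_incseq)
    show "incseq ?B" by (rule incseq_SucI) (use less_SucI in blast)
  qed (use s in auto)
  then have "(\<lambda>N. \<mu> (\<Union>n. A n) - \<mu> (?B N)) \<longlonglongrightarrow> \<mu> (\<Union>n. A n) - \<mu> (\<Union>n. A n)"
    unfolding U by (intro tendsto_diff tendsto_const)
  moreover have "mdist (\<Union>n. A n) (?B N) = \<mu> (\<Union>n. A n) - \<mu> (?B N)" for N
  proof -
    have "((\<Union>n. A n) - ?B N) \<union> (?B N - (\<Union>n. A n)) = (\<Union>n. A n) - ?B N" by auto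
    then show ?thesis unfolding mdist_def using CM.finite_measure_Diff[OF s(2) s(1)[of N]] by auto
  qed
  ultimately show ?thesis by simp
qed

text \<open>The events that clopen sets approximate contain the cylinders and form a sigma-algebra;
  a countable union is first cut to a finite one at cost \<open>e / 2\<close>.\<close>

lemma clopen_dense_coins:
  assumes "A \<in> sets coins"
  shows "\<forall>e>0. \<exists>c. mdist A (clopen c) < e"
proof -
  let ?G = "{{f \<in> UNIV \<rightarrow>\<^sub>E space coin. f i \<in> A} | i A. i \<in> (UNIV :: nat set) \<and> A \<in> sets coin}"
  have "A \<in> sigma_sets (UNIV \<rightarrow>\<^sub>E space coin) ?G"
    using assms unfolding sets_PiM_single by simp
  then have "A \<in> evs \<and> (\<forall>e>0. \<exists>c. mdist A (clopen c) < e)"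
  proof (induct rule: sigma_sets.induct)
    case (Basic a)
    then obtain i B where a: "a = {f. f i \<in> (B :: bool set)}" by auto
    have "B = {} \<or> B = UNIV \<or> B = {True} \<or> B = {False}" by (cases "True \<in> B"; cases "False \<in> B") (auto, (metis (full_types))+)
    then have "\<exists>c. a = clopen c"
    proof (elim disjE)
      assume "B = {}" then have "a = clopen 0" by (simp add: a) then show ?thesis ..
    next
      assume "B = UNIV" then have "a = clopen 1" by (simp add: a) then show ?thesis ..
    next
      assume "B = {True}" then have "a = clopen (cbit i)" by (simp add: a clopen_cbit) then show ?thesis ..
    next
      assume "B = {False}" then have "a = clopen (cneg (cbit i))" by (auto simp add: a clopen_cbit clopen_cneg) then show ?thesis ..
    qed
    then obtain c where "a = clopen c" by blast
    then show ?case by (auto intro!: exI[of _ c])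
  next
    case Empty
    then show ?case by (auto intro!: exI[of _ 0])
  next
    case (Compl a)
    have e: "(UNIV \<rightarrow>\<^sub>E space coin) - a = - a" by auto
    show ?case unfolding e
    proof (intro conjI allI impI)
      show "- a \<in> evs" using Compl Compl_evs by blast
      fix e :: real assume "0 < e"
      then obtain c where "mdist a (clopen c) < e" using Compl by blast
      then show "\<exists>c. mdist (- a) (clopen c) < e" by (intro exI[of _ "cneg c"]) (simp add: clopen_cneg mdist_Compl)
    qed
  next
    case (Union a)
    have fin: "\<forall>e>0. \<exists>c. mdist (\<Union>n<N. a n) (clopen c) < e" for N
    proof (induct N)
      case 0
      then show ?case by (auto intro!: exI[of _ 0])
    next
      case (Suc N)
      show ?case
      proof (intro allI impI)
        fix e :: real assume e: "0 < e"
        obtain c where c: "mdist (\<Union>n<N. a n) (clopen c) < e / 2" using Suc e half_gt_zero by blast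
        obtain c' where c': "mdist (a N) (clopen c') < e / 2" using Union(2)[of N] e half_gt_zero by blast
        have sN: "(\<Union>n<N. a n) \<in> evs" using Union(2) by blast
        have "(\<Union>n<Suc N. a n) = (\<Union>n<N. a n) \<union> a N" by (auto simp: less_Suc_eq)
        then have "mdist (\<Union>n<Suc N. a n) (clopen (cor c c')) \<le> mdist (\<Union>n<N. a n) (clopen c) + mdist (a N) (clopen c')"
          using mdist_Un[of "\<Union>n<N. a n" "a N" "clopen c" "clopen c'"] sN Union(2)[of N] by (simp add: clopen_cor)
        then show "\<exists>c. mdist (\<Union>n<Suc N. a n) (clopen c) < e" using c c' by (intro exI[of _ "cor c c'"]) linarith
      qed
    qed
    have s: "a n \<in> evs" for n using Union(2) by blast
    show ?case
    proof (intro conjI allI impI)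
      show "(\<Union>i. a i) \<in> evs" using s by auto
      fix e :: real assume e: "0 < e"
      have "\<forall>\<^sub>F N in sequentially. mdist (\<Union>n. a n) (\<Union>n<N. a n) < e / 2"
        using mdist_UN_tendsto[of a, OF s] e by (intro order_tendstoD(2)) auto
      then obtain N where N: "mdist (\<Union>n. a n) (\<Union>n<N. a n) < e / 2" by (auto simp: eventually_sequentially)
      obtain c where c: "mdist (\<Union>n<N. a n) (clopen c) < e / 2" using fin e half_gt_zero by blast
      have "mdist (\<Union>n. a n) (clopen c) \<le> mdist (\<Union>n. a n) (\<Union>n<N. a n) + mdist (\<Union>n<N. a n) (clopen c)"
        using s by (intro mdist_triangle) auto
      then show "\<exists>c. mdist (\<Union>i. a i) (clopen c) < e" using N c by (intro exI[of _ c]) linarith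
    qed
  qed
  then show ?thesis by blast
qed

lemma clopen_dense:
  assumes A: "A \<in> evs" and e: "0 < e"
  shows "\<exists>c. mdist A (clopen c) < e"
proof -
  obtain S N N' where *: "A = S \<union> N" "N \<subseteq> N'" "N' \<in> null_sets coins" "S \<in> sets coins"
    using A unfolding cantor_measure_def by (rule sets_completionE) blast
  obtain c where c: "mdist S (clopen c) < e" using clopen_dense_coins[OF *(4)] e by blast
  have N': "N' \<in> evs" "\<mu> N' = 0"
    using *(3) by (auto simp: null_sets_def sets_coins_CM measure_coins_CM measure_eq_0_null_sets)
  have "mdist A S \<le> \<mu> N'" unfolding mdist_def
    using * N' by (intro CM.finite_measure_mono) auto
  then have "mdist A S = 0" using N'(2) mdist_nonneg[of A S] by linarith
  moreover have "mdist A (clopen c) \<le> mdist A S + mdist S (clopen c)"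
    using A *(4) by (intro mdist_triangle) (auto intro: sets_coins_CM)
  ultimately show ?thesis using c by (intro exI[of _ c]) linarith
qed

section \<open>Names of events, closed under countable Boolean operations\<close>

definition named :: "(nat \<Rightarrow> bool) set \<Rightarrow> (nat \<Rightarrow> nat) \<Rightarrow> bool" where
  "named A \<nu> = (A \<in> evs \<and> (\<forall>k. mdist A (clopen (\<nu> k)) \<le> 1 / 2 ^ k))"

lemma named_evs: "named A \<nu> \<Longrightarrow> A \<in> evs" and named_dd: "named A \<nu> \<Longrightarrow> mdist A (clopen (\<nu> k)) \<le> 1 / 2 ^ k"
  by (auto simp: named_def)

lemma named_clopen: "named (clopen c) (\<lambda>_. c)"
  by (simp add: named_def)

lemma named_neg: "named A \<nu> \<Longrightarrow> named (- A) (\<lambda>k. cneg (\<nu> k))"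
  by (simp add: named_def clopen_cneg mdist_Compl Compl_evs)

text \<open>The name of the \<open>i\<close>-th event is read at precision \<open>k + i + 1\<close>,
  so that the errors add up to less than \<open>1 / 2 ^ k\<close> for every
  \<open>n\<close>.\<close>

definition finite_union :: "(nat \<Rightarrow> nat \<Rightarrow> nat) \<Rightarrow> nat \<Rightarrow> nat \<Rightarrow> nat" where
  "finite_union N n k = rec_nat 0 (\<lambda>i r. cor r (N i (k + i + 1))) n"

text \<open>No rate of convergence of the finite unions is at hand. Instead a code is searched that
  is close to almost all of them, a condition with number quantifiers and hence decidable in the
  Suslin functional.\<close>

definition UNn :: "(nat \<Rightarrow> nat \<Rightarrow> nat) \<Rightarrow> nat \<Rightarrow> nat" where
  "UNn N k = minimize (\<lambda>c. \<exists>m. \<forall>n. m \<le> n \<longrightarrow> clopen_floor (cxor c (finite_union N n (k + 3))) (k + 1) = 0)"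

definition INTn :: "(nat \<Rightarrow> nat \<Rightarrow> nat) \<Rightarrow> nat \<Rightarrow> nat" where
  "INTn N k = cneg (UNn (\<lambda>n j. cneg (N n j)) k)"

lemma minimize_cxor: "\<mu> (clopen (cxor a b)) = mdist (clopen a) (clopen b)"
  by (simp add: clopen_cxor mdist_def)

lemma named_fu:
  assumes "\<And>n. named (A n) (N n)"
  shows "mdist (\<Union>i<n. A i) (clopen (finite_union N n k)) \<le> (1 - 1 / 2 ^ n) / 2 ^ k"
proof (induct n)
  case 0
  then show ?case by (simp add: finite_union_def)
next
  case (Suc n)
  have "(\<Union>i<Suc n. A i) = (\<Union>i<n. A i) \<union> A n" by (auto simp: less_Suc_eq)
  then have "mdist (\<Union>i<Suc n. A i) (clopen (finite_union N (Suc n) k)) \<le> mdist (\<Union>i<n. A i) (clopen (finite_union N n k)) + mdist (A n) (clopen (N n (k + n + 1)))"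
    using mdist_Un[of "\<Union>i<n. A i" "A n" "clopen (finite_union N n k)" "clopen (N n (k + n + 1))"] named_evs[OF assms]
    by (auto simp: clopen_cor finite_union_def)
  also have "\<dots> \<le> (1 - 1 / 2 ^ n) / 2 ^ k + 1 / 2 ^ (k + n + 1)"
    using Suc named_dd[OF assms] by (rule add_mono)
  also have "\<dots> = (1 - 1 / 2 ^ Suc n) / 2 ^ k" by (simp add: field_simps power_add)
  finally show ?case .
qed

lemma named_UN:
  assumes N: "\<And>n. named (A n) (N n)"
  shows "named (\<Union>n. A n) (UNn N)"
proof -
  let ?U = "\<Union>n. A n"
  have s: "A n \<in> evs" for n using named_evs[OF N] .
  have finite_union: "mdist (\<Union>i<n. A i) (clopen (finite_union N n j)) \<le> 1 / 2 ^ j" for n j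
    using named_fu[of A N n j, OF N] by (rule order_trans) (simp add: divide_right_mono)
  have evals: "\<exists>m. \<forall>n\<ge>m. mdist ?U (\<Union>i<n. A i) < e" if "0 < e" for e
    using order_tendstoD(2)[OF mdist_UN_tendsto[of A, OF s] that] by (simp add: eventually_sequentially)
  have "mdist ?U (clopen (UNn N k)) \<le> 1 / 2 ^ k" for k
  proof -
    let ?Q = "\<lambda>c. \<exists>m. \<forall>n. m \<le> n \<longrightarrow> clopen_floor (cxor c (finite_union N n (k + 3))) (k + 1) = 0"
    have Q: "?Q c \<longleftrightarrow> (\<exists>m. \<forall>n\<ge>m. mdist (clopen c) (clopen (finite_union N n (k + 3))) < 1 / 2 ^ (k + 1))" for c
      by (simp add: clopen_floor_0_iff minimize_cxor)
    \<comment> \<open>In units of \<open>1 / 2 ^ (k + 3)\<close>: late finite unions have codes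
      within 2 of the union, two such codes differ by less than 4, which is the accuracy tested, and
      the code found is within 2 + 4 < 8.\<close>
    have p: "1 / 2 ^ (k + 1) = 4 * (1 / 2 ^ (k + 3) :: real)" "1 / 2 ^ k = 8 * (1 / 2 ^ (k + 3) :: real)"
      by (simp_all add: power_add)
    have pos: "0 < (1 / 2 ^ (k + 3) :: real)" by simp
    obtain m where m: "\<And>n. m \<le> n \<Longrightarrow> mdist ?U (\<Union>i<n. A i) < 1 / 2 ^ (k + 3)" using evals[OF pos] by blast
    have near: "mdist ?U (clopen (finite_union N n (k + 3))) < 2 * (1 / 2 ^ (k + 3))" if "m \<le> n" for n
    proof -
      have "mdist ?U (clopen (finite_union N n (k + 3))) \<le> mdist ?U (\<Union>i<n. A i) + mdist (\<Union>i<n. A i) (clopen (finite_union N n (k + 3)))"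
        using s by (intro mdist_triangle) auto
      then show ?thesis using m[OF that] finite_union[of n "k + 3"] by linarith
    qed
    have "mdist (clopen (finite_union N m (k + 3))) (clopen (finite_union N n (k + 3))) < 1 / 2 ^ (k + 1)" if "m \<le> n" for n
    proof -
      have "mdist (clopen (finite_union N m (k + 3))) (clopen (finite_union N n (k + 3))) \<le> mdist (clopen (finite_union N m (k + 3))) ?U + mdist ?U (clopen (finite_union N n (k + 3)))"
        using s by (intro mdist_triangle) auto
      then show ?thesis using near[OF that] near[of m] unfolding p by (simp only: mdist_sym[of _ ?U]) linarith
    qed
    then have "?Q (finite_union N m (k + 3))" unfolding Q by blast
    then have ex: "\<exists>c. ?Q c" by blast
    have "?Q (UNn N k)" unfolding UNn_def by (rule minimizeI[OF ex])
    then obtain m' where m': "\<And>n. m' \<le> n \<Longrightarrow> mdist (clopen (UNn N k)) (clopen (finite_union N n (k + 3))) < 1 / 2 ^ (k + 1)"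
      unfolding Q by blast
    let ?n = "max m m'"
    have n1: "mdist ?U (clopen (finite_union N ?n (k + 3))) < 2 * (1 / 2 ^ (k + 3))" by (rule near) simp
    have n2: "mdist (clopen (UNn N k)) (clopen (finite_union N ?n (k + 3))) < 4 * (1 / 2 ^ (k + 3))"
      unfolding p(1)[symmetric] by (rule m') simp
    have "mdist ?U (clopen (UNn N k)) \<le> mdist ?U (clopen (finite_union N ?n (k + 3))) + mdist (clopen (finite_union N ?n (k + 3))) (clopen (UNn N k))"
      using s by (intro mdist_triangle) auto
    then show ?thesis using n1 n2 pos unfolding p(2) mdist_sym[of "clopen (finite_union N ?n (k + 3))"] by linarith
  qed
  then show ?thesis unfolding named_def using s by auto
qed

lemma named_INT:
  assumes N: "\<And>n. named (A n) (N n)"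
  shows "named (\<Inter>n. A n) (INTn N)"
proof -
  have "named (\<Union>n. - A n) (UNn (\<lambda>n j. cneg (N n j)))" by (intro named_UN named_neg N)
  from named_neg[OF this] show ?thesis unfolding INTn_def by simp
qed

section \<open>A name for the result of the Suslin operation\<close>

definition takec :: "nat \<Rightarrow> nat \<Rightarrow> nat" where
  "takec k c = list_encode (take k (list_decode c))"

definition lec :: "nat \<Rightarrow> nat \<Rightarrow> bool" where
  "lec t s = list_all2 (\<le>) (list_decode t) (list_decode s)"

text \<open>The finite union over tuples is written as a union over all codes, with the empty clopen
  set for those out of bounds, so that \<open>UNn\<close> applies.\<close>

definition KN :: "(nat \<Rightarrow> nat \<Rightarrow> nat) \<Rightarrow> nat \<Rightarrow> nat \<Rightarrow> nat" where
  "KN N s j = UNn (\<lambda>t j. if lec t s then INTn (\<lambda>k j. N (takec k t) j) j else 0) j"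

lemma named_KN:
  assumes N: "\<And>n. named (U n) (N n)"
  shows "named (Kset U (list_decode s)) (KN N s)"
proof -
  have "named (\<Union>t. if lec t s then \<Inter>k. U (takec k t) else {}) (UNn (\<lambda>t j. if lec t s then INTn (\<lambda>k j. N (takec k t) j) j else 0))"
  proof (rule named_UN)
    fix t
    show "named (if lec t s then \<Inter>k. U (takec k t) else {}) (\<lambda>j. if lec t s then INTn (\<lambda>k j. N (takec k t) j) j else 0)"
    proof (cases "lec t s")
      case True
      have "named (\<Inter>k. U (takec k t)) (INTn (\<lambda>k. N (takec k t)))" by (intro named_INT N)
      then show ?thesis using True by simp
    next
      case False
      then show ?thesis using named_clopen[of 0] by simp
    qed
  qed
  moreover have "(\<Union>t. if lec t s then \<Inter>k. U (takec k t) else {}) = Kset U (list_decode s)"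
  proof (intro set_eqI iffI)
    fix x assume "x \<in> (\<Union>t. if lec t s then \<Inter>k. U (takec k t) else {})"
    then show "x \<in> Kset U (list_decode s)" unfolding Kset_def lec_def takec_def by (auto split: if_splits)
  next
    fix x assume "x \<in> Kset U (list_decode s)"
    then obtain t where t: "list_all2 (\<le>) t (list_decode s)" "\<And>k. x \<in> U (list_encode (take k t))"
      unfolding Kset_def by blast
    then have "lec (list_encode t) s" "x \<in> (\<Inter>k. U (takec k (list_encode t)))" by (auto simp: lec_def takec_def)
    then show "x \<in> (\<Union>t. if lec t s then \<Inter>k. U (takec k t) else {})" by (intro UN_I[of "list_encode t"]) auto
  qed
  ultimately show ?thesis unfolding KN_def by simp
qed

lemma dyadic_between:
  fixes a b :: real
  assumes "0 \<le> a" "a < b"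
  shows "\<exists>i l. a < real i / 2 ^ l \<and> real i / 2 ^ l < b"
proof -
  obtain l where l: "(1 / 2) ^ l < b - a" using real_arch_pow_inv[of "b - a" "1 / 2"] assms by auto
  define i where "i = nat (\<lfloor>a * 2 ^ l\<rfloor> + 1)"
  have "0 \<le> a * 2 ^ l" using assms by simp
  then have i: "a * 2 ^ l < real i" "real i \<le> a * 2 ^ l + 1" unfolding i_def by linarith+
  have "1 < (b - a) * 2 ^ l" using l by (simp add: field_simps power_one_over)
  then have "real i < b * 2 ^ l" using i(2) by (simp add: algebra_simps)
  then show ?thesis using i(1) by (intro exI[of _ i] exI[of _ l]) (simp add: field_simps)
qed

text \<open>Decides \<open>i / 2 ^ l < \<mu> (clopen c \<inter> susop U)\<close>; the summand \<open>2 ^ l'\<close> absorbs the error \<open>1 / 2 ^ j\<close> of the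
  \<open>j\<close>-th approximation.\<close>

definition dgt :: "(nat \<Rightarrow> nat \<Rightarrow> nat) \<Rightarrow> nat \<Rightarrow> nat \<Rightarrow> nat \<Rightarrow> bool" where
  "dgt N c i l = (\<exists>i' l'. i * 2 ^ l' < i' * 2 ^ l \<and>
     Suslin (\<lambda>s. of_bool (\<forall>j. i' * 2 ^ j \<le> clopen_floor (cand c (KN N s j)) (l' + j) + 2 ^ l')) = 1)"

lemma Suslin_of_bool: "Suslin (\<lambda>s. of_bool (P s)) = 1 \<longleftrightarrow> (\<exists>h. \<forall>n. P (seq_code h n))"
  unfolding Suslin_def by auto

text \<open>A bound \<open>g\<close> yields only a weak inequality for the Suslin set, while its
  existence requires a strict one; the intermediate value \<open>i' / 2 ^ l'\<close> bridges the
  two. By \<open>Suslin_of_bool\<close> the quantifier over \<open>g\<close> becomes an application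
  of the Suslin functional.\<close>

lemma dgt_iff:
  assumes N: "\<And>n. named (U n) (N n)"
  shows "dgt N c i l \<longleftrightarrow> real i / 2 ^ l < \<mu> (clopen c \<inter> susop U)"
proof -
  have U: "U n \<in> evs" for n using named_evs[OF N] .
  have ks: "Kset U s \<in> evs" for s by (rule CM.Kset_sets) (rule U)
  have le: "i' * 2 ^ j \<le> clopen_floor (cand c (KN N s j)) (l' + j) + 2 ^ l' \<longleftrightarrow>
      real i' / 2 ^ l' \<le> \<mu> (clopen c \<inter> clopen (KN N s j)) + 1 / 2 ^ j" for i' j s l'
  proof -
    have "i' * 2 ^ j \<le> clopen_floor (cand c (KN N s j)) (l' + j) + 2 ^ l' \<longleftrightarrow> i' * 2 ^ j - 2 ^ l' \<le> clopen_floor (cand c (KN N s j)) (l' + j)"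
      by linarith
    also have "\<dots> \<longleftrightarrow> real (i' * 2 ^ j - 2 ^ l') \<le> 2 ^ (l' + j) * \<mu> (clopen c \<inter> clopen (KN N s j))"
      by (simp add: le_fl_iff clopen_cand)
    also have "\<dots> \<longleftrightarrow> real i' * 2 ^ j - 2 ^ l' \<le> 2 ^ (l' + j) * \<mu> (clopen c \<inter> clopen (KN N s j))"
    proof (cases "2 ^ l' \<le> i' * 2 ^ j")
      case True
      then show ?thesis by (simp add: of_nat_diff)
    next
      case False
      then have "real (i' * 2 ^ j) \<le> real (2 ^ l')" by (intro of_nat_mono) simp
      then have "real i' * 2 ^ j - 2 ^ l' \<le> 0" by simp
      moreover have "0 \<le> 2 ^ (l' + j) * \<mu> (clopen c \<inter> clopen (KN N s j))" by simp
      ultimately have "real i' * 2 ^ j - 2 ^ l' \<le> 2 ^ (l' + j) * \<mu> (clopen c \<inter> clopen (KN N s j))" by linarith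
      then show ?thesis using False by simp
    qed
    also have "\<dots> \<longleftrightarrow> real i' / 2 ^ l' \<le> \<mu> (clopen c \<inter> clopen (KN N s j)) + 1 / 2 ^ j"
      by (simp add: field_simps power_add)
    finally show ?thesis .
  qed
  have K1: "\<mu> (clopen c \<inter> clopen (KN N s j)) \<le> \<mu> (clopen c \<inter> Kset U (list_decode s)) + 1 / 2 ^ j"
    "\<mu> (clopen c \<inter> Kset U (list_decode s)) \<le> \<mu> (clopen c \<inter> clopen (KN N s j)) + 1 / 2 ^ j" for s j
  proof -
    note d = named_dd[OF named_KN[of U N s, OF N], of j]
    show "\<mu> (clopen c \<inter> clopen (KN N s j)) \<le> \<mu> (clopen c \<inter> Kset U (list_decode s)) + 1 / 2 ^ j"
      using mdist_Int_measure[of "clopen (KN N s j)" "Kset U (list_decode s)" "clopen c"] d ks by (simp add: mdist_sym)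
    show "\<mu> (clopen c \<inter> Kset U (list_decode s)) \<le> \<mu> (clopen c \<inter> clopen (KN N s j)) + 1 / 2 ^ j"
      using mdist_Int_measure[of "Kset U (list_decode s)" "clopen (KN N s j)" "clopen c"] d ks by simp
  qed
  have all: "(\<forall>j. i' * 2 ^ j \<le> clopen_floor (cand c (KN N s j)) (l' + j) + 2 ^ l') \<longleftrightarrow>
     real i' / 2 ^ l' \<le> \<mu> (clopen c \<inter> Kset U (list_decode s))" (is "?L \<longleftrightarrow> ?R") for i' s l'
  proof
    assume ?L
    then have L: "real i' / 2 ^ l' \<le> \<mu> (clopen c \<inter> clopen (KN N s j)) + 1 / 2 ^ j" for j unfolding le by blast
    \<comment> \<open>One error \<open>1 / 2 ^ j\<close> comes from the name and one from the
      tolerance of the test; both vanish as \<open>j\<close> grows.\<close>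
    have "real i' / 2 ^ l' \<le> \<mu> (clopen c \<inter> Kset U (list_decode s)) + 2 * (1 / 2) ^ j" for j
      using K1(1)[of s j] L[of j] unfolding power_one_over by linarith
    moreover have "(\<lambda>j. \<mu> (clopen c \<inter> Kset U (list_decode s)) + 2 * (1 / 2) ^ j) \<longlonglongrightarrow>
       \<mu> (clopen c \<inter> Kset U (list_decode s)) + 2 * 0"
      by (intro tendsto_intros LIMSEQ_power_zero) simp
    ultimately show ?R by (intro LIMSEQ_le_const[where X = "\<lambda>j. \<mu> (clopen c \<inter> Kset U (list_decode s)) + 2 * (1 / 2) ^ j"]) auto
  next
    assume ?R
    then show ?L unfolding le using order_trans[OF _ K1(2)[of s]] by blast
  qed
  have dgt: "dgt N c i l \<longleftrightarrow> (\<exists>i' l' g. real i / 2 ^ l < real i' / 2 ^ l' \<and>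
     (\<forall>n. real i' / 2 ^ l' \<le> \<mu> (clopen c \<inter> Kset U (map g [0..<n]))))"
  proof -
    have 1: "i * 2 ^ l' < i' * 2 ^ l \<longleftrightarrow> real i / 2 ^ l < real i' / 2 ^ l'" for i' l'
    proof -
      have "i * 2 ^ l' < i' * 2 ^ l \<longleftrightarrow> real (i * 2 ^ l') < real (i' * 2 ^ l)" by (simp only: of_nat_less_iff)
      then show ?thesis by (simp add: field_simps)
    qed
    show ?thesis unfolding dgt_def Suslin_of_bool all 1 seq_code_def list_encode_inverse by blast
  qed
  show ?thesis
  proof
    assume "dgt N c i l"
    then obtain i' l' g where g: "real i / 2 ^ l < real i' / 2 ^ l'"
      "\<And>n. real i' / 2 ^ l' \<le> \<mu> (clopen c \<inter> Kset U (map g [0..<n]))" unfolding dgt by blast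
    have "real i' / 2 ^ l' \<le> \<mu> (clopen c \<inter> susop U)"
      by (rule CM.suslin_measure_upper[of U "clopen c" _ g, OF U space_CM complete_CM clopen_sets g(2)])
    then show "real i / 2 ^ l < \<mu> (clopen c \<inter> susop U)" using g(1) by linarith
  next
    assume "real i / 2 ^ l < \<mu> (clopen c \<inter> susop U)"
    then obtain i' l' where r: "real i / 2 ^ l < real i' / 2 ^ l'" "real i' / 2 ^ l' < \<mu> (clopen c \<inter> susop U)"
      using dyadic_between[of "real i / 2 ^ l" "\<mu> (clopen c \<inter> susop U)"] by auto
    obtain g where "\<And>n. real i' / 2 ^ l' \<le> \<mu> (clopen c \<inter> Kset U (map g [0..<n]))"
      using CM.suslin_measure_lower[of U "clopen c" "real i' / 2 ^ l'", OF U space_CM complete_CM clopen_sets] r by auto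
    then show "dgt N c i l" unfolding dgt using r(1) by blast
  qed
qed

text \<open>Here \<open>i1 / 2 ^ l\<close> and \<open>i2 / 2 ^ l\<close> bound the measure of the Suslin set inside \<open>c\<close> from below and outside \<open>c\<close>
  from above.\<close>

definition SUSn :: "(nat \<Rightarrow> nat \<Rightarrow> nat) \<Rightarrow> nat \<Rightarrow> nat" where
  "SUSn N k = minimize (\<lambda>c. \<exists>i1 i2 l. (i1 = 0 \<or> dgt N c i1 l) \<and> \<not> dgt N (cneg c) i2 l \<and>
     (clopen_floor c l + 1 + i2) * 2 ^ k \<le> 2 ^ l + i1 * 2 ^ k)"

lemma named_SUS:
  assumes N: "\<And>n. named (U n) (N n)"
  shows "named (susop U) (SUSn N)"
proof -
  let ?A = "susop U"
  have U: "U n \<in> evs" for n using named_evs[OF N] .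
  have A: "?A \<in> evs" by (rule CM.susop_sets[of U, OF U space_CM complete_CM])
  note dgt = dgt_iff[of U N, OF N]
  have "mdist ?A (clopen (SUSn N k)) \<le> 1 / 2 ^ k" for k
  proof -
    let ?Q = "\<lambda>c. \<exists>i1 i2 l. (i1 = 0 \<or> dgt N c i1 l) \<and> \<not> dgt N (cneg c) i2 l \<and>
     (clopen_floor c l + 1 + i2) * 2 ^ k \<le> 2 ^ l + i1 * 2 ^ k"
    have sound: "mdist ?A (clopen c) \<le> 1 / 2 ^ k" if Q: "?Q c" for c
    proof -
      obtain i1 i2 l where i: "i1 = 0 \<or> dgt N c i1 l" "\<not> dgt N (cneg c) i2 l"
        "(clopen_floor c l + 1 + i2) * 2 ^ k \<le> 2 ^ l + i1 * 2 ^ k" using Q by blast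
      have 1: "real i1 / 2 ^ l \<le> \<mu> (clopen c \<inter> ?A)" using i(1) unfolding dgt by auto
      have 2: "\<mu> (- clopen c \<inter> ?A) \<le> real i2 / 2 ^ l" using i(2) unfolding dgt clopen_cneg by auto
      have "\<not> clopen_floor c l + 1 \<le> clopen_floor c l" by simp
      then have 3: "2 ^ l * \<mu> (clopen c) < real (clopen_floor c l + 1)" unfolding le_fl_iff by simp
      have 4: "(real (clopen_floor c l + 1) + real i2) * 2 ^ k \<le> 2 ^ l + real i1 * 2 ^ k"
        using i(3) of_nat_le_iff[of "(clopen_floor c l + 1 + i2) * 2 ^ k" "2 ^ l + i1 * 2 ^ k", where ?'a = real] by (simp add: algebra_simps)
      have "\<mu> (clopen c) + real i2 / 2 ^ l - real i1 / 2 ^ l \<le> (real (clopen_floor c l + 1) + real i2 - real i1) / 2 ^ l"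
      proof -
        have "\<mu> (clopen c) \<le> real (clopen_floor c l + 1) / 2 ^ l" using 3 by (simp add: field_simps)
        then show ?thesis by (simp add: add_divide_distrib diff_divide_distrib)
      qed
      also have "\<dots> \<le> 1 / 2 ^ k" using 4 by (simp add: field_simps)
      finally show ?thesis unfolding mdist_split[OF A clopen_sets] using 1 2 by linarith
    qed
    have "\<exists>c. ?Q c"
    proof -
      obtain c where c: "mdist ?A (clopen c) < 1 / 2 ^ (k + 1)" using clopen_dense[OF A, of "1 / 2 ^ (k + 1)"] by auto
      \<comment> \<open>The permitted error \<open>1 / 2 ^ k\<close> is 8 units of
        \<open>1 / 2 ^ l\<close>. The distance to \<open>c\<close> takes less than 4 of them, and
        rounding the measure of \<open>c\<close>, \<open>x\<close> and \<open>y\<close> takes at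
        most one each.\<close>
      define l where "l = k + 3"
      define x where "x = 2 ^ l * \<mu> (clopen c \<inter> ?A)"
      define y where "y = 2 ^ l * \<mu> (- clopen c \<inter> ?A)"
      have xy: "0 \<le> x" "0 \<le> y" by (simp_all add: x_def y_def)
      \<comment> \<open>The largest integer strictly below \<open>x\<close>, because
        \<open>dgt\<close> tests a strict inequality. For \<open>x = 0\<close> it becomes 0, which
        \<open>SUSn\<close> admits without a test.\<close>
      define i1 where "i1 = nat (\<lceil>x\<rceil> - 1)"
      define i2 where "i2 = nat \<lceil>y\<rceil>"
      have i1: "x - 1 \<le> real i1" "i1 = 0 \<or> real i1 < x" unfolding i1_def using xy by linarith+
      have i2: "y \<le> real i2" "real i2 \<le> y + 1" unfolding i2_def using xy by linarith+
      have f: "real (clopen_floor c l) \<le> 2 ^ l * \<mu> (clopen c)" using le_fl_iff[of "clopen_floor c l" c l] by simp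
      have "2 ^ l * \<mu> (clopen c) - x + y = 2 ^ l * mdist ?A (clopen c)"
        unfolding mdist_split[OF A clopen_sets] x_def y_def by (simp add: algebra_simps)
      also have "\<dots> < 2 ^ l * (1 / 2 ^ (k + 1))" using c by (intro mult_strict_left_mono) auto
      also have "\<dots> = 4" by (simp add: l_def power_add)
      finally have "real (clopen_floor c l) + 1 + real i2 - real i1 < 8" using f i1(1) i2(2) by linarith
      then have "real (clopen_floor c l + 1 + i2) \<le> real (8 + i1)" by simp
      then have "clopen_floor c l + 1 + i2 \<le> 8 + i1" by (simp only: of_nat_le_iff)
      then have "(clopen_floor c l + 1 + i2) * 2 ^ k \<le> (8 + i1) * 2 ^ k" by (rule mult_le_mono1)
      also have "\<dots> = 2 ^ l + i1 * 2 ^ k" by (simp add: l_def power_add algebra_simps)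
      finally have 3: "(clopen_floor c l + 1 + i2) * 2 ^ k \<le> 2 ^ l + i1 * 2 ^ k" .
      have 1: "i1 = 0 \<or> dgt N c i1 l" unfolding dgt using i1(2) by (auto simp: x_def field_simps)
      have 2: "\<not> dgt N (cneg c) i2 l" unfolding dgt clopen_cneg using i2(1) by (auto simp: y_def field_simps)
      show ?thesis using 1 2 3 by blast
    qed
    then have "?Q (SUSn N k)" unfolding SUSn_def by (rule minimizeI[of ?Q])
    then show ?thesis by (rule sound)
  qed
  then show ?thesis unfolding named_def using A by blast
qed

section \<open>Events of bounded rank\<close>

lemma computable_app3:
  assumes "computable gs (\<lambda>\<nu> z. N \<nu> (pf z) (pf (ps z)) (ps (ps z)))" "computable gs a" "computable gs b" "computable gs c"
  shows "computable gs (\<lambda>\<nu> x. N \<nu> (a \<nu> x) (b \<nu> x) (c \<nu> x))"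
  using computable_comp[OF assms(1), of "\<lambda>\<nu> x. pr (a \<nu> x) (pr (b \<nu> x) (c \<nu> x))"] assms by (simp add: computable_pr)

lemma computable_UNn [cintro]:
  assumes N: "computable gs (\<lambda>\<nu> z. N \<nu> (pf z) (pf (ps z)) (ps (ps z)))" and k: "computable gs k"
  shows "computable gs (\<lambda>\<nu> x. UNn (\<lambda>n j. N \<nu> n j x) (k \<nu> x))"
proof -
  have finite_union: "computable gs (\<lambda>\<nu> x. finite_union (\<lambda>n j. N \<nu> n j (c \<nu> x)) (a \<nu> x) (b \<nu> x))"
    if "computable gs a" "computable gs b" "computable gs c" for a b c
    unfolding finite_union_def by (intro cintro computable_app3[OF N] that computable_comp[OF that(2)] computable_comp[OF that(3)])
  show ?thesis unfolding UNn_def by (intro cintro finite_union computable_comp[OF k])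
qed

lemma computable_INTn [cintro]:
  assumes N: "computable gs (\<lambda>\<nu> z. N \<nu> (pf z) (pf (ps z)) (ps (ps z)))" and k: "computable gs k"
  shows "computable gs (\<lambda>\<nu> x. INTn (\<lambda>n j. N \<nu> n j x) (k \<nu> x))"
  unfolding INTn_def by (intro cintro computable_app3[OF N] k)

lemma list_decode_ccons: "list_decode c = (if c = 0 then [] else chd c # list_decode (ctl c))"
  by (cases c) (simp_all add: chd_def ctl_def pf_def ps_def split: prod.split)

lemma ctl_less: "c \<noteq> 0 \<Longrightarrow> ctl c < c"
  unfolding ctl_def using ps_le[of "c - 1"] by linarith

lemma computable_takec0: "computable gs (\<lambda>\<nu> z. takec (pf z) (ps z))"
proof -
  let ?\<phi> = "\<lambda>\<nu> z. if pf z = 0 then 0 else if ps z = 0 then 0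
     else ccons (chd (ps z)) (\<nu> (pr (pf z - 1) (ctl (ps z))))"
  show ?thesis
  proof (rule computable_wfrec[where \<phi> = ?\<phi> and ms = pf])
    show "takec (pf x) (ps x) = ?\<phi> (\<lambda>y. if pf y < pf x then takec (pf y) (ps y) else 0) x" for x
      unfolding takec_def by (subst list_decode_ccons) (auto simp: ccons_def take_Cons')
  qed (intro cintro)+
qed

lemmas computable_takec [cintro] = computable_pure2I[OF computable_takec0]

lemma decidable_lec0: "decidable gs (\<lambda>\<nu> z. lec (pf z) (ps z))"
proof -
  let ?\<phi> = "\<lambda>\<nu> z. if pf z = 0 then of_bool (ps z = 0) else if ps z = 0 then 0
     else if chd (pf z) \<le> chd (ps z) then \<nu> (pr (ctl (pf z)) (ctl (ps z))) else 0"
  show ?thesis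
  proof (rule computable_wfrec[where \<phi> = ?\<phi> and ms = pf])
    show "of_bool (lec (pf x) (ps x)) = ?\<phi> (\<lambda>y. if pf y < pf x then of_bool (lec (pf y) (ps y)) else 0) x" for x
      unfolding lec_def
      by (subst list_decode_ccons[of "pf x"], subst list_decode_ccons[of "ps x"]) (use ctl_less[of "pf x"] in auto)
  qed (intro cintro)+
qed

lemma decidable_lec [cintro]: "computable gs a \<Longrightarrow> computable gs b \<Longrightarrow> decidable gs (\<lambda>\<nu> x. lec (a \<nu> x) (b \<nu> x))"
  by (rule computable_pure2I[OF decidable_lec0])

lemma computable_SUSn [cintro]:
  assumes N: "computable gs (\<lambda>\<nu> z. N \<nu> (pf z) (pf (ps z)) (ps (ps z)))" and k: "computable gs k"
  shows "computable gs (\<lambda>\<nu> x. SUSn (\<lambda>n j. N \<nu> n j x) (k \<nu> x))"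
proof -
  have KN: "computable gs (\<lambda>\<nu> x. KN (\<lambda>n j. N \<nu> n j (c \<nu> x)) (a \<nu> x) (b \<nu> x))"
    if "computable gs a" "computable gs b" "computable gs c" for a b c
    unfolding KN_def by (intro cintro computable_app3[OF N] that computable_comp[OF that(1)] computable_comp[OF that(3)])
  have dgt: "decidable gs (\<lambda>\<nu> x. dgt (\<lambda>n j. N \<nu> n j (c \<nu> x)) (a \<nu> x) (b \<nu> x) (d \<nu> x))"
    if "computable gs a" "computable gs b" "computable gs c" "computable gs d" for a b c d
    unfolding dgt_def by (intro cintro KN that that[THEN computable_comp])
  show ?thesis unfolding SUSn_def by (intro cintro dgt computable_comp[OF k])
qed

text \<open>Both names are read one step further, since two errors of half the size add up.\<close>

definition ANDn :: "(nat \<Rightarrow> nat) \<Rightarrow> (nat \<Rightarrow> nat) \<Rightarrow> nat \<Rightarrow> nat" where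
  "ANDn a b k = cand (a (Suc k)) (b (Suc k))"
definition ORn :: "(nat \<Rightarrow> nat) \<Rightarrow> (nat \<Rightarrow> nat) \<Rightarrow> nat \<Rightarrow> nat" where
  "ORn a b k = cor (a (Suc k)) (b (Suc k))"

lemma named_OR: "named A a \<Longrightarrow> named B b \<Longrightarrow> named (A \<union> B) (ORn a b)"
proof -
  assume a: "named A a" and b: "named B b"
  have "mdist (A \<union> B) (clopen (ORn a b k)) \<le> 1 / 2 ^ k" for k
  proof -
    have "mdist (A \<union> B) (clopen (ORn a b k)) \<le> mdist A (clopen (a (Suc k))) + mdist B (clopen (b (Suc k)))"
      unfolding ORn_def clopen_cor using named_evs[OF a] named_evs[OF b] by (intro mdist_Un) auto
    also have "\<dots> \<le> 1 / 2 ^ Suc k + 1 / 2 ^ Suc k" using named_dd[OF a] named_dd[OF b] by (rule add_mono)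
    finally show ?thesis by simp
  qed
  then show ?thesis unfolding named_def using named_evs[OF a] named_evs[OF b] by auto
qed

lemma named_AND: "named A a \<Longrightarrow> named B b \<Longrightarrow> named (A \<inter> B) (ANDn a b)"
  using named_neg[OF named_OR[OF named_neg named_neg, of A a B b]] unfolding ORn_def ANDn_def cand_def by simp

lemma computable_ANDn [cintro]:
  assumes a: "computable gs (\<lambda>\<nu> z. a \<nu> (pf z) (ps z))" and b: "computable gs (\<lambda>\<nu> z. b \<nu> (pf z) (ps z))" and k: "computable gs k"
  shows "computable gs (\<lambda>\<nu> x. ANDn (\<lambda>j. a \<nu> j x) (\<lambda>j. b \<nu> j x) (k \<nu> x))"
    and "computable gs (\<lambda>\<nu> x. ORn (\<lambda>j. a \<nu> j x) (\<lambda>j. b \<nu> j x) (k \<nu> x))"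
proof -
  have *: "computable gs (\<lambda>\<nu> x. pr (c \<nu> x) x)" if "computable gs c" for c using that by (intro cintro)
  have AB: "computable gs (\<lambda>\<nu> x. a \<nu> (c \<nu> x) x)" "computable gs (\<lambda>\<nu> x. b \<nu> (c \<nu> x) x)" if "computable gs c" for c
    using computable_comp[OF a *[OF that]] computable_comp[OF b *[OF that]] by simp_all
  show "computable gs (\<lambda>\<nu> x. ANDn (\<lambda>j. a \<nu> j x) (\<lambda>j. b \<nu> j x) (k \<nu> x))"
    "computable gs (\<lambda>\<nu> x. ORn (\<lambda>j. a \<nu> j x) (\<lambda>j. b \<nu> j x) (k \<nu> x))"
    unfolding ANDn_def ORn_def by (intro cintro AB k)+
qed

section \<open>Events that fix the value and bound the rank of a computation in
  \<open>f\<close>\<close>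

definition val_le :: "nat \<Rightarrow> nat \<Rightarrow> nat \<Rightarrow> (nat \<Rightarrow> bool) set" where
  "val_le p q b = {\<omega>. evals (to_nat_fun \<omega>) q b \<and> rank_le (to_nat_fun \<omega>, q) (zero, p)}"

definition val_less :: "nat \<Rightarrow> nat \<Rightarrow> nat \<Rightarrow> (nat \<Rightarrow> bool) set" where
  "val_less p q b = {\<omega>. evals (to_nat_fun \<omega>) q b \<and> rank_less (to_nat_fun \<omega>, q) (zero, p)}"

text \<open>Tail and children in one sequence, the tail at index 0, so that having rank below
  \<open>p\<close> is one countable union.\<close>

definition sb :: "nat \<Rightarrow> nat \<Rightarrow> nat \<Rightarrow> nat" where
  "sb r p j = (if j = 0 then r else child p (j - 1))"

lemma subcomps_sb:
  assumes "conv zero p" "\<not> is_leaf p" shows "subcomps (zero, p) = range (\<lambda>j. (zero, sb (tail zero p) p j))"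
proof -
  have "range (\<lambda>j. (zero, sb (tail zero p) p j)) = insert (zero, tail zero p) (range (\<lambda>y. (zero, child p y)))"
  proof (intro set_eqI iffI)
    fix z assume "z \<in> insert (zero, tail zero p) (range (\<lambda>y. (zero, child p y)))"
    then show "z \<in> range (\<lambda>j. (zero, sb (tail zero p) p j))"
      by (auto simp: sb_def intro: image_eqI[of _ _ 0] image_eqI[of _ _ "Suc _"])
  qed (auto simp: sb_def)
  then show ?thesis using subcomps_node[OF assms] by simp
qed

lemma val_less_UN:
  assumes "conv zero p" "\<not> is_leaf p" shows "val_less p q b = (\<Union>j. val_le (sb (tail zero p) p j) q b)"
  unfolding val_less_def val_le_def rank_less_def subcomps_sb[OF assms] by auto

lemma val_le_leaf_leaf: "is_leaf q \<Longrightarrow> val_le p q b = {\<omega>. leaf_val (to_nat_fun \<omega>) q = b}"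
  unfolding val_le_def by (auto simp: evals_leaf rank_le_leaf)

lemma val_le_node_leaf: "\<not> is_leaf q \<Longrightarrow> is_leaf p \<Longrightarrow> val_le p q b = {}"
  unfolding val_le_def rank_le_iff[of "(to_nat_fun _, q)"] by (auto simp: subcomps_node subcomps_leaf rank_less_def evals_iff)

lemma Suslin_01: "Suslin h = 1 \<longleftrightarrow> (\<exists>g. \<forall>n. 0 < h (seq_code g n))" "Suslin h = 0 \<or> Suslin h = 1"
  unfolding Suslin_def by auto

text \<open>Rank at most that of \<open>p\<close> means that all children and the tail of
  \<open>q\<close> have rank below it. Which tail is run depends on \<open>f\<close> through the
  value \<open>v\<close> of child 0 and the Suslin functional applied to all values.
  \<open>U s\<close> says that child \<open>s\<close> has a positive value, so once all children are
  bounded that functional is 1 exactly on \<open>susop U\<close>.\<close>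

lemma val_le_node_node:
  fixes p q b :: nat
  assumes q: "\<not> is_leaf q"
  defines "U \<equiv> (\<lambda>s. \<Union>v. val_less p (child q s) (Suc v))"
  shows "val_le p q b = (\<Inter>y. \<Union>v. val_less p (child q y) v) \<inter>
     (\<Union>v. val_less p (child q 0) v \<inter> ((susop U \<inter> val_less p (tail_of q v 1) b) \<union> (- susop U \<inter> val_less p (tail_of q v 0) b)))"
proof -
  have ww: "\<omega> \<in> val_le p q b \<longleftrightarrow> (\<forall>y. \<exists>v. \<omega> \<in> val_less p (child q y) v) \<and>
     (\<exists>v. \<omega> \<in> val_less p (child q 0) v \<and> ((\<omega> \<in> susop U \<and> \<omega> \<in> val_less p (tail_of q v 1) b) \<or> (\<omega> \<notin> susop U \<and> \<omega> \<in> val_less p (tail_of q v 0) b)))"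
    (is "?L \<longleftrightarrow> ?A \<and> ?B") for \<omega>
  proof -
    let ?f = "to_nat_fun \<omega>"
    let ?h = "\<lambda>y. result ?f (child q y)"
    have A: "?A \<longleftrightarrow> (\<forall>y. conv ?f (child q y) \<and> rank_less (?f, child q y) (zero, p))"
      unfolding val_less_def by (auto simp: evals_iff)
    have U: "\<omega> \<in> susop U \<longleftrightarrow> Suslin ?h = 1" if ?A
    proof -
      have "\<omega> \<in> U s \<longleftrightarrow> 0 < ?h s" for s
        using that unfolding A U_def val_less_def by (auto simp: evals_iff gr0_conv_Suc)
      then show ?thesis unfolding susop_def Suslin_01(1) by simp
    qed
    have B: "?B \<longleftrightarrow> \<omega> \<in> val_less p (tail ?f q) b" if a: ?A
    proof -
      have c0: "\<omega> \<in> val_less p (child q 0) v \<longleftrightarrow> v = ?h 0" for v using a unfolding A by (auto simp: val_less_def evals_iff)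
      have r: "tail ?f q = tail_of q (?h 0) (Suslin ?h)" by (simp add: tail_def)
      show ?thesis unfolding c0 U[OF a] r using Suslin_01(2)[of ?h] by auto
    qed
    have L: "?L \<longleftrightarrow> ?A \<and> \<omega> \<in> val_less p (tail ?f q) b"
    proof
      assume l: ?L
      then have c: "conv ?f q" "result ?f q = b" and le: "rank_le (?f, q) (zero, p)" by (auto simp: val_le_def evals_iff)
      have sub: "rank_less s (zero, p)" if "s \<in> subcomps (?f, q)" for s using le that rank_le_iff by blast
      show "?A \<and> \<omega> \<in> val_less p (tail ?f q) b"
        unfolding A val_less_def using c conv_node[OF q, of ?f] result_node[OF q c(1)] sub subcomps_node[OF c(1) q]
        by (auto simp: evals_iff)
    next
      assume r: "?A \<and> \<omega> \<in> val_less p (tail ?f q) b"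
      then have c: "conv ?f q" unfolding A val_less_def using conv_node[OF q, of ?f] by (auto simp: evals_iff)
      have "rank_le (?f, q) (zero, p)" unfolding rank_le_iff[of "(?f, q)"] subcomps_node[OF c q]
        using r unfolding A val_less_def by auto
      then show ?L using r c result_node[OF q c] unfolding val_le_def val_less_def by (auto simp: evals_iff)
    qed
    show ?thesis using L B by blast
  qed
  show ?thesis by (rule set_eqI) (unfold ww, blast)
qed

text \<open>S7 is the only leaf that reads \<open>f\<close>, and it returns one bit: values other
  than 0 and 1 get the empty set. Any other leaf has a constant value, and its event is empty or
  everything.\<close>

definition leafcode :: "nat \<Rightarrow> nat \<Rightarrow> nat" where
  "leafcode q b = (if pf q = 0 \<and> chd (pf (ps q)) = 7
     then (if b = 1 then cbit (chd (ps (ps q))) else if b = 0 then cneg (cbit (chd (ps (ps q)))) else 0)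
     else if leaf_val zero q = b then 1 else 0)"

lemma clopen_leafcode: "clopen (leafcode q b) = {\<omega>. leaf_val (to_nat_fun \<omega>) q = b}"
proof (cases "pf q = 0 \<and> chd (pf (ps q)) = 7")
  case True
  then have "leaf_val (to_nat_fun \<omega>) q = (if \<omega> (chd (ps (ps q))) then 1 else 0)" for \<omega>
    by (simp add: leaf_val_def kleene_val_def to_nat_fun_def)
  moreover have "leafcode q b = (if b = 1 then cbit (chd (ps (ps q))) else if b = 0 then cneg (cbit (chd (ps (ps q)))) else 0)"
    using True by (simp add: leafcode_def)
  ultimately show ?thesis by (simp add: clopen_cbit clopen_cneg Collect_neg_eq)
next
  case False
  then have "leaf_val (to_nat_fun \<omega>) q = leaf_val zero q" for \<omega>
    by (auto simp: leaf_val_def kleene_val_def)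
  moreover have "leafcode q b = (if leaf_val zero q = b then 1 else 0)"
    unfolding leafcode_def using False by (simp only: if_False)
  ultimately show ?thesis by simp
qed

lemma computable_leafcode [cintro]: "computable gs a \<Longrightarrow> computable gs b \<Longrightarrow> computable gs (\<lambda>\<nu> x. leafcode (a \<nu> x) (b \<nu> x))"
  unfolding leafcode_def by (intro cintro)

definition val_less_name :: "(nat \<Rightarrow> nat) \<Rightarrow> nat \<Rightarrow> nat \<Rightarrow> nat \<Rightarrow> nat" where
  "val_less_name M q b k = UNn (\<lambda>j k. M (pr j (pr q (pr b k)))) k"

definition suslin_name :: "(nat \<Rightarrow> nat) \<Rightarrow> nat \<Rightarrow> nat \<Rightarrow> nat" where
  "suslin_name M q k = SUSn (\<lambda>s k. UNn (\<lambda>v k. val_less_name M (child q s) (Suc v) k) k) k"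

definition val_le_name :: "(nat \<Rightarrow> nat) \<Rightarrow> nat \<Rightarrow> nat \<Rightarrow> nat \<Rightarrow> nat" where
  "val_le_name M q b k = ANDn (\<lambda>k. INTn (\<lambda>y k. UNn (\<lambda>v k. val_less_name M (child q y) v k) k) k)
     (\<lambda>k. UNn (\<lambda>v k. ANDn (\<lambda>k. val_less_name M (child q 0) v k)
        (\<lambda>k. ORn (\<lambda>k. ANDn (\<lambda>k. suslin_name M q k) (\<lambda>k. val_less_name M (tail_of q v 1) b k) k)
                  (\<lambda>k. ANDn (\<lambda>k. cneg (suslin_name M q k)) (\<lambda>k. val_less_name M (tail_of q v 0) b k) k) k) k) k) k"

lemma computable_Xn: "computable gs (\<lambda>\<nu> x. val_le_name \<nu> (pf x) (pf (ps x)) (ps (ps x)))"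
proof -
  have "computable gs (\<lambda>\<nu> x. val_less_name \<nu> (pf x) (pf (ps x)) (ps (ps x)))" unfolding val_less_name_def by (intro cintro)
  note Y = computable_app3[where N = "\<lambda>\<nu> a b c. val_less_name \<nu> a b c", OF this]
  have "computable gs (\<lambda>\<nu> x. suslin_name \<nu> (pf x) (ps x))" unfolding suslin_name_def by (intro cintro Y)
  from computable_comp[OF this, of "\<lambda>\<nu> x. pr (a \<nu> x) (b \<nu> x)" for a b]
  have S: "computable gs a \<Longrightarrow> computable gs b \<Longrightarrow> computable gs (\<lambda>\<nu> x. suslin_name \<nu> (a \<nu> x) (b \<nu> x))" for a b by (simp add: computable_pr)
  show ?thesis unfolding val_le_name_def by (intro cintro Y S)
qed

lemma named_Xn:
  assumes p: "conv zero p" "\<not> is_leaf p" and q: "\<not> is_leaf q"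
    and M: "\<And>j q b. named (val_le (sb (tail zero p) p j) q b) (\<lambda>k. M (pr j (pr q (pr b k))))"
  shows "named (val_le p q b) (val_le_name M q b)"
proof -
  have Y: "named (val_less p q b) (\<lambda>k. val_less_name M q b k)" for q b
    unfolding val_less_UN[OF p] val_less_name_def using named_UN[OF M] .
  have S: "named (susop (\<lambda>s. \<Union>v. val_less p (child q s) (Suc v))) (\<lambda>k. suslin_name M q k)"
    unfolding suslin_name_def by (intro named_SUS named_UN Y)
  show ?thesis
    unfolding val_le_node_node[OF q] val_le_name_def[abs_def]
    by (intro named_AND named_OR named_INT named_UN named_neg Y S)
qed

text \<open>The recursion is on \<open>p\<close> alone. The event for \<open>q\<close> at
  \<open>p\<close> refers to other computations in \<open>f\<close>, but only at immediate
  subcomputations of \<open>p\<close>, so \<open>q\<close> and \<open>b\<close> stay universally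
  quantified; in particular \<open>q\<close> may diverge.\<close>

theorem naming:
  "\<exists>E. \<forall>p. conv zero p \<longrightarrow> (\<forall>q b. \<exists>\<nu>. named (val_le p q b) \<nu> \<and> (\<forall>k. run gs E (pr p (pr q (pr b k))) (\<nu> k)))"
proof -
  define \<phi> where "\<phi> = (\<lambda>(\<nu> :: nat \<Rightarrow> nat option) x.
    if is_leaf (pf (ps x)) then Some (leafcode (pf (ps x)) (pf (ps (ps x))))
    else if is_leaf (pf x) then Some 0
    else Option.bind (tail_opt (pf x)) (\<lambda>r.
      olift (\<lambda>\<nu> x. val_le_name \<nu> (pf x) (pf (ps x)) (ps (ps x))) (\<lambda>n. \<nu> (pr (sb r (pf x) (pf n)) (ps n))) (ps x)))"
  have "pcomputable gs \<phi>"
    unfolding \<phi>_def sb_def by (intro pcomputable_if pcomputable_bind pcomputable_olift pcomputable_Some pcomputable_call pcomputable_pcf[OF partial_computable_To] computable_Xn cintro)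
  from pcomputable_rec[OF this] obtain z where z: "\<And>x v \<nu>. (\<And>n w. \<nu> n = Some w \<Longrightarrow> run gs z n w) \<Longrightarrow>
     \<phi> \<nu> x = Some v \<Longrightarrow> run gs z x v" by blast
  have main: "conv f p \<Longrightarrow> f = zero \<Longrightarrow> \<forall>q b. \<exists>\<nu>. named (val_le p q b) \<nu> \<and> (\<forall>k. run gs z (pr p (pr q (pr b k))) (\<nu> k))" for f p
  proof (induct "(f, p)" arbitrary: p rule: subcomps_induct)
    case 1
    show ?case
    proof (intro allI)
      fix q b
      show "\<exists>\<nu>. named (val_le p q b) \<nu> \<and> (\<forall>k. run gs z (pr p (pr q (pr b k))) (\<nu> k))"
      proof (cases "is_leaf q")
        case True
        have "named (val_le p q b) (\<lambda>_. leafcode q b)"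
          using named_clopen[of "leafcode q b"] unfolding val_le_leaf_leaf[OF True] clopen_leafcode .
        moreover have "run gs z (pr p (pr q (pr b k))) (leafcode q b)" for k
          by (rule z[of "\<lambda>_. None"]) (simp_all add: \<phi>_def True)
        ultimately show ?thesis by blast
      next
        case q: False
        show ?thesis
        proof (cases "is_leaf p")
          case True
          have "named (val_le p q b) (\<lambda>_. 0)" using named_clopen[of 0] unfolding val_le_node_leaf[OF q True] by simp
          moreover have "run gs z (pr p (pr q (pr b k))) 0" for k
            by (rule z[of "\<lambda>_. None"]) (simp_all add: \<phi>_def True q)
          ultimately show ?thesis by blast
        next
          case p: False
          have cp: "conv zero p" using 1(2,3) by simp
          let ?t = "sb (tail zero p) p"
          have "\<exists>\<nu>. named (val_le t q b) \<nu> \<and> (\<forall>k. run gs z (pr t (pr q (pr b k))) (\<nu> k))" if "t \<in> range ?t" for t q b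
          proof -
            have "(f, t) \<in> subcomps (f, p)" using subcomps_sb[OF cp p] 1(3) that by auto
            moreover have "conv f t" using cp 1(3) conv_node[OF p, of zero] that by (auto simp: sb_def)
            ultimately show ?thesis using 1(1) 1(3) by blast
          qed
          then obtain V where V: "\<And>t q b. t \<in> range ?t \<Longrightarrow> named (val_le t q b) (V t q b)"
            "\<And>t q b k. t \<in> range ?t \<Longrightarrow> run gs z (pr t (pr q (pr b k))) (V t q b k)" by metis
          define v where "v n = V (pf n) (pf (ps n)) (pf (ps (ps n))) (ps (ps (ps n)))" for n
          define M where "M n = v (pr (?t (pf n)) (ps n))" for n
          have named: "named (val_le p q b) (val_le_name M q b)"
            by (rule named_Xn[OF cp p q]) (simp add: M_def v_def V)
          have "run gs z (pr p (pr q (pr b k))) (val_le_name M q b k)" for k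
          proof -
            define \<nu> where "\<nu> n = (if run gs z n (v n) then Some (v n) else None)" for n
            have 1: "run gs z n w" if "\<nu> n = Some w" for n w using that by (simp add: \<nu>_def split: if_split_asm)
            have "run gs z (pr (?t (pf n)) (ps n)) (v (pr (?t (pf n)) (ps n)))" for n
              using V(2)[of "?t (pf n)" "pf (ps n)" "pf (ps (ps n))" "ps (ps (ps n))"] by (simp add: v_def)
            then have "olift (\<lambda>\<nu> x. val_le_name \<nu> (pf x) (pf (ps x)) (ps (ps x))) (\<lambda>n. \<nu> (pr (?t (pf n)) (ps n))) (pr q (pr b k))
              = Some (val_le_name M q b k)"
              by (subst olift_Some[where h = M]) (simp_all add: M_def \<nu>_def)
            moreover have "tail_opt p = Some (tail zero p)" using cp conv_node[OF p, of zero] by (simp add: tail_opt_def)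
            ultimately have *: "\<phi> \<nu> (pr p (pr q (pr b k))) = Some (val_le_name M q b k)"
              by (simp add: \<phi>_def p q)
            show ?thesis by (rule z[of \<nu>, OF _ *]) (rule 1)
          qed
          then show ?thesis using named by blast
        qed
      qed
    qed
  qed
  then show ?thesis by blast
qed

section \<open>Uniformity of ranks almost everywhere\<close>

definition conv_le :: "nat \<Rightarrow> nat \<Rightarrow> (nat \<Rightarrow> bool) set" where
  "conv_le p q = {\<omega>. conv (to_nat_fun \<omega>) q \<and> rank_le (to_nat_fun \<omega>, q) (zero, p)}"

definition conv_le_upto :: "nat \<Rightarrow> nat \<Rightarrow> nat \<Rightarrow> (nat \<Rightarrow> bool) set" where
  "conv_le_upto q y p = (\<Inter>z. if z \<le> y then conv_le p (child q z) else UNIV)"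

lemma conv_le_UN: "conv_le p q = (\<Union>b. val_le p q b)"
  unfolding conv_le_def val_le_def by (auto simp: conv_def)

lemma conv_le_evs: "conv zero p \<Longrightarrow> conv_le p q \<in> evs"
  unfolding conv_le_UN using naming[of "[]"] named_evs by (intro sets.countable_UN) blast

lemma conv_le_upto_evs: "conv zero p \<Longrightarrow> conv_le_upto q y p \<in> evs"
  unfolding conv_le_upto_def using conv_le_evs sets.top[of cantor_measure] by (intro sets.countable_INT) auto

lemma conv_le_mono: "rank_le (zero, p) (zero, p') \<Longrightarrow> conv_le p q \<subseteq> conv_le p' q"
  unfolding conv_le_def using rank_le_trans by blast

lemma conv_le_upto_mono: "rank_le (zero, p) (zero, p') \<Longrightarrow> conv_le_upto q y p \<subseteq> conv_le_upto q y p'"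
  unfolding conv_le_upto_def using conv_le_mono by (intro INT_anti_mono) auto

text \<open>A strict lower bound shows at some finite precision \<open>j\<close>: the approximation
  must exceed it by its own error \<open>1 / 2 ^ j\<close>, and the summand 1, worth
  \<open>1 / 2 ^ (l + j)\<close>, secures strictness.\<close>

lemma named_exceeds:
  assumes "named A \<nu>"
  shows "real i / 2 ^ l < \<mu> A \<longleftrightarrow> (\<exists>j. i * 2 ^ j + 2 ^ l + 1 \<le> clopen_floor (\<nu> j) (l + j))"
proof -
  have d: "\<mu> A \<le> \<mu> (clopen (\<nu> j)) + 1 / 2 ^ j" "\<mu> (clopen (\<nu> j)) \<le> \<mu> A + 1 / 2 ^ j" for j
    using mdist_measure[OF named_evs[OF assms] clopen_sets[of "\<nu> j"]] mdist_measure[OF clopen_sets[of "\<nu> j"] named_evs[OF assms]]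
      named_dd[OF assms, of j] mdist_sym[of A "clopen (\<nu> j)"] by linarith+
  have le: "i * 2 ^ j + 2 ^ l + 1 \<le> clopen_floor (\<nu> j) (l + j) \<longleftrightarrow>
      real i / 2 ^ l + 1 / 2 ^ j + 1 / 2 ^ (l + j) \<le> \<mu> (clopen (\<nu> j))" for j
    unfolding le_fl_iff by (simp add: field_simps power_add)
  show ?thesis
  proof
    assume "real i / 2 ^ l < \<mu> A"
    \<comment> \<open>Three shares: the error of the name, the margin \<open>1 / 2 ^ j\<close>, and
      \<open>1 / 2 ^ (l + j)\<close>, which is no larger.\<close>
    then obtain j where j: "(1 / 2) ^ j < (\<mu> A - real i / 2 ^ l) / 3"
      using real_arch_pow_inv[of "(\<mu> A - real i / 2 ^ l) / 3" "1 / 2"] by auto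
    have "1 / 2 ^ (l + j) \<le> (1 / 2 ^ j :: real)" by (intro divide_left_mono) (auto simp: power_increasing)
    then have "real i / 2 ^ l + 1 / 2 ^ j + 1 / 2 ^ (l + j) \<le> \<mu> (clopen (\<nu> j))"
      using j d(1)[of j] unfolding power_one_over by argo
    then show "\<exists>j. i * 2 ^ j + 2 ^ l + 1 \<le> clopen_floor (\<nu> j) (l + j)" using le by blast
  next
    assume "\<exists>j. i * 2 ^ j + 2 ^ l + 1 \<le> clopen_floor (\<nu> j) (l + j)"
    then obtain j where "real i / 2 ^ l + 1 / 2 ^ j + 1 / 2 ^ (l + j) \<le> \<mu> (clopen (\<nu> j))" using le by blast
    moreover have "0 < (1 / 2 ^ (l + j) :: real)" by simp
    ultimately show "real i / 2 ^ l < \<mu> A" using d(2)[of j] by linarith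
  qed
qed

text \<open>The test that selection searches with. It must terminate for every convergent
  \<open>p\<close>, and the answer 0 stands for success, because \<open>stChk\<close> diverges on
  any other value.\<close>

lemma threshold:
  "\<exists>e. \<forall>y p. conv zero p \<longrightarrow> run gs e (pr y p) (if real i / 2 ^ l < \<mu> (conv_le_upto q y p) then 0 else 1)"
proof -
  obtain E where E: "\<forall>p. conv zero p \<longrightarrow> (\<forall>q b. \<exists>\<nu>. named (val_le p q b) \<nu> \<and> (\<forall>k. run gs E (pr p (pr q (pr b k))) (\<nu> k)))"
    using naming by blast
  then have "\<forall>p q b. \<exists>\<nu>. conv zero p \<longrightarrow> named (val_le p q b) \<nu> \<and> (\<forall>k. run gs E (pr p (pr q (pr b k))) (\<nu> k))"
    by blast
  then obtain V where V: "\<And>p q b. conv zero p \<Longrightarrow> named (val_le p q b) (V p q b)"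
    "\<And>p q b k. conv zero p \<Longrightarrow> run gs E (pr p (pr q (pr b k))) (V p q b k)" by metis
  define T where "T x = (if conv zero (pf x) then Some (V (pf x) (pf (ps x)) (pf (ps (ps x))) (ps (ps (ps x)))) else None)" for x
  have "run gs E x v" if "T x = Some v" for x v
    using that V(2)[of "pf x" "pf (ps x)" "pf (ps (ps x))" "ps (ps (ps x))"] by (simp add: T_def split: if_split_asm)
  then have T: "partial_computable gs T" unfolding partial_computable_def by blast
  let ?N = "\<lambda>\<nu> y j. INTn (\<lambda>z k. if z \<le> y then UNn (\<lambda>b k. \<nu> (pr z (pr b k))) k else 1) j"
  let ?O = "\<lambda>\<nu> x. 1 - of_bool (\<exists>j. i * 2 ^ j + 2 ^ l + 1 \<le> clopen_floor (?N \<nu> (pf x) j) (l + j)) :: nat"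
  have "computable gs ?O" by (intro cintro)
  then have "pcomputable gs (\<lambda>\<nu> x. olift ?O (\<lambda>n. T (pr (ps x) (pr (child q (pf n)) (ps n)))) x)"
    by (intro pcomputable_olift pcomputable_pcf[OF T] cintro)
  from pcomputable_pcfD[OF this] obtain e where e: "\<And>x v. olift ?O (\<lambda>n. T (pr (ps x) (pr (child q (pf n)) (ps n)))) x = Some v \<Longrightarrow> run gs e x v"
    unfolding partial_computable_def by blast
  have "run gs e (pr y p) (if real i / 2 ^ l < \<mu> (conv_le_upto q y p) then 0 else 1)" if p: "conv zero p" for y p
  proof (rule e)
    define M where "M n = V p (child q (pf n)) (pf (ps n)) (ps (ps n))" for n
    have "named (\<Inter>z. if z \<le> y then (\<Union>b. val_le p (child q z) b) else UNIV)
        (INTn (\<lambda>z k. if z \<le> y then UNn (\<lambda>b k. M (pr z (pr b k))) k else 1))"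
    proof (rule named_INT)
      fix z
      show "named (if z \<le> y then (\<Union>b. val_le p (child q z) b) else UNIV) (\<lambda>k. if z \<le> y then UNn (\<lambda>b k. M (pr z (pr b k))) k else 1)"
      proof (cases "z \<le> y")
        case True
        have "named (\<Union>b. val_le p (child q z) b) (UNn (\<lambda>b k. M (pr z (pr b k))))"
          by (rule named_UN) (simp add: M_def V p)
        then show ?thesis using True by simp
      next
        case False
        then show ?thesis using named_clopen[of 1] by simp
      qed
    qed
    then have "named (conv_le_upto q y p) (?N M y)" unfolding conv_le_upto_def conv_le_UN .
    note x = named_exceeds[OF this, of i l]
    have "olift ?O (\<lambda>n. T (pr p (pr (child q (pf n)) (ps n)))) (pr y p) = Some (?O M (pr y p))"
      by (rule olift_Some) (simp add: T_def p M_def)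
    then show "olift ?O (\<lambda>n. T (pr (ps (pr y p)) (pr (child q (pf n)) (ps n)))) (pr y p)
       = Some (if real i / 2 ^ l < \<mu> (conv_le_upto q y p) then 0 else 1)"
      unfolding x by (simp only: ps_pr pf_pr) simp
  qed
  then show ?thesis by blast
qed

section \<open>Gandy selection on the machine\<close>

lemma run_imp_ev: "run [] e x v \<Longrightarrow> evals zero (stK e (ccons x 0)) v"
  unfolding run_def using kc_imp_ev[of e "[x]" "[]" v zero] by (simp add: ccons_def)

lemma conv_L: "conv f (stL v)"
  by (rule conv_leaf) simp

lemma conv_Seq: "conv f (stSeq p q) \<longleftrightarrow> conv f p \<and> conv f q"
  by (subst conv_node) (simp_all add: tail_def)

lemma rank_less_Seq: "conv f (stSeq p q) \<Longrightarrow> rank_less (f, p) (f, stSeq p q)" "conv f (stSeq p q) \<Longrightarrow> rank_less (f, q) (f, stSeq p q)"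
  by (rule rank_less_Sub; simp add: subcomps_node tail_def)+

lemma not_conv_Div: "\<not> conv f stDiv"
proof -
  have "evals f p b \<Longrightarrow> p \<noteq> stDiv" for p b
  proof (induct rule: evals.induct)
    case (leaf p)
    then show ?case by auto
  next
    case (node p h b)
    then show ?case by auto
  qed
  then show ?thesis unfolding conv_def by blast
qed

text \<open>Gandy's selection argument: \<open>stSel\<close> compares the rank of the \<open>w\<close>-th candidate with the
  rank of the search from \<open>w + 1\<close> on, so that it converges as soon as some candidate does.\<close>

lemma selection:
  assumes e: "\<And>y p. conv zero p \<Longrightarrow> run [] e (pr y p) (if Q y p then 0 else 1)"
    and ex: "\<And>y. \<exists>p. conv zero p \<and> Q y p"
  shows "\<exists>P. conv zero P \<and> (\<forall>y. \<exists>p. conv zero p \<and> Q y p \<and> rank_less (zero, p) (zero, P))"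
proof -
  obtain k where k: "\<And>p q. conv zero p \<or> conv zero q \<Longrightarrow> run [] k (pr p q) (if stage_le p q then 0 else 1)"
    using stage_comparison by blast
  have cand: "conv zero (stCand e y w) \<longleftrightarrow> conv zero w \<and> Q y w" for y w
  proof (cases "conv zero w")
    case True
    have "evals zero (stK e (ccons (pr y w) 0)) (if Q y w then 0 else 1)" by (rule run_imp_ev[OF e[OF True]])
    then have "conv zero (stK e (ccons (pr y w) 0))" "result zero (stK e (ccons (pr y w) 0)) = (if Q y w then 0 else 1)"
      by (simp_all add: evals_iff)
    then have "conv zero (stChk e (pr y w)) \<longleftrightarrow> Q y w"
      by (subst conv_node) (auto simp: tail_def conv_L not_conv_Div)
    then show ?thesis using True unfolding stCand_def conv_Seq by simp
  qed (simp add: stCand_def conv_Seq)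
  have cmp: "conv zero (stK k (ccons (pr p q) 0)) \<and> result zero (stK k (ccons (pr p q) 0)) = (if stage_le p q then 0 else 1)"
    if "conv zero p \<or> conv zero q" for p q
    using run_imp_ev[OF k[OF that]] by (simp add: evals_iff)
  \<comment> \<open>If the comparison favours the candidate, \<open>stage_le\<close> says that it
    converges. Otherwise the search from \<open>Suc w\<close> on must converge, because a divergent
    one would count as infinite.\<close>
  have step: "conv zero (stSel k e y w)" if c: "conv zero (stCand e y w) \<or> conv zero (stSel k e y (Suc w))" for y w
    using cmp[OF c] c by (subst conv_node) (auto simp: tail_def conv_Seq conv_L stage_le_def)
  have down: "conv zero (stCand e y n) \<Longrightarrow> conv zero (stSel k e y (n - d))" for y n d
  proof (induct d)
    case 0
    then show ?case by (simp add: step)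
  next
    case (Suc d)
    show ?case
    proof (cases "d < n")
      case True
      then have "Suc (n - Suc d) = n - d" by simp
      then show ?thesis using Suc by (intro step) simp
    next
      case False
      then show ?thesis using Suc by simp
    qed
  qed
  have sel: "conv zero (stSel k e y 0)" for y
  proof -
    obtain p where "conv zero p" "Q y p" using ex by blast
    then show ?thesis using down[of y p p] cand by simp
  qed
  \<comment> \<open>When a candidate is passed over, the tail is again a search state, so the
    induction on the evaluation has to generalize over the starting point \<open>w\<close>.\<close>
  have leaf_val: "evals zero s v \<Longrightarrow> s = stSel k e y w \<Longrightarrow> conv zero (stCand e y v)" for s v y w
  proof (induct arbitrary: w rule: evals.induct)
    case (leaf p)
    then show ?case by simp
  next
    case (node p h b)
    show ?case
    proof (cases "h 0 = 0")
      case True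
      then have E: "evals zero (stSeq (stCand e y w) (stL w)) b" using node(4,6) by simp
      then have "conv zero (stCand e y w)" "result zero (stSeq (stCand e y w) (stL w)) = b" by (simp_all add: evals_iff conv_Seq)
      moreover have "result zero (stSeq (stCand e y w) (stL w)) = w"
      proof -
        have "tail zero (stSeq (stCand e y w) (stL w)) = stL w" by (simp add: tail_def)
        moreover have "result zero (stL w) = w" by (rule result_eq) simp
        ultimately show ?thesis
          using result_node[of "stSeq (stCand e y w) (stL w)" zero] E conv_def by force
      qed
      ultimately show ?thesis by simp
    next
      case False
      then show ?thesis using node(5,6) by simp
    qed
  qed
  define c where "c y = result zero (stSel k e y 0)" for y
  have c: "conv zero (c y)" "Q y (c y)" for y
    using leaf_val[OF conv_ev[OF sel] refl, of y] cand unfolding c_def by blast+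
  have rtV: "tail zero (stV k e y) = c y" for y by (simp add: tail_def c_def)
  have V: "conv zero (stV k e y)" for y
    by (subst conv_node) (simp_all add: rtV c sel)
  have S: "conv zero (stSup k e)"
    by (subst conv_node) (simp_all add: tail_def V conv_L)
  have "rank_less (zero, c y) (zero, stSup k e)" for y
  proof -
    have "(zero, c y) \<in> subcomps (zero, stV k e y)" using V by (simp add: subcomps_node rtV)
    moreover have "(zero, stV k e y) \<in> subcomps (zero, stSup k e)" using S by (simp add: subcomps_node)
    ultimately show ?thesis using rank_less_Sub rank_less_rle rank_le_rlt_trans by blast
  qed
  then show ?thesis using S c by blast
qed

section \<open>From a bound for each child to a common bound\<close>

definition children_bounded :: "nat \<Rightarrow> (nat \<Rightarrow> bool) set" where
  "children_bounded q = (\<Inter>y. \<Union>p\<in>{p. conv zero p}. conv_le p (child q y))"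

definition children_unif_bounded :: "nat \<Rightarrow> (nat \<Rightarrow> bool) set" where
  "children_unif_bounded q = (\<Union>p\<in>{p. conv zero p}. \<Inter>y. conv_le p (child q y))"

text \<open>Run the convergent computations one after another, with a leaf in place of each
  divergent number. The sequence is not computable; it only serves continuity of measure along
  increasing sets.\<close>

lemma cofinal_sequence:
  "\<exists>s :: nat \<Rightarrow> nat. (\<forall>n. conv zero (s n)) \<and> (\<forall>n m. n \<le> m \<longrightarrow> rank_le (zero, s n) (zero, s m)) \<and> (\<forall>p. conv zero p \<longrightarrow> (\<exists>n. rank_le (zero, p) (zero, s n)))"
proof -
  define d where "d n = (if conv zero n then n else stL 0)" for n
  have d: "conv zero (d n)" for n by (simp add: d_def conv_L)
  define s where "s = rec_nat (d 0) (\<lambda>n p. stSeq p (d (Suc n)))"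
  have s: "conv zero (s n)" for n by (induct n) (simp_all add: s_def d conv_Seq)
  have step: "rank_le (zero, s n) (zero, s (Suc n))" for n
    using rank_less_Seq(1)[of zero "s n" "d (Suc n)"] s[of "Suc n"] rank_less_rle by (simp add: s_def)
  have mono: "rank_le (zero, s n) (zero, s m)" if "n \<le> m" for n m
    using that by (induct m rule: dec_induct) (blast intro: rank_le_refl rank_le_trans step)+
  have "rank_le (zero, d n) (zero, s n)" for n
  proof (cases n)
    case 0
    then show ?thesis by (simp add: s_def rank_le_refl)
  next
    case (Suc m)
    then show ?thesis using rank_less_Seq(2)[of zero "s m" "d (Suc m)"] s[of "Suc m"] rank_less_rle by (simp add: s_def)
  qed
  then have "\<exists>n. rank_le (zero, p) (zero, s n)" if "conv zero p" for p using that by (metis d_def)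
  then show ?thesis using s mono by blast
qed

lemma children_bounded_Ge_evs: "children_bounded q \<in> evs" "children_unif_bounded q \<in> evs"
  unfolding children_bounded_def children_unif_bounded_def
  by (intro sets.countable_INT sets.countable_UN' image_subsetI; use conv_le_evs in \<open>auto intro!: sets.countable_UN' sets.countable_INT simp: countable_subset[OF subset_UNIV]\<close>)+

lemma children_bounded_Ge_null: "children_bounded q - children_unif_bounded q \<in> null_sets cantor_measure"
proof -
  have sub: "children_unif_bounded q \<subseteq> children_bounded q" unfolding children_bounded_def children_unif_bounded_def by blast
  have "\<mu> (children_bounded q) \<le> \<mu> (children_unif_bounded q)"
  proof (rule ccontr)
    assume "\<not> \<mu> (children_bounded q) \<le> \<mu> (children_unif_bounded q)"
    \<comment> \<open>Dyadic, since \<open>threshold\<close> compares with such numbers only, and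
      strictly above the smaller measure, since the limit over \<open>y\<close> leaves just a weak
      inequality.\<close>
    then obtain i l where r: "\<mu> (children_unif_bounded q) < real i / 2 ^ l" "real i / 2 ^ l < \<mu> (children_bounded q)"
      using dyadic_between[of "\<mu> (children_unif_bounded q)" "\<mu> (children_bounded q)"] by auto
    obtain e where e: "\<And>y p. conv zero p \<Longrightarrow> run [] e (pr y p) (if real i / 2 ^ l < \<mu> (conv_le_upto q y p) then 0 else 1)"
      using threshold[of "[]"] by blast
    obtain s :: "nat \<Rightarrow> nat" where s: "\<And>n. conv zero (s n)" "\<And>n m. n \<le> m \<Longrightarrow> rank_le (zero, s n) (zero, s m)"
      "\<And>p. conv zero p \<Longrightarrow> \<exists>n. rank_le (zero, p) (zero, s n)" using cofinal_sequence by blast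
    have ex: "\<exists>p. conv zero p \<and> real i / 2 ^ l < \<mu> (conv_le_upto q y p)" for y :: nat
    proof -
      have "children_bounded q \<subseteq> (\<Union>n. conv_le_upto q y (s n))"
      proof
        fix \<omega> assume "\<omega> \<in> children_bounded q"
        then have "\<forall>z. \<exists>p. conv zero p \<and> \<omega> \<in> conv_le p (child q z)" unfolding children_bounded_def by blast
        then have "\<forall>z. \<exists>n. \<omega> \<in> conv_le (s n) (child q z)" using s(3) conv_le_mono by blast
        then obtain n where n: "\<And>z. \<omega> \<in> conv_le (s (n z)) (child q z)" by metis
        let ?m = "Max (n ` {..y})"
        have "\<omega> \<in> conv_le (s ?m) (child q z)" if "z \<le> y" for z
        proof -
          have "n z \<le> ?m" using that by (intro Max_ge) auto
          then show ?thesis using n[of z] s(2) conv_le_mono by blast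
        qed
        then have "\<omega> \<in> conv_le_upto q y (s ?m)" unfolding conv_le_upto_def by auto
        then show "\<omega> \<in> (\<Union>n. conv_le_upto q y (s n))" by blast
      qed
      moreover have fs: "conv_le_upto q y (s n) \<in> evs" for n using conv_le_upto_evs s(1) by blast
      ultimately have "\<mu> (children_bounded q) \<le> \<mu> (\<Union>n. conv_le_upto q y (s n))" by (intro CM.finite_measure_mono) auto
      then have "real i / 2 ^ l < \<mu> (\<Union>n. conv_le_upto q y (s n))" using r(2) by linarith
      moreover have "(\<lambda>n. \<mu> (conv_le_upto q y (s n))) \<longlonglongrightarrow> \<mu> (\<Union>n. conv_le_upto q y (s n))"
      proof (rule CM.finite_Lim_measure_incseq)
        show "incseq (\<lambda>n. conv_le_upto q y (s n))" unfolding incseq_def using conv_le_upto_mono s(2) by blast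
      qed (use fs in auto)
      ultimately have "\<forall>\<^sub>F n in sequentially. real i / 2 ^ l < \<mu> (conv_le_upto q y (s n))"
        by (intro order_tendstoD(1)) auto
      then show ?thesis using s(1) by (auto simp: eventually_sequentially)
    qed
    obtain P where P: "conv zero P" "\<And>y. \<exists>p. conv zero p \<and> real i / 2 ^ l < \<mu> (conv_le_upto q y p) \<and> rank_less (zero, p) (zero, P)"
      using selection[of e "\<lambda>y p. real i / 2 ^ l < \<mu> (conv_le_upto q y p)", OF e ex] by blast
    have PP: "real i / 2 ^ l \<le> \<mu> (conv_le_upto q y P)" for y
    proof -
      obtain p where p: "conv zero p" "real i / 2 ^ l < \<mu> (conv_le_upto q y p)" "rank_less (zero, p) (zero, P)" using P(2) by blast
      have "\<mu> (conv_le_upto q y p) \<le> \<mu> (conv_le_upto q y P)"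
        using conv_le_upto_mono[OF rank_less_rle[OF p(3)]] conv_le_upto_evs[OF P(1)] by (intro CM.finite_measure_mono) auto
      then show ?thesis using p(2) by linarith
    qed
    have "(\<lambda>y. \<mu> (conv_le_upto q y P)) \<longlonglongrightarrow> \<mu> (\<Inter>y. conv_le_upto q y P)"
    proof (rule CM.finite_Lim_measure_decseq)
      show "decseq (\<lambda>y. conv_le_upto q y P)" by (rule decseq_SucI) (auto simp: conv_le_upto_def split: if_splits)
    qed (use conv_le_upto_evs[OF P(1)] in auto)
    then have "real i / 2 ^ l \<le> \<mu> (\<Inter>y. conv_le_upto q y P)" using PP by (intro LIMSEQ_le_const) auto
    also have "\<dots> \<le> \<mu> (children_unif_bounded q)"
    proof (rule CM.finite_measure_mono)
      have "(\<Inter>y. conv_le_upto q y P) \<subseteq> (\<Inter>y. conv_le P (child q y))" unfolding conv_le_upto_def by auto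
      then show "(\<Inter>y. conv_le_upto q y P) \<subseteq> children_unif_bounded q" unfolding children_unif_bounded_def using P(1) by blast
    qed (rule children_bounded_Ge_evs)
    finally show False using r(1) by linarith
  qed
  then have "\<mu> (children_bounded q - children_unif_bounded q) = 0"
    using CM.finite_measure_Diff[OF children_bounded_Ge_evs(1,2) sub] measure_nonneg[of cantor_measure "children_bounded q - children_unif_bounded q"] by linarith
  then show ?thesis using children_bounded_Ge_evs[of q] by (auto simp: null_sets_def CM.emeasure_eq_measure)
qed

text \<open>The induction hypothesis bounds each child and thus puts \<open>\<omega>\<close> into
  \<open>children_bounded q\<close>; off the exceptional sets there is then one bound for all
  children. Running it together with a bound for the tail by \<open>stSeq\<close> bounds
  \<open>q\<close>.\<close>

lemma good_outside:
  assumes "\<And>q. \<omega> \<notin> children_bounded q - children_unif_bounded q"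
  shows "good (to_nat_fun \<omega>)"
proof -
  have "conv f q \<Longrightarrow> f = to_nat_fun \<omega> \<Longrightarrow> \<exists>p. conv zero p \<and> rank_le (f, q) (zero, p)" for f q
  proof (induct "(f, q)" arbitrary: q rule: subcomps_induct)
    case 1
    show ?case
    proof (cases "is_leaf q")
      case True
      then show ?thesis using rank_le_leaf conv_L by blast
    next
      case q: False
      note S = subcomps_node[OF 1(2) q]
      have c: "conv f (child q y)" "conv f (tail f q)" for y using conv_node[OF q, of f] 1(2) by auto
      have "\<exists>p. conv zero p \<and> rank_le (f, child q y) (zero, p)" for y
        using 1(1)[of "child q y"] S c 1(3) by blast
      then have "\<omega> \<in> children_bounded q" unfolding children_bounded_def conv_le_def using c 1(3) by auto
      then have "\<omega> \<in> children_unif_bounded q" using assms by blast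
      then obtain p where p: "conv zero p" "\<And>y. rank_le (f, child q y) (zero, p)"
        unfolding children_unif_bounded_def conv_le_def using 1(3) by auto
      obtain p' where p': "conv zero p'" "rank_le (f, tail f q) (zero, p')" using 1(1)[of "tail f q"] S c 1(3) by blast
      have P: "conv zero (stSeq p p')" using p(1) p'(1) by (simp add: conv_Seq)
      have "rank_le (f, q) (zero, stSeq p p')" unfolding rank_le_iff[of "(f, q)"] S
        using rank_le_rlt_trans[OF p(2) rank_less_Seq(1)[OF P]] rank_le_rlt_trans[OF p'(2) rank_less_Seq(2)[OF P]] by blast
      then show ?thesis using P by blast
    qed
  qed
  then show ?thesis unfolding good_def by blast
qed

theorem theorem6p5:
  shows "{f \<in> space cantor_measure. \<exists>W. is_omega1 Suslin [to_nat_fun f] W \<and> is_omega1 Suslin [] W}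
           \<in> sets cantor_measure
       \<and> emeasure cantor_measure
           {f \<in> space cantor_measure. \<exists>W. is_omega1 Suslin [to_nat_fun f] W \<and> is_omega1 Suslin [] W} = 1"
proof -
  let ?S = "{f \<in> space cantor_measure. \<exists>W. is_omega1 Suslin [to_nat_fun f] W \<and> is_omega1 Suslin [] W}"
  let ?N = "\<Union>q. children_bounded q - children_unif_bounded q"
  have N: "?N \<in> null_sets cantor_measure" by (intro null_sets_UN children_bounded_Ge_null)
  have sub: "- ?S \<subseteq> ?N"
  proof
    fix f assume f: "f \<in> - ?S"
    show "f \<in> ?N"
    proof (rule ccontr)
      assume "f \<notin> ?N"
      then have "good (to_nat_fun f)" by (intro good_outside) auto
      \<comment> \<open>The same good \<open>f\<close> settles the empty list of function arguments,
        because those computations never consult \<open>f\<close>.\<close>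
      then have "is_omega1 Suslin [to_nat_fun f] Wrel" "is_omega1 Suslin [] Wrel"
        using is_omega1_Wrel by blast+
      then show False using f by auto
    qed
  qed
  \<comment> \<open>Only the inclusion in a null set is known; measurability of the set itself comes
    from completeness.\<close>
  have nS: "- ?S \<in> null_sets cantor_measure"
    using complete_measure.complete2[OF complete_CM sub N] .
  then have "- (- ?S) \<in> evs" by (rule Compl_evs[OF null_setsD2])
  then have S: "?S \<in> evs" unfolding double_complement .
  have "\<mu> (UNIV - - ?S) = \<mu> UNIV - \<mu> (- ?S)"
    using nS sets.top[of cantor_measure] by (intro CM.finite_measure_Diff) auto
  moreover have "UNIV - - ?S = ?S" by auto
  moreover have "\<mu> (- ?S) = 0" using nS by (simp add: null_sets_def measure_def)
  moreover have "\<mu> UNIV = 1" using CM.prob_space by simp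
  ultimately have "\<mu> ?S = 1" by simp
  then have "emeasure cantor_measure ?S = 1" unfolding CM.emeasure_eq_measure by simp
  with S show ?thesis by blast
qed

end
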